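(* If $G$ has Kazhdan's property (T), then for every generating probability measure $\mu$ on $G$ the set of ergodic actions is nowhere dense in $A_\mu(G,X,\nu)$ endowed with the weak topology.
   Context: $G$ is a countable discrete group; $\mu$ is a probability measure on $G$ whose support generates $G$ as a semigroup. $(X,\nu)$ is a standard nonatomic Lebesgue probability space. $\mathrm{Aut}^*(X,\nu)$ is the group of invertible nonsingular transformations $T$ of $(X,\nu)$ (i.e. $T_*\nu\sim\nu$), modulo equality a.e. For $T\in\mathrm{Aut}^*(X,\nu)$ let $U_{T,1}f=\frac{dT_*\nu}{d\nu}\cdot f\circ T^{-1}$, an isometry of $L^1(X,\nu)$. The weak topology on $\mathrm{Aut}^*(X,\nu)$ is the one in which $T_n\to T$ iff $\|U_{T_n,1}\mathbf 1_A-U_{T,1}\mathbf 1_A\|_1\to0$ for every measurable $A\subseteq X$ (the topology induced by the strong operator topology on isometries of $L^1$). $A^*(G,X,\nu)$ is the set of homomorphisms $a:G\to\mathrm{Aut}^*(X,\nu)$ with the topology of pointwise convergence, and $A_\mu(G,X,\nu)$ is its subspace of $\mu$-stationary actions, i.e. those with $\sum_{g}\mu(g)a(g)_*\nu=\nu$. An action $a$ is ergodic if every measurable set $E$ with $a(g)E=E$ for all $g$ has $\nu(E)\in\{0,1\}$. *)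

theory Defs
  imports "HOL-Probability.Probability" "HOL-Algebra.Group"
begin

definition l2 :: "(nat \<Rightarrow> complex) set" where
  "l2 = {f. summable (\<lambda>n. (cmod (f n))^2)}"

definition l2_norm :: "(nat \<Rightarrow> complex) \<Rightarrow> real" where
  "l2_norm f = sqrt (\<Sum>n. (cmod (f n))^2)"

text \<open>Closed complex linear subspaces of l2(N) (these are, up to unitary equivalence,
  all separable complex Hilbert spaces).\<close>

definition closed_l2_subspace :: "(nat \<Rightarrow> complex) set \<Rightarrow> bool" where
  "closed_l2_subspace H \<longleftrightarrow>
     H \<subseteq> l2 \<and> (\<lambda>n. 0) \<in> H \<and>
     (\<forall>u\<in>H. \<forall>v\<in>H. (\<lambda>n. u n + v n) \<in> H) \<and>
     (\<forall>c::complex. \<forall>u\<in>H. (\<lambda>n. c * u n) \<in> H) \<and>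
     (\<forall>s v. (\<forall>k. s k \<in> H) \<and> v \<in> l2 \<and> (\<lambda>k. l2_norm (\<lambda>n. s k n - v n)) \<longlonglongrightarrow> 0
            \<longrightarrow> v \<in> H)"

definition unitary_rep ::
  "('g, 'b) monoid_scheme \<Rightarrow> (nat \<Rightarrow> complex) set \<Rightarrow> ('g \<Rightarrow> (nat \<Rightarrow> complex) \<Rightarrow> (nat \<Rightarrow> complex)) \<Rightarrow> bool" where
  "unitary_rep G H \<pi> \<longleftrightarrow>
     (\<forall>g\<in>carrier G.
        bij_betw (\<pi> g) H H \<and>
        (\<forall>u\<in>H. \<forall>v\<in>H. \<pi> g (\<lambda>n. u n + v n) = (\<lambda>n. \<pi> g u n + \<pi> g v n)) \<and>
        (\<forall>c::complex. \<forall>u\<in>H. \<pi> g (\<lambda>n. c * u n) = (\<lambda>n. c * \<pi> g u n)) \<and>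
        (\<forall>u\<in>H. l2_norm (\<pi> g u) = l2_norm u)) \<and>
     (\<forall>g\<in>carrier G. \<forall>h\<in>carrier G. \<forall>u\<in>H. \<pi> (g \<otimes>\<^bsub>G\<^esub> h) u = \<pi> g (\<pi> h u)) \<and>
     (\<forall>u\<in>H. \<pi> \<one>\<^bsub>G\<^esub> u = u)"

definition has_almost_invariant_vectors ::
  "('g, 'b) monoid_scheme \<Rightarrow> (nat \<Rightarrow> complex) set \<Rightarrow> ('g \<Rightarrow> (nat \<Rightarrow> complex) \<Rightarrow> (nat \<Rightarrow> complex)) \<Rightarrow> bool" where
  "has_almost_invariant_vectors G H \<pi> \<longleftrightarrow>
     (\<forall>K \<epsilon>. finite K \<and> K \<subseteq> carrier G \<and> \<epsilon> > (0::real) \<longrightarrow>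
        (\<exists>v\<in>H. l2_norm v = 1 \<and> (\<forall>g\<in>K. l2_norm (\<lambda>n. \<pi> g v n - v n) < \<epsilon>)))"

definition has_nonzero_invariant_vector ::
  "('g, 'b) monoid_scheme \<Rightarrow> (nat \<Rightarrow> complex) set \<Rightarrow> ('g \<Rightarrow> (nat \<Rightarrow> complex) \<Rightarrow> (nat \<Rightarrow> complex)) \<Rightarrow> bool" where
  "has_nonzero_invariant_vector G H \<pi> \<longleftrightarrow>
     (\<exists>v\<in>H. v \<noteq> (\<lambda>n. 0) \<and> (\<forall>g\<in>carrier G. \<pi> g v = v))"

definition kazhdan_T :: "('g, 'b) monoid_scheme \<Rightarrow> bool" where
  "kazhdan_T G \<longleftrightarrow>
     (\<forall>H \<pi>. closed_l2_subspace H \<and> unitary_rep G H \<pi> \<and> has_almost_invariant_vectors G H \<pi>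
        \<longrightarrow> has_nonzero_invariant_vector G H \<pi>)"

inductive_set subsemigroup_gen :: "('g, 'b) monoid_scheme \<Rightarrow> 'g set \<Rightarrow> 'g set"
  for G S where
  base: "s \<in> S \<Longrightarrow> s \<in> subsemigroup_gen G S"
| mult: "x \<in> subsemigroup_gen G S \<Longrightarrow> y \<in> subsemigroup_gen G S \<Longrightarrow> x \<otimes>\<^bsub>G\<^esub> y \<in> subsemigroup_gen G S"

definition prob_on_group :: "('g, 'b) monoid_scheme \<Rightarrow> ('g \<Rightarrow> real) \<Rightarrow> bool" where
  "prob_on_group G \<mu> \<longleftrightarrow> (\<forall>g\<in>carrier G. \<mu> g \<ge> 0) \<and> (\<mu> has_sum 1) (carrier G)"

definition supp_measure :: "('g, 'b) monoid_scheme \<Rightarrow> ('g \<Rightarrow> real) \<Rightarrow> 'g set" where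
  "supp_measure G \<mu> = {g \<in> carrier G. \<mu> g > 0}"

definition generating_prob :: "('g, 'b) monoid_scheme \<Rightarrow> ('g \<Rightarrow> real) \<Rightarrow> bool" where
  "generating_prob G \<mu> \<longleftrightarrow> prob_on_group G \<mu> \<and> subsemigroup_gen G (supp_measure G \<mu>) = carrier G"

definition nonatomic :: "'x measure \<Rightarrow> bool" where
  "nonatomic M \<longleftrightarrow> (\<forall>A\<in>sets M. measure M A > 0 \<longrightarrow>
      (\<exists>B\<in>sets M. B \<subseteq> A \<and> 0 < measure M B \<and> measure M B < measure M A))"

definition std_nonatomic_prob :: "'x::polish_space measure \<Rightarrow> bool" where
  "std_nonatomic_prob \<nu> \<longleftrightarrow> sets \<nu> = sets borel \<and> prob_space \<nu> \<and> nonatomic \<nu>"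

text \<open>Representatives of elements of Aut*(X,nu): measurable maps, invertible modulo null sets,
  with T_* nu equivalent to nu.\<close>

definition ae_inverse :: "'x measure \<Rightarrow> ('x \<Rightarrow> 'x) \<Rightarrow> ('x \<Rightarrow> 'x) \<Rightarrow> bool" where
  "ae_inverse \<nu> T S \<longleftrightarrow> S \<in> measurable \<nu> \<nu> \<and>
     (AE x in \<nu>. S (T x) = x) \<and> (AE x in \<nu>. T (S x) = x)"

definition nonsingular_aut :: "'x measure \<Rightarrow> ('x \<Rightarrow> 'x) \<Rightarrow> bool" where
  "nonsingular_aut \<nu> T \<longleftrightarrow> T \<in> measurable \<nu> \<nu> \<and> (\<exists>S. ae_inverse \<nu> T S) \<and>
     (\<forall>A\<in>sets \<nu>. emeasure (distr \<nu> \<nu> T) A = 0 \<longleftrightarrow> emeasure \<nu> A = 0)"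

definition aut_inv :: "'x measure \<Rightarrow> ('x \<Rightarrow> 'x) \<Rightarrow> ('x \<Rightarrow> 'x)" where
  "aut_inv \<nu> T = (SOME S. ae_inverse \<nu> T S)"

text \<open>U_{T,1} f = d(T_* nu)/d nu * f o T^{-1}, applied to f = indicator of A.\<close>

definition U1_ind :: "'x measure \<Rightarrow> ('x \<Rightarrow> 'x) \<Rightarrow> 'x set \<Rightarrow> 'x \<Rightarrow> real" where
  "U1_ind \<nu> T A x = enn2real (RN_deriv \<nu> (distr \<nu> \<nu> T) x) * indicator A (aut_inv \<nu> T x)"

definition weak_dist :: "'x measure \<Rightarrow> 'x set \<Rightarrow> ('x \<Rightarrow> 'x) \<Rightarrow> ('x \<Rightarrow> 'x) \<Rightarrow> ennreal" where
  "weak_dist \<nu> A S T = (\<integral>\<^sup>+ x. ennreal \<bar>U1_ind \<nu> S A x - U1_ind \<nu> T A x\<bar> \<partial>\<nu>)"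

text \<open>A*(G,X,nu): homomorphisms G \<rightarrow> Aut*(X,nu), given by representatives, with equalities
  holding almost everywhere (extensional outside the carrier).\<close>

definition nonsingular_actions ::
  "('g, 'b) monoid_scheme \<Rightarrow> 'x measure \<Rightarrow> ('g \<Rightarrow> 'x \<Rightarrow> 'x) set" where
  "nonsingular_actions G \<nu> = {a. a \<in> extensional (carrier G) \<and>
     (\<forall>g\<in>carrier G. nonsingular_aut \<nu> (a g)) \<and>
     (\<forall>g\<in>carrier G. \<forall>h\<in>carrier G. AE x in \<nu>. a (g \<otimes>\<^bsub>G\<^esub> h) x = a g (a h x)) \<and>
     (AE x in \<nu>. a \<one>\<^bsub>G\<^esub> x = x)}"

text \<open>The topology of pointwise convergence, each factor carrying the weak topology
  (initial topology of T \<mapsto> U_{T,1} 1_A into L1, for all measurable A).\<close>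

definition weak_action_topology ::
  "('g, 'b) monoid_scheme \<Rightarrow> 'x measure \<Rightarrow> ('g \<Rightarrow> 'x \<Rightarrow> 'x) topology" where
  "weak_action_topology G \<nu> = topology_generated_by
     {{b \<in> nonsingular_actions G \<nu>. weak_dist \<nu> A (b g) (a g) < ennreal \<epsilon>} | a g A \<epsilon>.
        a \<in> nonsingular_actions G \<nu> \<and> g \<in> carrier G \<and> A \<in> sets \<nu> \<and> \<epsilon> > 0}"

definition stationary_actions ::
  "('g, 'b) monoid_scheme \<Rightarrow> ('g \<Rightarrow> real) \<Rightarrow> 'x measure \<Rightarrow> ('g \<Rightarrow> 'x \<Rightarrow> 'x) set" where
  "stationary_actions G \<mu> \<nu> = {a \<in> nonsingular_actions G \<nu>.
     \<forall>A\<in>sets \<nu>. ((\<lambda>g. \<mu> g * measure (distr \<nu> \<nu> (a g)) A) has_sum measure \<nu> A) (carrier G)}"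

definition stationary_topology ::
  "('g, 'b) monoid_scheme \<Rightarrow> ('g \<Rightarrow> real) \<Rightarrow> 'x measure \<Rightarrow> ('g \<Rightarrow> 'x \<Rightarrow> 'x) topology" where
  "stationary_topology G \<mu> \<nu> = subtopology (weak_action_topology G \<nu>) (stationary_actions G \<mu> \<nu>)"

definition ergodic_action :: "('g, 'b) monoid_scheme \<Rightarrow> 'x measure \<Rightarrow> ('g \<Rightarrow> 'x \<Rightarrow> 'x) \<Rightarrow> bool" where
  "ergodic_action G \<nu> a \<longleftrightarrow>
     (\<forall>E\<in>sets \<nu>. (\<forall>g\<in>carrier G. emeasure \<nu> ((a g -` E \<inter> space \<nu>) - E \<union> (E - a g -` E)) = 0)
        \<longrightarrow> measure \<nu> E = 0 \<or> measure \<nu> E = 1)"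

definition nowhere_dense_in :: "'a topology \<Rightarrow> 'a set \<Rightarrow> bool" where
  "nowhere_dense_in T E \<longleftrightarrow> T interior_of (T closure_of E) = {}"

end

theory Submission
  imports Defs
begin

text \<open>
  Identify \<open>(X, \<nu>)\<close> with the unit interval. For \<open>c < 1\<close>, conjugate a stationary action \<open>a\<close> by
  the dilation \<open>t \<mapsto> c t\<close> onto \<open>(0, c)\<close> and let \<open>G\<close> act trivially on the rest. The resulting action
  is stationary and converges weakly to \<open>a\<close> as \<open>c \<rightarrow> 1\<close>, because dilations act continuously on \<open>L\<^sup>1\<close>.

  It is not a limit of ergodic stationary actions \<open>b\<^sub>n\<close>: let \<open>A\<close>, \<open>B\<close> be disjoint subsets of equal
  positive measure of the set on which it is trivial. Then \<open>1\<^sub>A - 1\<^sub>B\<close> is asymptotically invariant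
  under the unitary half-density representations \<open>f \<mapsto> (d b\<^sub>n(g)\<^sub>*\<nu> / d\<nu>)\<^sup>1\<^sup>/\<^sup>2 f \<circ> b\<^sub>n(g)\<^sup>-\<^sup>1\<close> on \<open>L\<^sup>2(\<nu>)\<close>.
  If \<open>w \<ge> 0\<close> is an invariant vector of such a representation, then \<open>w\<^sup>2 \<nu>\<close> is an invariant measure, and
  stationarity and ergodicity of \<open>b\<^sub>n\<close> force \<open>w\<close> to be constant. Hence \<open>1\<^sub>A - 1\<^sub>B\<close> is orthogonal to
  all invariant vectors, and property (T), applied to the orthogonal complement of the invariant
  vectors in the Hilbert sum of these representations, gives a contradiction.
\<close>

text \<open>\<open>kazhdan_T\<close> is qualitative: almost invariant vectors of one representation
  yield an invariant vector, and no constant uniform over representations is provided. This is why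
  the representations of all the \<open>b n\<close> are summed before it is applied. It also speaks
  only of closed subspaces of sequence space, so the sum is realised as functions on N x X and
  carried over by coefficients in an orthonormal family. The vector is 1_A - 1_B rather than 1_A
  because constants can be invariant half-densities (nonzero ones are, exactly when the action
  preserves \<nu>), and equal masses make the difference orthogonal to them. Half-densities meet the
  weak topology in the inequality (sqrt p - sqrt q)^2 \<le> |p - q|, which turns L1-closeness of
  U_{T,1} 1_A to 1_A into L2-closeness. Closeness matters on A and B only, so countability of G
  suffices to extract the sequence \<open>b n\<close> from the closure. Elements of Aut* are given
  by maps, so identities between operators hold almost everywhere until coefficients are
  taken.\<close>

section \<open>Nonatomic Polish probability spaces and the unit interval\<close>

text \<open>Record, as ternary digits, which point of a dense sequence is the first one within \<open>2\<^sup>-\<^sup>n\<close>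
  of \<open>x\<close>. A left inverse decodes the digits and takes the limit of these points, so no theorem on Borel
  images is needed.\<close>

lemma polish_space_real_coding:
  "\<exists>(f::'x::polish_space \<Rightarrow> real) g. f \<in> borel_measurable borel \<and> g \<in> borel_measurable borel \<and> (\<forall>x. g (f x) = x)"
proof -
  obtain D :: "'x set" where D: "countable D" "\<And>X. open X \<Longrightarrow> X \<noteq> {} \<Longrightarrow> \<exists>d\<in>D. d \<in> X"
    by (erule countable_dense_setE)
  have Dne: "D \<noteq> {}" using D(2)[of UNIV] by auto
  define d where "d = from_nat_into D"
  have dense: "\<exists>i. dist x (d i) < (1/2)^n" for x and n :: nat
  proof -
    obtain y where "y \<in> D" "y \<in> ball x ((1/2)^n)"
      using D(2)[of "ball x ((1/2)^n)"] by (metis centre_in_ball empty_iff open_ball zero_less_divide_1_iff zero_less_numeral zero_less_power)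
    then show ?thesis
      by (metis D(1) d_def from_nat_into_to_nat_on mem_ball)
  qed
  define idx where "idx n x = (LEAST i. dist x (d i) < (1/2)^n)" for n :: nat and x
  have idx: "dist x (d (idx n x)) < (1/2)^n" for n x
    unfolding idx_def by (rule LeastI_ex[OF dense])
  have [measurable]: "idx n \<in> measurable borel (count_space UNIV)" for n
    unfolding idx_def by measurable
  \<comment> \<open>Digit j codes the pair (n, i) = \<open>prod_decode j\<close> and is 1 exactly
    when i is the index chosen at scale n. Base 3 with digits 0 and 1 only leaves a gap: tails stay
    in [0, 1/2], so a leading digit 0 gives a tail at most 1/6 and a leading digit 1 a tail at least
    1/3. Comparison with 1/3 therefore reads off the digit without any ambiguity of
    expansions.\<close>
  define bit :: "nat \<Rightarrow> 'x \<Rightarrow> real"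
    where "bit j x = of_bool (idx (fst (prod_decode j)) x = snd (prod_decode j))" for j x
  have [measurable]: "bit j \<in> borel_measurable borel" for j
    unfolding bit_def by measurable
  define tail where "tail j x = (\<Sum>i. bit (j + i) x * (1/3)^Suc i)" for j x
  have geo: "summable (\<lambda>i. (1/3::real)^Suc i)" "(\<Sum>i. (1/3::real)^Suc i) = 1/2"
    using summable_geometric[of "1/3::real"] suminf_geometric[of "1/3::real"]
      suminf_divide[OF summable_geometric[of "1/3::real"], of 3]
    by auto
  have bit01: "0 \<le> bit j x" "bit j x \<le> 1" for j x
    by (auto simp: bit_def)
  have sm: "summable (\<lambda>i. bit (j + i) x * (1/3)^Suc i)" for j x
    by (rule summable_comparison_test'[OF geo(1), of 0])
       (use bit01 in \<open>auto simp: abs_mult intro!: mult_left_le_one_le\<close>)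
  have t0: "0 \<le> tail j x" for j x
    unfolding tail_def by (intro suminf_nonneg sm mult_nonneg_nonneg bit01) auto
  have t1: "tail j x \<le> 1/2" for j x
    unfolding tail_def geo(2)[symmetric]
    by (intro suminf_le sm geo mult_left_le_one_le bit01) auto
  have trec: "3 * tail j x = bit j x + tail (Suc j) x" for j x
  proof -
    have "tail j x = bit j x * (1/3) + (\<Sum>i. bit (Suc j + i) x * (1/3)^Suc (Suc i))"
      unfolding tail_def using suminf_split_head[OF sm[of j x]] by simp
    also have "(\<Sum>i. bit (Suc j + i) x * (1/3)^Suc (Suc i)) = (1/3) * tail (Suc j) x"
      unfolding tail_def by (subst suminf_mult[OF sm, symmetric]) (simp add: mult_ac)
    finally show ?thesis by simp
  qed
  have tbit: "tail j x \<ge> 1/3 \<longleftrightarrow> bit j x = 1" for j x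
  proof -
    have "bit j x = 0 \<or> bit j x = 1" by (auto simp: bit_def)
    then show ?thesis using trec[of j x] t0[of "Suc j" x] t1[of "Suc j" x] by auto
  qed
  define rm where "rm = rec_nat (\<lambda>y::real. y) (\<lambda>_ r y. 3 * r y - (if r y \<ge> 1/3 then 1 else 0))"
  have rm0: "rm 0 y = y" and rmS: "rm (Suc j) y = 3 * rm j y - (if rm j y \<ge> 1/3 then 1 else 0)" for j y
    by (auto simp: rm_def)
  have [measurable]: "rm j \<in> borel_measurable borel" for j
  proof (induction j)
    case 0 then show ?case by (simp add: rm0[abs_def])
  next
    case (Suc j)
    then have [measurable]: "rm j \<in> borel_measurable borel" .
    show ?case unfolding rmS[abs_def] by measurable
  qed
  have rmt: "rm j (tail 0 x) = tail j x" for j x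
  proof (induction j)
    case (Suc j)
    have "bit j x = 0 \<or> bit j x = 1" by (auto simp: bit_def)
    then show ?case using trec[of j x] tbit[of j x] by (auto simp: rmS Suc)
  qed (simp add: rm0)
  define ix where "ix n y = (LEAST i. rm (prod_encode (n, i)) y \<ge> 1/3)" for n y
  have [measurable]: "ix n \<in> measurable borel (count_space UNIV)" for n
    unfolding ix_def by measurable
  have ix: "ix n (tail 0 x) = idx n x" for n x
    unfolding ix_def rmt tbit by (auto simp: bit_def intro: Least_equality)
  \<comment> \<open>A real number that codes no point may decode to a divergent sequence. Replacing
    it by the constant \<open>d 0\<close> makes the limit exist for every y, so \<open>g\<close> is
    a pointwise limit of Borel functions on the whole line.\<close>
  define u where "u n y = (if Cauchy (\<lambda>n. d (ix n y)) then d (ix n y) else d 0)" for n y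
  have [measurable]: "(\<lambda>y. d (ix n y)) \<in> borel_measurable borel" for n
    by measurable
  have [measurable]: "u n \<in> borel_measurable borel" for n
    unfolding u_def by measurable
  have "Cauchy (\<lambda>n. u n y)" for y
    by (cases "Cauchy (\<lambda>n. d (ix n y))") (auto simp: u_def intro: LIMSEQ_imp_Cauchy)
  then have "\<forall>y. \<exists>l. (\<lambda>n. u n y) \<longlonglongrightarrow> l"
    using Cauchy_convergent convergent_def by blast
  then obtain g where g: "\<And>y. (\<lambda>n. u n y) \<longlonglongrightarrow> g y" by metis
  have gm: "g \<in> borel_measurable borel"
    by (rule borel_measurable_LIMSEQ_metric[where f=u]) (use g in auto)
  have "g (tail 0 x) = x" for x
  proof -
    have lim: "(\<lambda>n. d (idx n x)) \<longlonglongrightarrow> x"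
    proof (rule metric_LIMSEQ_I)
      fix r :: real assume "r > 0"
      then obtain N where N: "(1/2)^N < r" using real_arch_pow_inv[of r "1/2"] by auto
      have "dist (d (idx n x)) x < r" if "n \<ge> N" for n
      proof -
        have "(1/2::real)^n \<le> (1/2)^N" by (rule power_decreasing[OF that]) auto
        then show ?thesis using idx[of x n] N by (subst dist_commute) linarith
      qed
      then show "\<exists>no. \<forall>n\<ge>no. dist (d (idx n x)) x < r" by blast
    qed
    then have "Cauchy (\<lambda>n. d (idx n x))" by (rule LIMSEQ_imp_Cauchy)
    then have "(\<lambda>n. d (idx n x)) \<longlonglongrightarrow> g (tail 0 x)"
      using g[of "tail 0 x"] by (simp add: u_def ix)
    then show ?thesis using lim LIMSEQ_unique by blast
  qed
  moreover have "tail 0 \<in> borel_measurable borel"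
    unfolding tail_def by measurable
  ultimately show ?thesis using gm by blast
qed

lemma nonatomic_singleton:
  assumes "std_nonatomic_prob \<nu>" shows "measure \<nu> {x} = 0"
proof (rule ccontr)
  assume "measure \<nu> {x} \<noteq> 0"
  then have "measure \<nu> {x} > 0" by (simp add: zero_less_measure_iff)
  moreover have "{x} \<in> sets \<nu>" using assms by (auto simp: std_nonatomic_prob_def)
  ultimately obtain B where B: "B \<subseteq> {x}" "0 < measure \<nu> B" "measure \<nu> B < measure \<nu> {x}"
    using assms unfolding std_nonatomic_prob_def nonatomic_def by meson
  then have "B = {} \<or> B = {x}" by auto
  then show False using B by auto
qed

text \<open>Kept as a measure on all Borel sets of the line, so that dilations and functions of a
  real variable need no restriction to the interval.\<close>

abbreviation unit_lborel :: "real measure" where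
  "unit_lborel \<equiv> density lborel (indicator {0<..<1})"

text \<open>\<open>h\<close> is an injective real coding followed by the distribution function of
  the image measure. Points are null, so this distribution function is continuous and takes the
  image measure to the uniform one; its quantile function inverts it almost everywhere. The opposite
  order, \<open>h (k t) = t\<close>, is recovered later at the points where it matters.\<close>

lemma nonatomic_unit_interval_iso:
  fixes \<nu> :: "'x::polish_space measure"
  assumes "std_nonatomic_prob \<nu>"
  shows "\<exists>h k. h \<in> borel_measurable borel \<and> k \<in> borel_measurable borel \<and>
    distr \<nu> borel h = unit_lborel \<and> (AE x in \<nu>. k (h x) = x)"
proof -
  interpret N: prob_space \<nu> using assms by (simp add: std_nonatomic_prob_def)
  have sN[measurable_cong]: "sets \<nu> = sets borel" using assms by (simp add: std_nonatomic_prob_def)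
  obtain f :: "'x \<Rightarrow> real" and g where [measurable]: "f \<in> borel_measurable borel" "g \<in> borel_measurable borel"
    and gf: "\<And>x. g (f x) = x"
    using polish_space_real_coding by blast
  define m where "m = distr \<nu> borel f"
  interpret m: cdf_distribution m
    unfolding cdf_distribution_def m_def by (rule N.real_distribution_distr) measurable
  have atom: "measure m {y} = 0" for y
  proof -
    have "f -` {y} \<inter> space \<nu> \<subseteq> {g y}" using gf by auto
    moreover have "{g y} \<in> sets \<nu>" using sN by auto
    ultimately have "measure \<nu> (f -` {y} \<inter> space \<nu>) \<le> measure \<nu> {g y}"
      by (rule N.finite_measure_mono)
    then show ?thesis
      unfolding m_def using nonatomic_singleton[OF assms, of "g y"]
      by (subst measure_distr) (auto simp: measure_le_0_iff)
  qed
  have cont: "isCont m.C x" for x by (simp add: m.isCont_cdf atom)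
  \<comment> \<open>Below \<open>m.I w\<close> the distribution function is at most w, and
    continuity carries this bound to \<open>m.I w\<close> itself.\<close>
  have CI: "m.C (m.I w) = w" if "w \<in> {0<..<1}" for w
  proof (rule antisym)
    show "w \<le> m.C (m.I w)" using m.pseudoinverse[of w "m.I w"] that by simp
    have "m.C x \<le> w" if "x < m.I w" for x
      using m.pseudoinverse[of w x] \<open>w \<in> _\<close> that by simp
    then have "eventually (\<lambda>x. m.C x \<le> w) (at_left (m.I w))"
      by (simp add: eventually_at_left_field) (meson lt_ex)
    moreover have "(m.C \<longlongrightarrow> m.C (m.I w)) (at_left (m.I w))"
      using cont by (meson continuous_at_imp_continuous_at_within continuous_within)
    ultimately show "m.C (m.I w) \<le> w"
      by (intro tendsto_upperbound[where F="at_left (m.I w)" and f=m.C]) auto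
  qed
  let ?L = "restrict_space lborel {0<..<1::real}"
  define J where "J w = (if w \<in> {0<..<1} then m.I w else 0)" for w
  have [measurable]: "J \<in> borel_measurable borel"
    unfolding J_def using m.measurable_CI
    by (subst measurable_If_restrict_space_iff) (auto simp: greaterThanLessThan_def greaterThan_def lessThan_def Int_def)
  define h where "h x = m.C (f x)" for x
  have hm[measurable]: "h \<in> borel_measurable borel" unfolding h_def by (rule measurable_compose[OF _ m.measurable_C]) simp
  have "distr \<nu> borel h = distr m borel m.C"
    using m.measurable_C unfolding m_def h_def by (subst distr_distr) (auto simp: comp_def)
  also have "\<dots> = distr ?L borel (\<lambda>w. m.C (m.I w))"
    by (subst m.distr_I_eq_M[symmetric], subst distr_distr)
       (auto simp: comp_def intro!: measurable_restrict_space1)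
  also have "\<dots> = distr ?L borel (\<lambda>w. w)"
    by (rule distr_cong) (auto simp: CI space_restrict_space)
  also have "\<dots> = unit_lborel"
  proof (rule measure_eqI)
    fix A assume "A \<in> sets (distr ?L borel (\<lambda>w. w))"
    then have [measurable]: "A \<in> sets borel" by simp
    have "(\<lambda>w::real. w) \<in> measurable ?L borel" by (intro measurable_restrict_space1) auto
    then show "emeasure (distr ?L borel (\<lambda>w. w)) A = emeasure unit_lborel A"
      by (simp add: emeasure_distr emeasure_restrict_space space_restrict_space emeasure_density
          indicator_inter_arith[symmetric] Int_ac)
  qed simp
  finally have dh: "distr \<nu> borel h = unit_lborel" .
  \<comment> \<open>Almost every point for \<open>m\<close> is a quantile, because \<open>m\<close>
    is the image of the uniform measure under \<open>m.I\<close>; on quantiles \<open>J\<close>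
    undoes \<open>m.C\<close> by \<open>CI\<close>.\<close>
  have "AE y in m. J (m.C y) = y"
  proof -
    have "AE w in ?L. J (m.C (m.I w)) = m.I w"
      by (rule AE_I2) (simp add: space_restrict_space CI J_def)
    then have "AE y in distr ?L borel m.I. J (m.C y) = y"
      by (subst AE_distr_iff) auto
    then show ?thesis by (simp only: m.distr_I_eq_M)
  qed
  then have "AE x in \<nu>. J (h x) = f x"
    unfolding h_def by (intro AE_distrD[of f \<nu> borel "\<lambda>y. J (m.C y) = y"], simp, subst m_def[symmetric])
  then have "AE x in \<nu>. (g \<circ> J) (h x) = x"
    by eventually_elim (simp add: gf)
  moreover have "g \<circ> J \<in> borel_measurable borel" by measurable
  ultimately show ?thesis using hm dh by blast
qed

section \<open>Dilations of the unit interval\<close>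

lemma lborel_integral_dilation:
  fixes f :: "real \<Rightarrow> real"
  assumes "0 < c" shows "(\<integral>t. f (t / c) \<partial>lborel) = c * (\<integral>t. f t \<partial>lborel)"
  using lborel_integral_real_affine[of "1/c" f 0] assms by (simp add: field_simps)

lemma lborel_integrable_dilation:
  fixes f :: "real \<Rightarrow> real"
  assumes "integrable lborel f" "0 < c" shows "integrable lborel (\<lambda>t. f (t / c))"
  using lborel_integrable_real_affine[OF assms(1), of "1/c" 0] assms(2) by (simp add: field_simps)

text \<open>Openness makes x/c lie in U eventually for each x in U, so the part of U outside its
  dilate vanishes by dominated convergence. The part of the dilate outside U is then controlled as
  well, since the two measures differ only by the factor c.\<close>

lemma dilation_tendsto_open:
  fixes U :: "real set"
  assumes "open U" and fin: "emeasure lborel U < \<infinity>" and c: "c \<longlonglongrightarrow> 1" "\<And>n. 0 < c n"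
  shows "(\<lambda>n. \<integral>t. \<bar>indicator U (t / c n) - indicator U t\<bar> \<partial>lborel) \<longlonglongrightarrow> (0::real)"
proof -
  have [measurable]: "U \<in> sets borel" using assms by auto
  have iU: "integrable lborel (indicator U :: real \<Rightarrow> real)"
    using fin by (intro integrable_real_indicator) auto
  have iUc: "integrable lborel (\<lambda>t. indicator U (t / c n) :: real)" for n
    using lborel_integrable_dilation[OF iU c(2)] .
  have ip: "integrable lborel (\<lambda>t. indicator U t * (1 - indicator U (t / c n)) :: real)" for n
    by (rule Bochner_Integration.integrable_bound[OF iU]) (auto simp: indicator_def)
  have lim: "(\<lambda>n. \<integral>t. indicator U t * (1 - indicator U (t / c n)) \<partial>lborel) \<longlonglongrightarrow> (\<integral>t. (0::real) \<partial>(lborel :: real measure))"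
  proof (rule integral_dominated_convergence[where w="indicator U"])
    show "AE x in lborel. (\<lambda>i. indicator U x * (1 - indicator U (x / c i))) \<longlonglongrightarrow> (0::real)"
    proof (rule AE_I2)
      fix x :: real
      show "(\<lambda>i. indicator U x * (1 - indicator U (x / c i))) \<longlonglongrightarrow> (0::real)"
      proof (cases "x \<in> U")
        case True
        have "(\<lambda>i. x / c i) \<longlonglongrightarrow> x / 1" by (intro tendsto_intros c) auto
        then have "eventually (\<lambda>i. x / c i \<in> U) sequentially"
          using topological_tendstoD[of "\<lambda>i. x / c i" x sequentially U] \<open>open U\<close> True by simp
        then have "eventually (\<lambda>i. indicator U x * (1 - indicator U (x / c i)) = (0::real)) sequentially"
          by eventually_elim simp
        then show ?thesis by (rule tendsto_eventually)
      qed simp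
    qed
  qed (use iU in \<open>auto simp: indicator_def\<close>)
  \<comment> \<open>For p, q in {0, 1} one has |p - q| = 2q(1 - p) - (q - p); here p and q are the
    indicators at t/c and at t.\<close>
  have eq: "(\<integral>t. \<bar>indicator U (t / c n) - indicator U t\<bar> \<partial>lborel) =
      2 * (\<integral>t. indicator U t * (1 - indicator U (t / c n)) \<partial>lborel) - (1 - c n) * (\<integral>t. indicator U t \<partial>lborel)"
    (is "?l = ?r" ) for n
  proof -
    have "?l = (\<integral>t. 2 * (indicator U t * (1 - indicator U (t / c n))) - (indicator U t - indicator U (t / c n)) \<partial>lborel)"
      by (intro Bochner_Integration.integral_cong) (auto simp: indicator_def)
    also have "\<dots> = 2 * (\<integral>t. indicator U t * (1 - indicator U (t / c n)) \<partial>lborel) -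
        ((\<integral>t. indicator U t \<partial>lborel) - (\<integral>t. indicator U (t / c n) \<partial>lborel))"
      using ip[of n] iU iUc[of n] by simp
    also have "\<dots> = ?r"
      by (subst lborel_integral_dilation[OF c(2)]) (simp add: algebra_simps)
    finally show ?thesis .
  qed
  have "(\<lambda>n. 2 * (\<integral>t. indicator U t * (1 - indicator U (t / c n)) \<partial>lborel) - (1 - c n) * (\<integral>t. indicator U t \<partial>lborel))
    \<longlonglongrightarrow> 2 * 0 - (1 - 1) * (\<integral>t. indicator U t \<partial>lborel)"
    using lim by (intro tendsto_intros c) simp
  then show ?thesis unfolding eq by simp
qed

text \<open>Since \<open>c n \<le> 1\<close>, dilation does not increase the L1-norm of f - s, so a
  single approximation controls two of the three error terms. This is what lets L1-continuity of
  dilations pass to L1-limits.\<close>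

lemma dilation_approx:
  fixes f :: "real \<Rightarrow> real"
  assumes f: "integrable lborel f" and c: "c \<longlonglongrightarrow> 1" "\<And>n. 0 < c n" "\<And>n. c n \<le> 1"
    and approx: "\<And>e. e > 0 \<Longrightarrow> \<exists>s. integrable lborel s \<and> (\<integral>t. \<bar>f t - s t\<bar> \<partial>lborel) < e \<and>
      (\<lambda>n. \<integral>t. \<bar>s (t / c n) - s t\<bar> \<partial>lborel) \<longlonglongrightarrow> 0"
  shows "(\<lambda>n. \<integral>t. \<bar>f (t / c n) - f t\<bar> \<partial>lborel) \<longlonglongrightarrow> 0"
proof (rule LIMSEQ_I)
  fix r :: real assume "r > 0"
  then obtain s where s: "integrable lborel s" and sr: "(\<integral>t. \<bar>f t - s t\<bar> \<partial>lborel) < r/4"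
    and slim: "(\<lambda>n. \<integral>t. \<bar>s (t / c n) - s t\<bar> \<partial>lborel) \<longlonglongrightarrow> 0"
    using approx[of "r/4"] by auto
  obtain N where N: "\<And>n. n \<ge> N \<Longrightarrow> \<bar>\<integral>t. \<bar>s (t / c n) - s t\<bar> \<partial>lborel\<bar> < r/4"
    using LIMSEQ_D[OF slim, of "r/4"] \<open>r > 0\<close> by auto
  have "\<bar>\<integral>t. \<bar>f (t / c n) - f t\<bar> \<partial>lborel\<bar> < r" if "n \<ge> N" for n
  proof -
    note i = f s lborel_integrable_dilation[OF f c(2)] lborel_integrable_dilation[OF s c(2)]
    have "(\<integral>t. \<bar>f (t / c n) - f t\<bar> \<partial>lborel) \<le>
       (\<integral>t. \<bar>f (t / c n) - s (t / c n)\<bar> + \<bar>s (t / c n) - s t\<bar> + \<bar>f t - s t\<bar> \<partial>lborel)"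
      by (intro integral_mono Bochner_Integration.integrable_add integrable_abs Bochner_Integration.integrable_diff i) linarith
    also have "\<dots> = (\<integral>t. \<bar>f (t / c n) - s (t / c n)\<bar> \<partial>lborel) + (\<integral>t. \<bar>s (t / c n) - s t\<bar> \<partial>lborel) + (\<integral>t. \<bar>f t - s t\<bar> \<partial>lborel)"
      using i by simp
    also have "(\<integral>t. \<bar>f (t / c n) - s (t / c n)\<bar> \<partial>lborel) = c n * (\<integral>t. \<bar>f t - s t\<bar> \<partial>lborel)"
      using lborel_integral_dilation[OF c(2), of "\<lambda>t. \<bar>f t - s t\<bar>"] .
    also have "\<dots> \<le> (\<integral>t. \<bar>f t - s t\<bar> \<partial>lborel)"
      using c(2)[of n] c(3)[of n] by (intro mult_left_le_one_le) (auto intro: less_imp_le)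
    finally have "(\<integral>t. \<bar>f (t / c n) - f t\<bar> \<partial>lborel) < r"
      using sr N[OF that] by linarith
    moreover have "(\<integral>t. \<bar>f (t / c n) - f t\<bar> \<partial>lborel) \<ge> 0" by simp
    ultimately show ?thesis by linarith
  qed
  then show "\<exists>no. \<forall>n\<ge>no. norm ((\<integral>t. \<bar>f (t / c n) - f t\<bar> \<partial>lborel) - 0) < r" by auto
qed

text \<open>The induction reduces to indicators, which outer regularity approximates by open sets;
  sums use the triangle inequality, and dominated limits use \<open>dilation_approx\<close>
  again.\<close>

lemma dilation_tendsto:
  fixes f :: "real \<Rightarrow> real"
  assumes f: "integrable lborel f" and c: "c \<longlonglongrightarrow> 1" "\<And>n. 0 < c n" "\<And>n. c n \<le> 1"
  shows "(\<lambda>n. \<integral>t. \<bar>f (t / c n) - f t\<bar> \<partial>lborel) \<longlonglongrightarrow> 0"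
  using f
proof (induction rule: integrable_induct)
  case (base A y)
  then have A[measurable]: "A \<in> sets borel" by simp
  have iA: "integrable lborel (indicator A :: real \<Rightarrow> real)"
    using base by (intro integrable_real_indicator) auto
  have "(\<lambda>n. \<integral>t. \<bar>indicator A (t / c n) - indicator A t\<bar> \<partial>lborel) \<longlonglongrightarrow> (0::real)"
  proof (rule dilation_approx[OF iA c])
    fix e :: real assume "e > 0"
    obtain U where U: "open U" "A \<subseteq> U" "emeasure lebesgue (U - A) < ennreal e"
      using sets_lebesgue_outer_open[of A e] \<open>e > 0\<close> A by (metis sets_completionI_sets sets_lborel)
    have [measurable]: "U \<in> sets borel" using U by auto
    have UA: "emeasure lborel (U - A) < ennreal e"
      using U(3) by (subst (asm) emeasure_completion) (auto simp: main_part_sets)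
    have "emeasure lborel U = emeasure lborel A + emeasure lborel (U - A)"
      using U by (subst plus_emeasure) (auto simp: Un_absorb1)
    then have Ufin: "emeasure lborel U < \<infinity>"
      using base UA by (metis ennreal_add_less_top ennreal_less_top infinity_ennreal_def order_less_trans)
    have "(\<integral>t. \<bar>indicator A t - indicator U t\<bar> \<partial>lborel) = (\<integral>t. indicator (U - A) t \<partial>lborel :: real)"
      using U by (intro Bochner_Integration.integral_cong) (auto simp: indicator_def)
    also have "\<dots> = measure lborel (U - A)" by simp
    also have "\<dots> < e"
    proof -
      have "emeasure lborel (U - A) \<noteq> \<top>" using UA by auto
      then have "ennreal (measure lborel (U - A)) < ennreal e"
        using UA by (simp add: emeasure_eq_ennreal_measure)
      then show ?thesis by (simp add: ennreal_less_iff)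
    qed
    finally show "\<exists>s. integrable lborel s \<and> (\<integral>t. \<bar>indicator A t - s t\<bar> \<partial>lborel) < e \<and>
      (\<lambda>n. \<integral>t. \<bar>s (t / c n) - s t\<bar> \<partial>lborel) \<longlonglongrightarrow> 0"
      using dilation_tendsto_open[OF U(1) Ufin c(1,2)] Ufin
      by (intro exI[of _ "indicator U"]) auto
  qed
  then have "(\<lambda>n. (\<integral>t. \<bar>indicator A (t / c n) - indicator A t\<bar> \<partial>lborel) * \<bar>y\<bar>) \<longlonglongrightarrow> 0 * \<bar>y\<bar>"
    by (intro tendsto_intros)
  moreover have "\<bar>indicator A (t / c n) *\<^sub>R y - indicator A t *\<^sub>R y\<bar> = \<bar>indicator A (t / c n) - indicator A t\<bar> * \<bar>y\<bar>" for t n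
    by (auto simp: indicator_def)
  ultimately show ?case by simp
next
  case (add f g)
  note i = add(1,2) lborel_integrable_dilation[OF add(1) c(2)] lborel_integrable_dilation[OF add(2) c(2)]
  have "(\<lambda>n. (\<integral>t. \<bar>f (t / c n) - f t\<bar> \<partial>lborel) + (\<integral>t. \<bar>g (t / c n) - g t\<bar> \<partial>lborel)) \<longlonglongrightarrow> 0 + 0"
    by (intro tendsto_intros add)
  then have lim: "(\<lambda>n. (\<integral>t. \<bar>f (t / c n) - f t\<bar> \<partial>lborel) + (\<integral>t. \<bar>g (t / c n) - g t\<bar> \<partial>lborel)) \<longlonglongrightarrow> 0" by simp
  have le: "(\<integral>t. \<bar>(f (t / c n) + g (t / c n)) - (f t + g t)\<bar> \<partial>lborel) \<le>
     (\<integral>t. \<bar>f (t / c n) - f t\<bar> \<partial>lborel) + (\<integral>t. \<bar>g (t / c n) - g t\<bar> \<partial>lborel)" for n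
  proof -
    have "(\<integral>t. \<bar>(f (t / c n) + g (t / c n)) - (f t + g t)\<bar> \<partial>lborel) \<le>
       (\<integral>t. \<bar>f (t / c n) - f t\<bar> + \<bar>g (t / c n) - g t\<bar> \<partial>lborel)"
      by (intro integral_mono Bochner_Integration.integrable_add integrable_abs Bochner_Integration.integrable_diff i) linarith
    then show ?thesis using i by simp
  qed
  show ?case
    by (rule tendsto_sandwich[OF _ _ tendsto_const lim]) (auto intro!: always_eventually le)
next
  case (lim f s)
  show ?case
  proof (rule dilation_approx[OF lim(4) c])
    fix e :: real assume "e > 0"
    have "(\<lambda>i. \<integral>t. \<bar>f t - s i t\<bar> \<partial>lborel) \<longlonglongrightarrow> (\<integral>t. (0::real) \<partial>(lborel :: real measure))"
    \<comment> \<open>The approximants supplied by the induction rule satisfy |s i x| \<le> 2|f x|,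
      hence the bound 3|f|.\<close>
    proof (rule integral_dominated_convergence[where w="\<lambda>t. 3 * \<bar>f t\<bar>"])
      show "AE x in lborel. (\<lambda>i. \<bar>f x - s i x\<bar>) \<longlonglongrightarrow> 0"
      proof (rule AE_I2)
        fix x
        have "(\<lambda>i. \<bar>f x - s i x\<bar>) \<longlonglongrightarrow> \<bar>f x - f x\<bar>" by (intro tendsto_intros lim) auto
        then show "(\<lambda>i. \<bar>f x - s i x\<bar>) \<longlonglongrightarrow> 0" by simp
      qed
      show "AE x in lborel. norm \<bar>f x - s i x\<bar> \<le> 3 * \<bar>f x\<bar>" for i
        using lim(3)[of _ i] by (intro AE_I2) (smt (verit) UNIV_I real_norm_def space_borel space_lborel)
    qed (use lim(1,4) in \<open>auto intro: borel_measurable_integrable\<close>)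
    then obtain i where "\<bar>\<integral>t. \<bar>f t - s i t\<bar> \<partial>lborel\<bar> < e"
      using LIMSEQ_D[of _ 0 e] \<open>e > 0\<close> by fastforce
    then show "\<exists>s. integrable lborel s \<and> (\<integral>t. \<bar>f t - s t\<bar> \<partial>lborel) < e \<and>
      (\<lambda>n. \<integral>t. \<bar>s (t / c n) - s t\<bar> \<partial>lborel) \<longlonglongrightarrow> 0"
      using lim(1,5) by (intro exI[of _ "s i"]) auto
  qed
qed

text \<open>\<open>\<phi>\<close> is an isomorphism onto \<open>Y\<close> with inverse \<open>\<psi>\<close> that scales \<open>\<nu>\<close> by the factor \<open>c\<close>.\<close>

definition shrinking :: "'x measure \<Rightarrow> real \<Rightarrow> ('x \<Rightarrow> 'x) \<Rightarrow> ('x \<Rightarrow> 'x) \<Rightarrow> 'x set \<Rightarrow> bool" where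
  "shrinking \<nu> c \<phi> \<psi> Y \<longleftrightarrow> 0 < c \<and> c < 1 \<and> \<phi> \<in> measurable \<nu> \<nu> \<and> \<psi> \<in> measurable \<nu> \<nu> \<and> Y \<in> sets \<nu> \<and>
     (AE x in \<nu>. \<psi> (\<phi> x) = x) \<and>
     (\<forall>F\<in>borel_measurable \<nu>. (\<integral>\<^sup>+x. F x * indicator Y x \<partial>\<nu>) = ennreal c * (\<integral>\<^sup>+x. F (\<phi> x) \<partial>\<nu>))"

text \<open>In the coordinate \<open>h\<close>, \<phi> is t \<mapsto> c t, \<psi> is t \<mapsto> t/c
  and Y is the set where h < c. The limit statement is continuity of dilations transported to X; A
  and B are the two halves of the interval (c, 1) that is left over.\<close>

lemma shrinking_sequence_exists:
  fixes \<nu> :: "'x::polish_space measure"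
  assumes "std_nonatomic_prob \<nu>"
  obtains c \<phi> \<psi> Y where "\<And>n::nat. shrinking \<nu> (c n) (\<phi> n) (\<psi> n) (Y n)"
    and "\<And>f::'x \<Rightarrow> real. integrable \<nu> f \<Longrightarrow>
          (\<lambda>n. \<integral>x. \<bar>indicator (Y n) x * f (\<psi> n x) - f x\<bar> \<partial>\<nu>) \<longlonglongrightarrow> 0"
    and "\<And>n. \<exists>A\<in>sets \<nu>. \<exists>B\<in>sets \<nu>. A \<inter> B = {} \<and> (A \<union> B) \<inter> Y n = {} \<and>
          measure \<nu> A = measure \<nu> B \<and> 0 < measure \<nu> A"
proof -
  interpret N: prob_space \<nu> using assms by (simp add: std_nonatomic_prob_def)
  have sN[measurable_cong]: "sets \<nu> = sets borel" using assms by (simp add: std_nonatomic_prob_def)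
  have spN: "space \<nu> = UNIV" using sets_eq_imp_space_eq[OF sN] by simp
  obtain h :: "'x \<Rightarrow> real" and k where [measurable]: "h \<in> borel_measurable borel" "k \<in> borel_measurable borel"
    and dh: "distr \<nu> borel h = unit_lborel" and kh: "AE x in \<nu>. k (h x) = x"
    using nonatomic_unit_interval_iso[OF assms] by blast
  have dh': "distr \<nu> borel h = density lborel (\<lambda>t. ennreal (indicator {0<..<1} t))"
    by (simp add: dh ennreal_indicator)
  have nnh: "(\<integral>\<^sup>+x. G (h x) \<partial>\<nu>) = (\<integral>\<^sup>+t. indicator {0<..<1} t * G t \<partial>lborel)"
    if [measurable]: "G \<in> borel_measurable borel" for G
  proof -
    have "(\<integral>\<^sup>+x. G (h x) \<partial>\<nu>) = (\<integral>\<^sup>+t. G t \<partial>distr \<nu> borel h)"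
      by (subst nn_integral_distr) auto
    then show ?thesis unfolding dh by (simp add: nn_integral_density)
  qed
  have scale: "(\<integral>\<^sup>+x. G (h x) * indicator {x. h x < c} x \<partial>\<nu>) = ennreal c * (\<integral>\<^sup>+x. G (c * h x) \<partial>\<nu>)"
    if [measurable]: "G \<in> borel_measurable borel" and c: "0 < c" "c < 1" for G c
  proof -
    have "(\<integral>\<^sup>+x. G (h x) * indicator {x. h x < c} x \<partial>\<nu>) = (\<integral>\<^sup>+x. G (h x) * indicator {..<c} (h x) \<partial>\<nu>)"
      by (intro nn_integral_cong) (auto simp: indicator_def)
    also have "\<dots> = (\<integral>\<^sup>+t. indicator {0<..<1} t * (G t * indicator {..<c} t) \<partial>lborel)"
      by (rule nnh) measurable
    also have "\<dots> = ennreal c * (\<integral>\<^sup>+t. indicator {0<..<1} (c * t) * (G (c * t) * indicator {..<c} (c * t)) \<partial>lborel)"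
      using c by (subst nn_integral_real_affine[where c=c and t=0]) auto
    also have "(\<integral>\<^sup>+t. indicator {0<..<1} (c * t) * (G (c * t) * indicator {..<c} (c * t)) \<partial>lborel)
       = (\<integral>\<^sup>+t. indicator {0<..<1} t * G (c * t) \<partial>lborel)"
    proof (intro nn_integral_cong)
      fix t
      have "0 < c * t \<and> c * t < 1 \<and> c * t < c \<longleftrightarrow> 0 < t \<and> t < 1"
        using c by (auto simp: zero_less_mult_iff) (smt (verit) mult_less_cancel_left2)
      then show "indicator {0<..<1} (c * t) * (G (c * t) * indicator {..<c} (c * t)) = indicator {0<..<1} t * G (c * t)"
        by (auto simp: indicator_def)
    qed
    also have "\<dots> = (\<integral>\<^sup>+x. G (c * h x) \<partial>\<nu>)"
      by (rule nnh[symmetric]) measurable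
    finally show ?thesis .
  qed
  define \<phi> where "\<phi> c x = k (c * h x)" for c x
  define \<psi> where "\<psi> c x = k (h x / c)" for c x
  define Y where "Y c = {x. h x < c}" for c
  have [measurable]: "\<phi> c \<in> borel_measurable borel" "\<psi> c \<in> borel_measurable borel" "Y c \<in> sets borel" for c
    unfolding \<phi>_def \<psi>_def Y_def by measurable
  have shr: "shrinking \<nu> c (\<phi> c) (\<psi> c) (Y c)" if c: "0 < c" "c < 1" for c
    unfolding shrinking_def
  proof (intro conjI ballI c)
    show "\<phi> c \<in> measurable \<nu> \<nu>" "\<psi> c \<in> measurable \<nu> \<nu>" "Y c \<in> sets \<nu>" by measurable
    \<comment> \<open>Besides \<open>k (h x) = x\<close> one needs \<open>h (k t) = t\<close> at the
      points t = c h(x). By \<open>scale\<close>, the measure of the failures is, up to the factor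
      c, that of the x with h(x) < c and \<open>h (k (h x)) \<noteq> h x\<close>, which is
      null.\<close>
    have "ennreal c * (\<integral>\<^sup>+x. indicator {t. h (k t) \<noteq> t} (c * h x) \<partial>\<nu>) =
        (\<integral>\<^sup>+x. indicator {t. h (k t) \<noteq> t} (h x) * indicator {x. h x < c} x \<partial>\<nu>)"
      by (rule scale[OF _ c, symmetric]) measurable
    also have "\<dots> = (\<integral>\<^sup>+x. 0 \<partial>\<nu>)"
      by (intro nn_integral_cong_AE) (use kh in eventually_elim, auto simp: indicator_def)
    finally have "(\<integral>\<^sup>+x. indicator {t. h (k t) \<noteq> t} (c * h x) \<partial>\<nu>) = 0"
      using c by (auto simp: ennreal_zero_less_mult_iff)
    then have "AE x in \<nu>. indicator {t. h (k t) \<noteq> t} (c * h x) = (0::ennreal)"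
      by (subst (asm) nn_integral_0_iff_AE) auto
    then have "AE x in \<nu>. h (k (c * h x)) = c * h x"
      by eventually_elim (auto simp: indicator_def split: if_splits)
    then show "AE x in \<nu>. \<psi> c (\<phi> c x) = x"
      using kh by eventually_elim (use c in \<open>auto simp: \<phi>_def \<psi>_def\<close>)
    fix F :: "'x \<Rightarrow> ennreal" assume "F \<in> borel_measurable \<nu>"
    then have [measurable]: "F \<in> borel_measurable borel" by simp
    have "(\<integral>\<^sup>+x. F x * indicator (Y c) x \<partial>\<nu>) = (\<integral>\<^sup>+x. F (k (h x)) * indicator {x. h x < c} x \<partial>\<nu>)"
      unfolding Y_def by (intro nn_integral_cong_AE) (use kh in eventually_elim, auto)
    also have "\<dots> = ennreal c * (\<integral>\<^sup>+x. F (\<phi> c x) \<partial>\<nu>)"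
      unfolding \<phi>_def by (rule scale[OF _ c]) measurable
    finally show "(\<integral>\<^sup>+x. F x * indicator (Y c) x \<partial>\<nu>) = ennreal c * (\<integral>\<^sup>+x. F (\<phi> c x) \<partial>\<nu>)" .
  qed
  \<comment> \<open>The sequence starts at 1/2, so that every \<open>c n\<close> lies strictly
    between 0 and 1.\<close>
  define c where "c n = 1 - inverse (real (Suc (Suc n)))" for n
  have c01: "0 < c n" "c n < 1" for n by (auto simp: c_def field_simps)
  have "(\<lambda>n. 1 - inverse (real (Suc (Suc n)))) \<longlonglongrightarrow> 1 - 0"
    using LIMSEQ_Suc[OF LIMSEQ_inverse_real_of_nat] by (intro tendsto_intros) auto
  then have clim: "c \<longlonglongrightarrow> 1" unfolding c_def by simp
  show ?thesis
  proof (rule that[of c "\<lambda>n. \<phi> (c n)" "\<lambda>n. \<psi> (c n)" "\<lambda>n. Y (c n)"])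
    show "shrinking \<nu> (c n) (\<phi> (c n)) (\<psi> (c n)) (Y (c n))" for n by (rule shr[OF c01])
    fix f :: "'x \<Rightarrow> real" assume f: "integrable \<nu> f"
    then have [measurable]: "f \<in> borel_measurable borel" using borel_measurable_integrable[OF f] by simp
    \<comment> \<open>Extension by 0 makes \<open>f' (t / c)\<close> vanish outside (0, c), which
      accounts for the factor \<open>indicator (Y (c n))\<close> and allows integration over the
      whole line.\<close>
    define f' where "f' t = indicator {0<..<1} t * f (k t)" for t
    have [measurable]: "f' \<in> borel_measurable borel" unfolding f'_def by measurable
    have "integrable \<nu> (\<lambda>x. f (k (h x)))"
      by (subst integrable_cong_AE[of _ _ f]) (use kh f in auto)
    then have "integrable (distr \<nu> borel h) (\<lambda>t. f (k t))"
      by (subst integrable_distr_eq) auto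
    then have f'i: "integrable lborel f'"
      unfolding dh' f'_def by (subst (asm) integrable_density) auto
    have "(\<integral>x. \<bar>indicator (Y (c n)) x * f (\<psi> (c n) x) - f x\<bar> \<partial>\<nu>) = (\<integral>t. \<bar>f' (t / c n) - f' t\<bar> \<partial>lborel)" for n
    proof -
      have "(\<integral>x. \<bar>indicator (Y (c n)) x * f (\<psi> (c n) x) - f x\<bar> \<partial>\<nu>) =
         (\<integral>x. \<bar>indicator {..<c n} (h x) * f (k (h x / c n)) - f (k (h x))\<bar> \<partial>\<nu>)"
        by (intro integral_cong_AE) (use kh in \<open>auto simp: Y_def \<psi>_def indicator_def\<close>)
      also have "\<dots> = (\<integral>t. \<bar>indicator {..<c n} t * f (k (t / c n)) - f (k t)\<bar> \<partial>distr \<nu> borel h)"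
        by (subst integral_distr) auto
      also have "\<dots> = (\<integral>t. indicator {0<..<1} t *\<^sub>R \<bar>indicator {..<c n} t * f (k (t / c n)) - f (k t)\<bar> \<partial>lborel)"
        unfolding dh' by (subst integral_density) auto
      also have "\<dots> = (\<integral>t. \<bar>f' (t / c n) - f' t\<bar> \<partial>lborel)"
      proof (intro Bochner_Integration.integral_cong refl)
        fix t
        have "0 < t / c n \<longleftrightarrow> 0 < t" "t / c n < 1 \<longleftrightarrow> t < c n" using c01[of n] by (auto simp: zero_less_divide_iff)
        then show "indicator {0<..<1} t *\<^sub>R \<bar>indicator {..<c n} t * f (k (t / c n)) - f (k t)\<bar> = \<bar>f' (t / c n) - f' t\<bar>"
          using c01[of n] by (auto simp: f'_def indicator_def)
      qed
      finally show ?thesis .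
    qed
    then show "(\<lambda>n. \<integral>x. \<bar>indicator (Y (c n)) x * f (\<psi> (c n) x) - f x\<bar> \<partial>\<nu>) \<longlonglongrightarrow> 0"
      using dilation_tendsto[OF f'i clim c01(1) less_imp_le[OF c01(2)]] by simp
  next
    fix n
    let ?A = "{x. c n < h x \<and> h x < (1 + c n) / 2}" and ?B = "{x. (1 + c n) / 2 < h x \<and> h x < 1}"
    have meas: "measure \<nu> {x. a < h x \<and> h x < b} = b - a" if "0 \<le> a" "a \<le> b" "b \<le> 1" for a b
    proof -
      have "emeasure \<nu> {x. a < h x \<and> h x < b} = (\<integral>\<^sup>+x. indicator {a<..<b} (h x) \<partial>\<nu>)"
        by (subst nn_integral_indicator[symmetric]) (auto simp del: nn_integral_indicator simp: indicator_def intro!: nn_integral_cong)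
      also have "\<dots> = (\<integral>\<^sup>+t. indicator {a<..<b} t \<partial>lborel)"
        by (subst nnh) (use that in \<open>auto simp del: nn_integral_indicator simp: indicator_def intro!: nn_integral_cong\<close>)
      also have "\<dots> = ennreal (b - a)" using that by simp
      finally show ?thesis using that by (simp add: measure_def)
    qed
    have "measure \<nu> ?A = (1 + c n) / 2 - c n" "measure \<nu> ?B = 1 - (1 + c n) / 2"
      using c01[of n] by (intro meas; simp)+
    then show "\<exists>A\<in>sets \<nu>. \<exists>B\<in>sets \<nu>. A \<inter> B = {} \<and> (A \<union> B) \<inter> Y (c n) = {} \<and>
          measure \<nu> A = measure \<nu> B \<and> 0 < measure \<nu> A"
      using c01[of n] by (intro bexI[of _ ?A] bexI[of _ ?B]) (auto simp: Y_def field_simps)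
  qed
qed

section \<open>Nonsingular transformations and their Radon-Nikodym derivatives\<close>

text \<open>The density of the image of \<nu> under T, that is, the factor in front of f composed
  with the inverse of T. For nonsingular T the value \<infinity>, which \<open>enn2real\<close>
  turns into 0, occurs on a null set only.\<close>

definition RN_jacobian :: "'x measure \<Rightarrow> ('x \<Rightarrow> 'x) \<Rightarrow> 'x \<Rightarrow> real" where
  "RN_jacobian \<nu> T x = enn2real (RN_deriv \<nu> (distr \<nu> \<nu> T) x)"

lemma jacobian_measurable[measurable]: "RN_jacobian \<nu> T \<in> borel_measurable \<nu>"
  unfolding RN_jacobian_def by measurable

lemma jacobian_nonneg[simp]: "0 \<le> RN_jacobian \<nu> T x"
  by (simp add: RN_jacobian_def)

lemma U1_ind_eq: "U1_ind \<nu> T A x = RN_jacobian \<nu> T x * indicator A (aut_inv \<nu> T x)"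
  by (simp add: U1_ind_def RN_jacobian_def)

lemma nonsingular_aut_measurable: "nonsingular_aut \<nu> T \<Longrightarrow> T \<in> measurable \<nu> \<nu>"
  by (simp add: nonsingular_aut_def)

lemma ae_inverse_aut_inv:
  assumes "nonsingular_aut \<nu> T" shows "ae_inverse \<nu> T (aut_inv \<nu> T)"
proof -
  have "\<exists>S. ae_inverse \<nu> T S" using assms by (simp add: nonsingular_aut_def)
  then show ?thesis unfolding aut_inv_def by (rule someI_ex)
qed

lemma aut_inv_measurable: "nonsingular_aut \<nu> T \<Longrightarrow> aut_inv \<nu> T \<in> measurable \<nu> \<nu>"
  using ae_inverse_aut_inv[of \<nu> T] by (simp add: ae_inverse_def)

lemma aut_inv_left: "nonsingular_aut \<nu> T \<Longrightarrow> AE x in \<nu>. aut_inv \<nu> T (T x) = x"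
  using ae_inverse_aut_inv[of \<nu> T] by (simp add: ae_inverse_def)

lemma aut_inv_right: "nonsingular_aut \<nu> T \<Longrightarrow> AE x in \<nu>. T (aut_inv \<nu> T x) = x"
  using ae_inverse_aut_inv[of \<nu> T] by (simp add: ae_inverse_def)

lemma nonsingular_absolutely_continuous:
  assumes "nonsingular_aut \<nu> T"
  shows "absolutely_continuous \<nu> (distr \<nu> \<nu> T)" "absolutely_continuous (distr \<nu> \<nu> T) \<nu>"
  using assms by (auto simp: absolutely_continuous_def null_sets_def nonsingular_aut_def)

lemma AE_nonsingular:
  assumes "nonsingular_aut \<nu> T" "AE x in \<nu>. P x" shows "AE x in \<nu>. P (T x)"
proof (rule AE_distrD[OF nonsingular_aut_measurable[OF assms(1)]])
  show "AE x in distr \<nu> \<nu> T. P x"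
    using nonsingular_absolutely_continuous(1)[OF assms(1)] assms(2)
    by (rule absolutely_continuous_AE[rotated]) simp
qed

text \<open>Pulling back by T the preimage of a null set N under the inverse gives N up to a null
  set, and T_* \<nu> has the same null sets as \<nu>. Nonsingularity, which is stated for T alone,
  thus extends to the inverse. N is a measurable replacement for the exceptional set of P.\<close>

lemma AE_aut_inv:
  assumes T: "nonsingular_aut \<nu> T" and P: "AE x in \<nu>. P x" shows "AE x in \<nu>. P (aut_inv \<nu> T x)"
proof -
  note [measurable] = nonsingular_aut_measurable[OF T] aut_inv_measurable[OF T]
  obtain N where N: "N \<in> null_sets \<nu>" "{x\<in>space \<nu>. \<not> P x} \<subseteq> N" 
    using AE_E[OF P] by (metis (no_types, lifting) null_setsI)
  have [measurable]: "N \<in> sets \<nu>" using N by auto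
  have "AE x in \<nu>. aut_inv \<nu> T (T x) \<notin> N"
    using AE_not_in[OF N(1)] aut_inv_left[OF T] by eventually_elim simp
  then have "AE x in distr \<nu> \<nu> T. aut_inv \<nu> T x \<notin> N"
    by (subst AE_distr_iff) auto
  then have "AE x in \<nu>. aut_inv \<nu> T x \<notin> N"
    using nonsingular_absolutely_continuous(2)[OF T] absolutely_continuous_AE[of \<nu> "distr \<nu> \<nu> T"] by simp
  with AE_space show ?thesis
  proof eventually_elim
    case (elim x)
    then show ?case using measurable_space[OF aut_inv_measurable[OF T], of x] N(2) by blast
  qed
qed

text \<open>\<open>aut_inv\<close> is an arbitrary choice, so it can be computed only up to null
  sets: evaluate the hypothesis at \<open>aut_inv \<nu> T x\<close>.\<close>

lemma aut_inv_unique: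
  assumes T: "nonsingular_aut \<nu> T" and S: "AE x in \<nu>. S (T x) = x"
  shows "AE x in \<nu>. aut_inv \<nu> T x = S x"
  using AE_aut_inv[OF T S] aut_inv_right[OF T] by eventually_elim metis

context prob_space
begin

lemma nn_integral_jacobian:
  assumes T: "nonsingular_aut M T" and [measurable]: "F \<in> borel_measurable M"
  shows "(\<integral>\<^sup>+x. ennreal (RN_jacobian M T x) * F x \<partial>M) = (\<integral>\<^sup>+x. F (T x) \<partial>M)"
proof -
  note [measurable] = nonsingular_aut_measurable[OF T]
  interpret D: prob_space "distr M M T" by (rule prob_space_distr) simp
  have "AE x in M. RN_deriv M (distr M M T) x \<noteq> \<infinity>"
    by (rule RN_deriv_finite[OF D.sigma_finite_measure_axioms nonsingular_absolutely_continuous(1)[OF T]]) simp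
  then have "(\<integral>\<^sup>+x. ennreal (RN_jacobian M T x) * F x \<partial>M) = (\<integral>\<^sup>+x. RN_deriv M (distr M M T) x * F x \<partial>M)"
    by (intro nn_integral_cong_AE, eventually_elim) (auto simp: RN_jacobian_def ennreal_enn2real_if)
  also have "\<dots> = (\<integral>\<^sup>+x. F x \<partial>distr M M T)"
    by (rule RN_deriv_nn_integral[OF nonsingular_absolutely_continuous(1)[OF T], symmetric]) auto
  also have "\<dots> = (\<integral>\<^sup>+x. F (T x) \<partial>M)" by (rule nn_integral_distr) auto
  finally show ?thesis .
qed

lemma nn_integral_jacobian_aut_inv:
  assumes T: "nonsingular_aut M T" and [measurable]: "F \<in> borel_measurable M" "K \<in> borel_measurable M"
  shows "(\<integral>\<^sup>+x. ennreal (RN_jacobian M T x) * (F (aut_inv M T x) * K x) \<partial>M) = (\<integral>\<^sup>+x. F x * K (T x) \<partial>M)"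
proof -
  note [measurable] = nonsingular_aut_measurable[OF T] aut_inv_measurable[OF T]
  have "(\<integral>\<^sup>+x. ennreal (RN_jacobian M T x) * (F (aut_inv M T x) * K x) \<partial>M) =
      (\<integral>\<^sup>+x. F (aut_inv M T (T x)) * K (T x) \<partial>M)"
    by (rule nn_integral_jacobian[OF T]) measurable
  also have "\<dots> = (\<integral>\<^sup>+x. F x * K (T x) \<partial>M)"
    by (intro nn_integral_cong_AE) (use aut_inv_left[OF T] in auto)
  finally show ?thesis .
qed

lemma density_unique_nn:
  assumes [measurable]: "u \<in> borel_measurable M" "v \<in> borel_measurable M"
    and nonneg: "\<And>x. 0 \<le> u x" "\<And>x. 0 \<le> (v x::real)"
    and eq: "\<And>B. B \<in> sets M \<Longrightarrow>
       (\<integral>\<^sup>+x. ennreal (u x) * indicator B x \<partial>M) = (\<integral>\<^sup>+x. ennreal (v x) * indicator B x \<partial>M)"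
    and fin: "(\<integral>\<^sup>+x. ennreal (u x) \<partial>M) < \<infinity>"
  shows "AE x in M. u x = v x"
proof -
  have "density M (\<lambda>x. ennreal (u x)) = density M (\<lambda>x. ennreal (v x))"
    by (rule measure_eqI) (auto simp: emeasure_density eq)
  then have "AE x in M. ennreal (u x) = ennreal (v x)"
    using fin by (subst (asm) finite_density_unique) auto
  then show ?thesis using nonneg by simp
qed

lemma U1_ind_measurable[measurable (raw)]:
  assumes T: "nonsingular_aut M T" and [measurable]: "A \<in> sets M"
  shows "U1_ind M T A \<in> borel_measurable M"
proof -
  note [measurable] = aut_inv_measurable[OF T]
  show ?thesis unfolding U1_ind_eq[abs_def] by measurable
qed

lemma nn_integral_U1_ind:
  assumes T: "nonsingular_aut M T" and [measurable]: "A \<in> sets M" "F \<in> borel_measurable M"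
  shows "(\<integral>\<^sup>+x. ennreal (U1_ind M T A x) * F x \<partial>M) = (\<integral>\<^sup>+x. indicator A x * F (T x) \<partial>M)"
  by (subst nn_integral_jacobian_aut_inv[OF T, symmetric])
     (auto simp: U1_ind_eq ennreal_mult ennreal_indicator mult.assoc)

lemma U1_ind_nonneg[simp]: "0 \<le> U1_ind M T A x"
  by (simp add: U1_ind_eq)

lemma nn_integral_U1_ind_le_1:
  assumes T: "nonsingular_aut M T" and [measurable]: "A \<in> sets M"
  shows "(\<integral>\<^sup>+x. ennreal (U1_ind M T A x) \<partial>M) \<le> 1"
  using nn_integral_U1_ind[OF assms, of "\<lambda>_. 1"] emeasure_le_1 by simp

lemma integrable_U1_ind:
  assumes T: "nonsingular_aut M T" and A: "A \<in> sets M"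
  shows "integrable M (U1_ind M T A)"
  using U1_ind_measurable[OF assms] nn_integral_U1_ind_le_1[OF assms]
  by (auto simp: integrable_iff_bounded order_le_less_trans)

text \<open>\<open>U1_ind M T A\<close> is the density of the image under T of the restriction of M
  to A, and a density is determined by its integrals over sets. This avoids explicit work with
  Radon-Nikodym derivatives and chosen inverses.\<close>

lemma U1_ind_unique:
  assumes T: "nonsingular_aut M T" and [measurable]: "A \<in> sets M" "u \<in> borel_measurable M"
    and nonneg: "\<And>x. 0 \<le> u x"
    and eq: "\<And>B. B \<in> sets M \<Longrightarrow>
       (\<integral>\<^sup>+x. ennreal (u x) * indicator B x \<partial>M) = (\<integral>\<^sup>+x. indicator A x * indicator B (T x) \<partial>M)"
  shows "AE x in M. U1_ind M T A x = u x"
proof (rule density_unique_nn)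
  show "(\<integral>\<^sup>+x. ennreal (U1_ind M T A x) \<partial>M) < \<infinity>"
    using nn_integral_U1_ind_le_1[OF T, of A] by (auto simp: order_le_less_trans)
  show "U1_ind M T A \<in> borel_measurable M" using U1_ind_measurable[OF T] by simp
qed (auto simp: nn_integral_U1_ind[OF T] eq nonneg)

lemma jacobian_unique:
  assumes T: "nonsingular_aut M T" and [measurable]: "u \<in> borel_measurable M"
    and nonneg: "\<And>x. 0 \<le> u x"
    and eq: "\<And>B. B \<in> sets M \<Longrightarrow>
       (\<integral>\<^sup>+x. ennreal (u x) * indicator B x \<partial>M) = (\<integral>\<^sup>+x. indicator B (T x) \<partial>M)"
  shows "AE x in M. RN_jacobian M T x = u x"
proof (rule density_unique_nn)
  have "(\<integral>\<^sup>+x. ennreal (RN_jacobian M T x) * 1 \<partial>M) = (\<integral>\<^sup>+x. 1 \<partial>M)"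
    by (rule nn_integral_jacobian[OF T]) simp
  then show "(\<integral>\<^sup>+x. ennreal (RN_jacobian M T x) \<partial>M) < \<infinity>" by (simp add: emeasure_space_1)
qed (auto simp: nn_integral_jacobian[OF T] eq nonneg)

lemma weak_dist_triangle:
  assumes "nonsingular_aut M R" "nonsingular_aut M S" "nonsingular_aut M T" and [measurable]: "A \<in> sets M"
  shows "weak_dist M A R T \<le> weak_dist M A R S + weak_dist M A S T"
proof -
  note [measurable] = assms(1-3)[THEN U1_ind_measurable]
  have "weak_dist M A R T \<le> (\<integral>\<^sup>+x. ennreal \<bar>U1_ind M R A x - U1_ind M S A x\<bar> + ennreal \<bar>U1_ind M S A x - U1_ind M T A x\<bar> \<partial>M)"
    unfolding weak_dist_def
    by (intro nn_integral_mono) (auto simp flip: ennreal_plus intro!: ennreal_leI)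
  then show ?thesis unfolding weak_dist_def by (subst (asm) nn_integral_add) auto
qed

text \<open>The constant is the supremum of the essential lower bounds of w. These are bounded,
  since otherwise w would exceed every integer almost everywhere; a number above the supremum is not
  such a bound and so, by the zero-one law, is an essential strict upper bound.\<close>

lemma AE_const_of_zero_one_law:
  fixes w :: "'a \<Rightarrow> real"
  assumes pos: "\<And>x. 0 \<le> w x" and zo: "\<And>r. 0 < r \<Longrightarrow> (AE x in M. w x < r) \<or> (AE x in M. r \<le> w x)"
  shows "\<exists>c. AE x in M. w x = c"
proof -
  define R where "R = {r. 0 \<le> r \<and> (AE x in M. r \<le> w x)}"
  have 0: "0 \<in> R" using pos by (simp add: R_def)
  have "\<exists>n::nat. AE x in M. w x < real (Suc n)"
  proof (rule ccontr)
    assume "\<not> ?thesis"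
    then have "AE x in M. real (Suc n) \<le> w x" for n using zo[of "real (Suc n)"] by auto
    then have "AE x in M. \<forall>n. real (Suc n) \<le> w x" by (simp add: AE_all_countable)
    then have "AE x in M. False"
    proof eventually_elim
      case (elim x)
      obtain n where "w x < real n" using reals_Archimedean2 by blast
      then show ?case using elim[rule_format, of n] by simp
    qed
    then show False by simp
  qed
  then obtain n where n: "AE x in M. w x < real (Suc n)" by blast
  have bdd: "bdd_above R"
  proof (rule bdd_aboveI[of _ "real (Suc n)"])
    fix r assume "r \<in> R"
    then have "AE x in M. r \<le> w x" by (simp add: R_def)
    with n have "AE x in M. r < real (Suc n)" by eventually_elim simp
    then show "r \<le> real (Suc n)" by simp
  qed
  define c where "c = Sup R"
  have c0: "0 \<le> c" unfolding c_def by (rule cSup_upper[OF 0 bdd])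
  have "AE x in M. w x < c + inverse (real (Suc n))" for n
  proof (rule ccontr)
    assume "\<not> ?thesis"
    then have "AE x in M. c + inverse (real (Suc n)) \<le> w x" using zo[of "c + inverse (real (Suc n))"] c0
      by (auto simp: add_nonneg_pos)
    then have "c + inverse (real (Suc n)) \<in> R" using c0 by (auto simp: R_def)
    then have "c + inverse (real (Suc n)) \<le> c" unfolding c_def by (rule cSup_upper[OF _ bdd])
    then show False by simp
  qed
  moreover have "AE x in M. c - inverse (real (Suc n)) \<le> w x" for n
  proof -
    obtain r where "r \<in> R" "c - inverse (real (Suc n)) < r"
      using less_cSup_iff[of R "c - inverse (real (Suc n))"] 0 bdd unfolding c_def by auto
    then have "AE x in M. r \<le> w x" by (simp add: R_def)
    then show ?thesis by eventually_elim (use \<open>_ < r\<close> in simp)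
  qed
  ultimately have "AE x in M. \<forall>n. w x < c + inverse (real (Suc n)) \<and> c - inverse (real (Suc n)) \<le> w x"
    by (simp add: AE_all_countable)
  then have "AE x in M. w x = c"
  proof eventually_elim
    case (elim x)
    show ?case
    proof (rule ccontr)
      assume "w x \<noteq> c"
      then obtain n where "inverse (real (Suc n)) < \<bar>w x - c\<bar>"
        using reals_Archimedean[of "\<bar>w x - c\<bar>"] by auto
      then show False using elim[rule_format, of n] by linarith
    qed
  qed
  then show ?thesis by blast
qed

end

section \<open>Invariant half-densities of ergodic stationary actions\<close>

lemma nonsingular_actions_aut:
  "a \<in> nonsingular_actions G \<nu> \<Longrightarrow> g \<in> carrier G \<Longrightarrow> nonsingular_aut \<nu> (a g)"
  by (simp add: nonsingular_actions_def)

lemma nonsingular_actions_mult: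
  "a \<in> nonsingular_actions G \<nu> \<Longrightarrow> g \<in> carrier G \<Longrightarrow> h \<in> carrier G \<Longrightarrow>
    AE x in \<nu>. a (g \<otimes>\<^bsub>G\<^esub> h) x = a g (a h x)"
  by (simp add: nonsingular_actions_def)

lemma nonsingular_actions_one:
  "a \<in> nonsingular_actions G \<nu> \<Longrightarrow> AE x in \<nu>. a \<one>\<^bsub>G\<^esub> x = x"
  by (simp add: nonsingular_actions_def)

lemma stationary_nonsingular: "a \<in> stationary_actions G \<mu> \<nu> \<Longrightarrow> a \<in> nonsingular_actions G \<nu>"
  by (simp add: stationary_actions_def)

text \<open>The measure \<open>w\<^sup>2 \<nu>\<close> is invariant and \<open>{w < r}\<close> maximises the signed measure
  \<open>\<nu> - r\<^sup>-\<^sup>2 w\<^sup>2 \<nu>\<close>; hence pulling this set back cannot increase its \<open>\<nu>\<close>-measure.\<close>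

lemma invariant_half_density_sublevel:
  assumes "prob_space \<nu>" and T: "nonsingular_aut \<nu> T" and [measurable]: "w \<in> borel_measurable \<nu>"
    and w0: "\<And>x. 0 \<le> w x" and w2: "integrable \<nu> (\<lambda>x. (w x)\<^sup>2)" and r: "0 < (r::real)"
    and inv: "AE x in \<nu>. sqrt (RN_jacobian \<nu> T x) * w (aut_inv \<nu> T x) = w x"
  defines "E \<equiv> {x \<in> space \<nu>. w x < r}"
  shows "measure \<nu> (T -` E \<inter> space \<nu>) \<le> measure \<nu> E"
    and "measure \<nu> (T -` E \<inter> space \<nu>) = measure \<nu> E \<Longrightarrow> AE x in \<nu>. T x \<in> E \<longleftrightarrow> x \<in> E"
proof -
  interpret prob_space \<nu> by fact
  note [measurable] = nonsingular_aut_measurable[OF T] aut_inv_measurable[OF T]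
  have [measurable]: "E \<in> sets \<nu>" unfolding E_def by measurable
  define E' where "E' = T -` E \<inter> space \<nu>"
  have [measurable]: "E' \<in> sets \<nu>" unfolding E'_def by measurable
  have iw: "integrable \<nu> (\<lambda>x. indicator B x * (w x)\<^sup>2)" if [measurable]: "B \<in> sets \<nu>" for B
    by (rule Bochner_Integration.integrable_bound[OF w2]) (auto simp: indicator_def)
  have "(\<integral>\<^sup>+x. ennreal (indicator E' x * (w x)\<^sup>2) \<partial>\<nu>) = (\<integral>\<^sup>+x. ennreal ((w x)\<^sup>2) * indicator E (T x) \<partial>\<nu>)"
    by (intro nn_integral_cong) (auto simp: E'_def indicator_def)
  also have "\<dots> = (\<integral>\<^sup>+x. ennreal (RN_jacobian \<nu> T x) * (ennreal ((w (aut_inv \<nu> T x))\<^sup>2) * indicator E x) \<partial>\<nu>)"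
    by (rule nn_integral_jacobian_aut_inv[OF T, symmetric]) auto
  also have "\<dots> = (\<integral>\<^sup>+x. ennreal (indicator E x * (w x)\<^sup>2) \<partial>\<nu>)"
  proof (intro nn_integral_cong_AE, use inv in eventually_elim)
    case (elim x)
    have "RN_jacobian \<nu> T x * (w (aut_inv \<nu> T x))\<^sup>2 = (w x)\<^sup>2"
      unfolding elim[symmetric] by (simp add: power_mult_distrib)
    then show ?case by (auto simp: indicator_def simp flip: ennreal_mult)
  qed
  finally have m: "(\<integral>x. indicator E' x * (w x)\<^sup>2 \<partial>\<nu>) = (\<integral>x. indicator E x * (w x)\<^sup>2 \<partial>\<nu>)"
    by (subst (1 2) integral_eq_nn_integral) auto
  \<comment> \<open>The first factor is positive exactly on E, so q is nonnegative; by invariance of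
    \<open>w\<^sup>2 \<nu>\<close> (fact \<open>m\<close>) its integral is \<nu>(E) -
    \<nu>(E').\<close>
  define q where "q x = (1 - (w x)\<^sup>2 / r\<^sup>2) * (indicator E x - indicator E' x)" for x
  have qeq: "q x = indicator E x - indicator E' x - (indicator E x * (w x)\<^sup>2 - indicator E' x * (w x)\<^sup>2) / r\<^sup>2" for x
    by (simp add: q_def algebra_simps diff_divide_distrib)
  have iI: "integrable \<nu> (indicat_real E)" "integrable \<nu> (indicat_real E')"
    by (auto intro!: integrable_real_indicator simp: top.not_eq_extremum[symmetric])
  have iq: "integrable \<nu> q"
    unfolding qeq[abs_def] by (intro Bochner_Integration.integrable_diff integrable_divide iw integrable_real_indicator) (auto simp: top.not_eq_extremum[symmetric])
  have intq: "(\<integral>x. q x \<partial>\<nu>) = measure \<nu> E - measure \<nu> E'"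
    unfolding qeq using iw[of E] iw[of E'] m iI by simp
  have sgn: "x \<in> space \<nu> \<Longrightarrow> x \<in> E \<longleftrightarrow> (w x)\<^sup>2 / r\<^sup>2 < 1" for x
    using w0[of x] r by (auto simp: E_def power_strict_mono intro: power2_less_imp_less)
  have q0: "x \<in> space \<nu> \<Longrightarrow> 0 \<le> q x" for x
    using sgn[of x] by (auto simp: q_def indicator_def E'_def mult_nonneg_nonneg)
  have "0 \<le> (\<integral>x. q x \<partial>\<nu>)" by (intro integral_nonneg_AE AE_I2 q0)
  then show "measure \<nu> (T -` E \<inter> space \<nu>) \<le> measure \<nu> E"
    unfolding intq E'_def by simp
  assume "measure \<nu> (T -` E \<inter> space \<nu>) = measure \<nu> E"
  then have eq: "measure \<nu> E' = measure \<nu> E" by (simp add: E'_def)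
  then have "AE x in \<nu>. q x = 0"
    using integral_nonneg_eq_0_iff_AE[OF iq] q0 intq by auto
  \<comment> \<open>Only one inclusion follows from q = 0, because the first factor vanishes where w
    = r; equality of measures gives the other.\<close>
  with AE_space have sub: "AE x in \<nu>. x \<in> E \<longrightarrow> x \<in> E'"
    by eventually_elim (use sgn in \<open>auto simp: q_def indicator_def split: if_splits\<close>)
  have "measure \<nu> (E' - E) = measure \<nu> E' - measure \<nu> (E' \<inter> E)"
    by (rule finite_measure_Diff') auto
  also have "measure \<nu> (E' \<inter> E) = measure \<nu> E"
    by (intro finite_measure_eq_AE) (use sub in auto)
  finally have "emeasure \<nu> (E' - E) = 0" using eq by (simp add: emeasure_eq_measure)
  then have "AE x in \<nu>. x \<notin> E' - E" by (intro AE_not_in) (auto simp: null_sets_def)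
  with AE_space sub show "AE x in \<nu>. T x \<in> E \<longleftrightarrow> x \<in> E"
    by eventually_elim (auto simp: E'_def)
qed

text \<open>By stationarity \<nu>(E), for E = {w < r}, is the \<mu>-average of the measures of its
  pullbacks, none of which exceeds \<nu>(E). So every pullback with \<mu>(g) > 0 has measure
  \<nu>(E), and E is invariant under the support of \<mu>, hence under the semigroup it generates,
  which is G. Ergodicity then gives a zero-one law at every level r > 0.\<close>

lemma ergodic_invariant_half_density_nonneg:
  fixes G (structure)
  assumes G: "group G" and \<nu>: "prob_space \<nu>" and gen: "generating_prob G \<mu>"
    and a: "a \<in> stationary_actions G \<mu> \<nu>" and erg: "ergodic_action G \<nu> a"
    and [measurable]: "w \<in> borel_measurable \<nu>"
    and w0: "\<And>x. 0 \<le> w x" and w2: "integrable \<nu> (\<lambda>x. (w x)\<^sup>2)"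
    and inv: "\<And>g. g \<in> carrier G \<Longrightarrow>
      AE x in \<nu>. sqrt (RN_jacobian \<nu> (a g) x) * w (aut_inv \<nu> (a g) x) = w x"
  shows "\<exists>c. AE x in \<nu>. w x = c"
proof -
  interpret prob_space \<nu> by fact
  interpret group G by fact
  note na = stationary_nonsingular[OF a]
  note aut = nonsingular_actions_aut[OF na]
  note [measurable] = aut[THEN nonsingular_aut_measurable]
  show ?thesis
  proof (rule AE_const_of_zero_one_law[OF w0])
    fix r :: real assume r: "0 < r"
    define E where "E = {x \<in> space \<nu>. w x < r}"
    have [measurable]: "E \<in> sets \<nu>" unfolding E_def by measurable
    note le = invariant_half_density_sublevel(1)[OF \<nu> aut _ w0 w2 r inv, folded E_def]
    have mu: "(\<mu> has_sum 1) (carrier G)" "\<And>g. g \<in> carrier G \<Longrightarrow> 0 \<le> \<mu> g"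
      using gen by (auto simp: generating_prob_def prob_on_group_def)
    have d: "measure (distr \<nu> \<nu> (a g)) E = measure \<nu> (a g -` E \<inter> space \<nu>)" if "g \<in> carrier G" for g
      using that by (intro measure_distr) auto
    have "((\<lambda>g. \<mu> g * measure (distr \<nu> \<nu> (a g)) E) has_sum measure \<nu> E) (carrier G)"
      using a by (auto simp: stationary_actions_def)
    then have hs: "((\<lambda>g. \<mu> g * measure \<nu> (a g -` E \<inter> space \<nu>)) has_sum measure \<nu> E) (carrier G)"
      by (subst has_sum_cong[where g="\<lambda>g. \<mu> g * measure (distr \<nu> \<nu> (a g)) E"]) (auto simp: d)
    have hs': "((\<lambda>g. \<mu> g * measure \<nu> E) has_sum 1 * measure \<nu> E) (carrier G)"
      by (intro has_sum_cmult_left mu)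
    have eq: "\<mu> g * measure \<nu> (a g -` E \<inter> space \<nu>) = \<mu> g * measure \<nu> E" if "g \<in> carrier G" for g
    proof (rule ccontr)
      assume ne: "\<not> ?thesis"
      have mle: "\<mu> g * measure \<nu> (a g -` E \<inter> space \<nu>) \<le> \<mu> g * measure \<nu> E" if "g \<in> carrier G" for g
        using that by (auto simp: mu intro!: mult_left_mono le)
      have "measure \<nu> E < 1 * measure \<nu> E"
        by (rule has_sum_strict_mono[OF hs hs' mle \<open>g \<in> carrier G\<close>]) (use ne mle[OF that] in linarith)+
      then show False by simp
    qed
    have supp: "AE x in \<nu>. a g x \<in> E \<longleftrightarrow> x \<in> E" if g: "g \<in> supp_measure G \<mu>" for g
    proof -
      have "measure \<nu> (a g -` E \<inter> space \<nu>) = measure \<nu> E"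
        using eq[of g] g by (auto simp: supp_measure_def)
      with g show ?thesis unfolding E_def
        by (intro invariant_half_density_sublevel(2)[OF \<nu> aut _ w0 w2 r inv]) (auto simp: supp_measure_def)
    qed
    have "g \<in> carrier G \<and> (AE x in \<nu>. a g x \<in> E \<longleftrightarrow> x \<in> E)" if "g \<in> subsemigroup_gen G (supp_measure G \<mu>)" for g
      using that
    proof induction
      case (base s)
      then show ?case using supp by (auto simp: supp_measure_def)
    next
      case (mult x y)
      then have xy: "x \<in> carrier G" "y \<in> carrier G" and
        X: "AE z in \<nu>. a x z \<in> E \<longleftrightarrow> z \<in> E" and Y: "AE z in \<nu>. a y z \<in> E \<longleftrightarrow> z \<in> E" by auto
      have "AE z in \<nu>. a (x \<otimes> y) z \<in> E \<longleftrightarrow> z \<in> E"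
        using nonsingular_actions_mult[OF na xy] AE_nonsingular[OF aut[OF xy(2)] X] Y
        by eventually_elim simp
      then show ?case using xy by simp
    qed
    then have all: "AE x in \<nu>. a g x \<in> E \<longleftrightarrow> x \<in> E" if "g \<in> carrier G" for g
      using that gen by (auto simp: generating_prob_def)
    have "emeasure \<nu> ((a g -` E \<inter> space \<nu>) - E \<union> (E - a g -` E)) = 0" if g: "g \<in> carrier G" for g
    proof -
      have [measurable]: "a g \<in> measurable \<nu> \<nu>" using g by simp
      have "E - a g -` E = E - (a g -` E \<inter> space \<nu>)" by (auto simp: E_def)
      then have "(a g -` E \<inter> space \<nu>) - E \<union> (E - a g -` E) \<in> sets \<nu>" by simp
      then show ?thesis
        by (rule AE_iff_measurable[THEN iffD1, rotated 2, OF all[OF g]]) (auto simp: E_def)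
    qed
    then have "measure \<nu> E = 0 \<or> measure \<nu> E = 1"
      using erg unfolding ergodic_action_def by (meson \<open>E \<in> sets \<nu>\<close>)
    then show "(AE x in \<nu>. w x < r) \<or> (AE x in \<nu>. r \<le> w x)"
    proof
      assume "measure \<nu> E = 0"
      then have "AE x in \<nu>. x \<notin> E" by (intro AE_not_in) (auto simp: null_sets_def emeasure_eq_measure)
      with AE_space have "AE x in \<nu>. r \<le> w x" by eventually_elim (auto simp: E_def)
      then show ?thesis ..
    next
      assume "measure \<nu> E = 1"
      then have "AE x in \<nu>. x \<in> E" by (subst AE_in_set_eq_1) auto
      then have "AE x in \<nu>. w x < r" by eventually_elim (auto simp: E_def)
      then show ?thesis ..
    qed
  qed
qed

text \<open>The twisting factor is a nonnegative real, so the invariance equation survives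
  composition with any positively homogeneous F. The positive parts of Re, -Re, Im and -Im reduce
  the complex case to the nonnegative one.\<close>

lemma ergodic_invariant_half_density:
  fixes G (structure) and w :: "'x \<Rightarrow> complex"
  assumes G: "group G" and \<nu>: "prob_space \<nu>" and gen: "generating_prob G \<mu>"
    and a: "a \<in> stationary_actions G \<mu> \<nu>" and erg: "ergodic_action G \<nu> a"
    and [measurable]: "w \<in> borel_measurable \<nu>" and w2: "integrable \<nu> (\<lambda>x. (cmod (w x))\<^sup>2)"
    and inv: "\<And>g. g \<in> carrier G \<Longrightarrow>
      AE x in \<nu>. of_real (sqrt (RN_jacobian \<nu> (a g) x)) * w (aut_inv \<nu> (a g) x) = w x"
  shows "\<exists>c. AE x in \<nu>. w x = c"
proof -
  have part: "\<exists>c. AE x in \<nu>. F (w x) = c"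
    if [measurable]: "F \<in> borel_measurable borel" and F0: "\<And>z. 0 \<le> F z" and Fle: "\<And>z. F z \<le> cmod z"
      and Fh: "\<And>s z. 0 \<le> s \<Longrightarrow> F (of_real s * z) = s * F z" for F :: "complex \<Rightarrow> real"
  proof (rule ergodic_invariant_half_density_nonneg[OF G \<nu> gen a erg])
    show "integrable \<nu> (\<lambda>x. (F (w x))\<^sup>2)"
      by (rule Bochner_Integration.integrable_bound[OF w2]) (auto intro!: power_mono F0 Fle)
    show "AE x in \<nu>. sqrt (RN_jacobian \<nu> (a g) x) * F (w (aut_inv \<nu> (a g) x)) = F (w x)" if "g \<in> carrier G" for g
      using inv[OF that] by eventually_elim (metis Fh jacobian_nonneg real_sqrt_ge_zero)
  qed (auto simp: F0)
  obtain c1 where c1: "AE x in \<nu>. max 0 (Re (w x)) = c1"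
    using part[of "\<lambda>z. max 0 (Re z)"] by (auto simp: max_mult_distrib_left abs_Re_le_cmod complex_Re_le_cmod)
  obtain c2 where c2: "AE x in \<nu>. max 0 (- Re (w x)) = c2"
    using part[of "\<lambda>z. max 0 (- Re z)"] abs_Re_le_cmod by (force simp: max_mult_distrib_left abs_le_iff)
  obtain c3 where c3: "AE x in \<nu>. max 0 (Im (w x)) = c3"
    using part[of "\<lambda>z. max 0 (Im z)"] abs_Im_le_cmod by (force simp: max_mult_distrib_left abs_le_iff)
  obtain c4 where c4: "AE x in \<nu>. max 0 (- Im (w x)) = c4"
    using part[of "\<lambda>z. max 0 (- Im z)"] abs_Im_le_cmod by (force simp: max_mult_distrib_left abs_le_iff)
  have "AE x in \<nu>. w x = Complex (c1 - c2) (c3 - c4)"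
    using c1 c2 c3 c4 by eventually_elim (auto simp: complex_eq_iff)
  then show ?thesis ..
qed

section \<open>Shrinking an action\<close>

definition shrunk :: "('x \<Rightarrow> 'x) \<Rightarrow> ('x \<Rightarrow> 'x) \<Rightarrow> 'x set \<Rightarrow> ('x \<Rightarrow> 'x) \<Rightarrow> 'x \<Rightarrow> 'x" where
  "shrunk \<phi> \<psi> Y T x = (if x \<in> Y then \<phi> (T (\<psi> x)) else x)"

locale shrinking_space = prob_space \<nu> for \<nu> :: "'x::polish_space measure" +
  fixes c :: real and \<phi> \<psi> :: "'x \<Rightarrow> 'x" and Y :: "'x set"
  assumes sets_borel[measurable_cong]: "sets \<nu> = sets borel"
    and shr: "shrinking \<nu> c \<phi> \<psi> Y"
begin

lemma c_pos: "0 < c"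
  and meas[measurable]: "\<phi> \<in> measurable \<nu> \<nu>" "\<psi> \<in> measurable \<nu> \<nu>" "Y \<in> sets \<nu>"
  and \<psi>\<phi>: "AE x in \<nu>. \<psi> (\<phi> x) = x"
  using shr by (auto simp: shrinking_def)

lemma space_UNIV[simp]: "space \<nu> = UNIV"
  using sets_eq_imp_space_eq[OF sets_borel] by simp

lemma nn_integral_Y:
  "F \<in> borel_measurable \<nu> \<Longrightarrow> (\<integral>\<^sup>+x. F x * indicator Y x \<partial>\<nu>) = ennreal c * (\<integral>\<^sup>+x. F (\<phi> x) \<partial>\<nu>)"
  using shr by (auto simp: shrinking_def)

text \<open>The integral identity says that \<nu> on Y is c times the image of \<nu> under \<phi>;
  null subsets of Y are thus recognised by their preimages.\<close>

lemma AE_on_Y_iff: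
  assumes [measurable]: "Measurable.pred \<nu> P"
  shows "(AE x in \<nu>. x \<in> Y \<longrightarrow> P x) \<longleftrightarrow> (AE x in \<nu>. P (\<phi> x))"
proof -
  have "(AE x in \<nu>. x \<in> Y \<longrightarrow> P x) \<longleftrightarrow> (\<integral>\<^sup>+x. indicator {x. \<not> P x} x * indicator Y x \<partial>\<nu>) = 0"
    by (subst nn_integral_0_iff_AE) (auto simp: indicator_def intro!: AE_cong)
  also have "\<dots> \<longleftrightarrow> ennreal c * (\<integral>\<^sup>+x. indicator {x. \<not> P x} (\<phi> x) \<partial>\<nu>) = 0"
    by (subst nn_integral_Y) auto
  also have "\<dots> \<longleftrightarrow> (\<integral>\<^sup>+x. indicator {x. \<not> P x} (\<phi> x) \<partial>\<nu>) = 0"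
    using c_pos by simp
  also have "\<dots> \<longleftrightarrow> (AE x in \<nu>. P (\<phi> x))"
    by (subst nn_integral_0_iff_AE) (auto simp: indicator_def intro!: AE_cong)
  finally show ?thesis .
qed

lemma \<phi>_in_Y: "AE x in \<nu>. \<phi> x \<in> Y"
  by (subst AE_on_Y_iff[symmetric]) auto

lemma AE_\<psi>:
  assumes "AE x in \<nu>. P x" shows "AE x in \<nu>. x \<in> Y \<longrightarrow> P (\<psi> x)"
proof -
  \<comment> \<open>The transfer criterion needs a measurable predicate, so the exceptional set of P
    is first enlarged to a null set.\<close>
  obtain N where N: "N \<in> null_sets \<nu>" "{x\<in>space \<nu>. \<not> P x} \<subseteq> N"
    using AE_E[OF assms] by (metis (no_types, lifting) null_setsI)
  have [measurable]: "N \<in> sets \<nu>" using N by auto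
  have "AE x in \<nu>. \<psi> (\<phi> x) \<notin> N"
    using AE_not_in[OF N(1)] \<psi>\<phi> by eventually_elim simp
  then have "AE x in \<nu>. x \<in> Y \<longrightarrow> \<psi> x \<notin> N"
    by (subst AE_on_Y_iff) auto
  then show ?thesis by eventually_elim (use N(2) in auto)
qed

text \<open>\<open>\<psi> (\<phi> x) = x\<close> gives the other order at points of the form
  \<phi>(x), and these fill Y up to a null set. Writing equality as a vanishing distance makes the
  predicate measurable.\<close>

lemma \<phi>\<psi>: "AE x in \<nu>. x \<in> Y \<longrightarrow> \<phi> (\<psi> x) = x"
proof -
  have "AE x in \<nu>. x \<in> Y \<longrightarrow> dist (\<phi> (\<psi> x)) x = 0"
  proof (subst AE_on_Y_iff)
    show "AE x in \<nu>. dist (\<phi> (\<psi> (\<phi> x))) (\<phi> x) = 0"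
      using \<psi>\<phi> by eventually_elim simp
    have eq: "measurable \<nu> \<nu> = borel_measurable \<nu>" by (rule measurable_cong_sets[OF refl sets_borel])
    have [measurable]: "(\<lambda>x. dist (\<phi> (\<psi> x)) x) \<in> borel_measurable \<nu>"
      using measurable_compose[OF meas(2) meas(1)] measurable_ident_sets[OF sets_borel]
      unfolding eq by (rule borel_measurable_dist)
    show "Measurable.pred \<nu> (\<lambda>x. dist (\<phi> (\<psi> x)) x = 0)" 
      using borel_measurable_eq[of "\<lambda>x. dist (\<phi> (\<psi> x)) x" \<nu> "\<lambda>_. 0"] by (simp add: pred_def)
  qed
  then show ?thesis by simp
qed

abbreviation "sh \<equiv> shrunk \<phi> \<psi> Y"

lemma shrunk_measurable[measurable (raw)]:
  assumes [measurable]: "T \<in> measurable \<nu> \<nu>" shows "sh T \<in> measurable \<nu> \<nu>"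
  unfolding shrunk_def[abs_def] by measurable

lemma nn_integral_shrunk:
  assumes [measurable]: "T \<in> measurable \<nu> \<nu>" "F \<in> borel_measurable \<nu>" "K \<in> borel_measurable \<nu>"
  shows "(\<integral>\<^sup>+x. K x * F (sh T x) \<partial>\<nu>) =
    ennreal c * (\<integral>\<^sup>+x. K (\<phi> x) * F (\<phi> (T x)) \<partial>\<nu>) + (\<integral>\<^sup>+x. K x * F x * indicator (-Y) x \<partial>\<nu>)"
proof -
  have [measurable]: "- Y \<in> sets \<nu>" using sets.compl_sets[OF meas(3)] by (simp add: Compl_eq_Diff_UNIV)
  have "(\<integral>\<^sup>+x. K x * F (sh T x) \<partial>\<nu>) =
     (\<integral>\<^sup>+x. (K x * F (\<phi> (T (\<psi> x)))) * indicator Y x + K x * F x * indicator (-Y) x \<partial>\<nu>)"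
    by (intro nn_integral_cong) (auto simp: shrunk_def indicator_def)
  also have "\<dots> = (\<integral>\<^sup>+x. (K x * F (\<phi> (T (\<psi> x)))) * indicator Y x \<partial>\<nu>) + (\<integral>\<^sup>+x. K x * F x * indicator (-Y) x \<partial>\<nu>)"
    by (rule nn_integral_add) auto
  also have "(\<integral>\<^sup>+x. (K x * F (\<phi> (T (\<psi> x)))) * indicator Y x \<partial>\<nu>) = ennreal c * (\<integral>\<^sup>+x. K (\<phi> x) * F (\<phi> (T (\<psi> (\<phi> x)))) \<partial>\<nu>)"
    by (rule nn_integral_Y) auto
  also have "(\<integral>\<^sup>+x. K (\<phi> x) * F (\<phi> (T (\<psi> (\<phi> x)))) \<partial>\<nu>) = (\<integral>\<^sup>+x. K (\<phi> x) * F (\<phi> (T x)) \<partial>\<nu>)"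
    by (intro nn_integral_cong_AE) (use \<psi>\<phi> in auto)
  finally show ?thesis .
qed

text \<open>The image measure depends affinely on that of T: a copy scaled by c on Y plus a fixed
  remainder. Together with the same decomposition of \<nu> in \<open>emeasure_split\<close>, this
  yields both nonsingularity and stationarity of shrunk actions.\<close>

lemma emeasure_shrunk:
  assumes [measurable]: "T \<in> measurable \<nu> \<nu>" "B \<in> sets \<nu>"
  shows "emeasure (distr \<nu> \<nu> (sh T)) B = ennreal c * emeasure (distr \<nu> \<nu> T) (\<phi> -` B) + emeasure \<nu> (B - Y)"
proof -
  have [measurable]: "\<phi> -` B \<in> sets \<nu>" using measurable_sets[OF meas(1), of B] by simp
  have [measurable]: "sh T \<in> measurable \<nu> \<nu>" by (rule shrunk_measurable) simp
  have [measurable]: "T -` \<phi> -` B \<in> sets \<nu>" using measurable_sets[of T \<nu> \<nu> "\<phi> -` B"] by simp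
  have [measurable]: "sh T -` B \<in> sets \<nu>" using measurable_sets[of "sh T" \<nu> \<nu> B] by simp
  have "emeasure (distr \<nu> \<nu> (sh T)) B = (\<integral>\<^sup>+x. indicator B (sh T x) \<partial>\<nu>)"
    by (subst emeasure_distr, simp, simp, subst nn_integral_indicator[symmetric])
       (auto simp del: nn_integral_indicator simp: indicator_def intro!: nn_integral_cong)
  also have "\<dots> = ennreal c * (\<integral>\<^sup>+x. indicator B (\<phi> (T x)) \<partial>\<nu>) + (\<integral>\<^sup>+x. indicator B x * indicator (-Y) x \<partial>\<nu>)"
    using nn_integral_shrunk[of T "indicator B" "\<lambda>_. 1"] by simp
  also have "(\<integral>\<^sup>+x. indicator B (\<phi> (T x)) \<partial>\<nu>) = emeasure (distr \<nu> \<nu> T) (\<phi> -` B)"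
    by (subst emeasure_distr, simp, simp, subst nn_integral_indicator[symmetric])
       (auto simp del: nn_integral_indicator simp: indicator_def intro!: nn_integral_cong)
  also have "(\<integral>\<^sup>+x. indicator B x * indicator (-Y) x \<partial>\<nu>) = emeasure \<nu> (B - Y)"
    by (subst nn_integral_indicator[symmetric])
       (auto simp del: nn_integral_indicator simp: indicator_def intro!: nn_integral_cong)
  finally show ?thesis .
qed

lemma emeasure_split:
  assumes [measurable]: "B \<in> sets \<nu>"
  shows "emeasure \<nu> B = ennreal c * emeasure \<nu> (\<phi> -` B) + emeasure \<nu> (B - Y)"
proof -
  have [measurable]: "\<phi> -` B \<in> sets \<nu>" using measurable_sets[OF meas(1), of B] by simp
  have "emeasure \<nu> (B \<inter> Y) = (\<integral>\<^sup>+x. indicator B x * indicator Y x \<partial>\<nu>)"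
    by (simp add: indicator_inter_arith[symmetric])
  also have "\<dots> = ennreal c * (\<integral>\<^sup>+x. indicator B (\<phi> x) \<partial>\<nu>)" by (rule nn_integral_Y) simp
  also have "(\<integral>\<^sup>+x. indicator B (\<phi> x) \<partial>\<nu>) = emeasure \<nu> (\<phi> -` B)"
    by (subst nn_integral_indicator[symmetric])
       (auto simp del: nn_integral_indicator simp: indicator_def intro!: nn_integral_cong)
  finally have "emeasure \<nu> (B \<inter> Y) = ennreal c * emeasure \<nu> (\<phi> -` B)" .
  moreover have "emeasure \<nu> B = emeasure \<nu> (B \<inter> Y) + emeasure \<nu> (B - Y)"
    by (subst plus_emeasure) (auto intro!: arg_cong[where f="emeasure \<nu>"])
  ultimately show ?thesis by simp
qed

lemma shrunk_action:
  fixes G (structure)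
  assumes G: "group G" and a: "a \<in> nonsingular_actions G \<nu>"
  shows "(\<lambda>g\<in>carrier G. sh (a g)) \<in> nonsingular_actions G \<nu>"
proof -
  interpret group G by fact
  note aut = nonsingular_actions_aut[OF a]
  note [measurable] = aut[THEN nonsingular_aut_measurable]
  \<comment> \<open>To compose two shrunk maps, the inner one must land in Y again and
    \<psi>(\<phi>(z)) = z must hold at the intermediate point z = a(h)(\<psi> x). Both are almost
    sure on Y because a(h) is nonsingular.\<close>
  have mult: "AE x in \<nu>. sh (a (g \<otimes> h)) x = sh (a g) (sh (a h) x)"
    if gh: "g \<in> carrier G" "h \<in> carrier G" for g h
    using AE_\<psi>[OF AE_nonsingular[OF aut[OF gh(2)] \<phi>_in_Y]] AE_\<psi>[OF AE_nonsingular[OF aut[OF gh(2)] \<psi>\<phi>]]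
      AE_\<psi>[OF nonsingular_actions_mult[OF a gh]]
    by eventually_elim (auto simp: shrunk_def)
  have one: "AE x in \<nu>. sh (a \<one>) x = x"
    using AE_\<psi>[OF nonsingular_actions_one[OF a]] \<phi>\<psi>
    by eventually_elim (auto simp: shrunk_def)
  have "nonsingular_aut \<nu> (sh (a g))" if g: "g \<in> carrier G" for g
    unfolding nonsingular_aut_def
  proof (intro conjI ballI exI)
    show "sh (a g) \<in> measurable \<nu> \<nu>" using g by measurable
    show "ae_inverse \<nu> (sh (a g)) (sh (a (inv g)))"
      using mult[of "inv g" g] mult[of g "inv g"] one g unfolding ae_inverse_def
      by (auto elim: eventually_elim2)
    fix A assume A[measurable]: "A \<in> sets \<nu>"
    have m: "\<phi> -` A \<in> sets \<nu>" using measurable_sets[OF meas(1) A] by simp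
    have "emeasure (distr \<nu> \<nu> (a g)) (\<phi> -` A) = 0 \<longleftrightarrow> emeasure \<nu> (\<phi> -` A) = 0"
      using aut[OF g] m unfolding nonsingular_aut_def by blast
    then show "emeasure (distr \<nu> \<nu> (sh (a g))) A = 0 \<longleftrightarrow> emeasure \<nu> A = 0"
      using g c_pos by (subst emeasure_shrunk, simp, simp, subst (2) emeasure_split) auto
  qed
  then show ?thesis
    using mult one by (auto simp: nonsingular_actions_def)
qed

text \<open>Stationarity is linear in the image measures: the scaled copy inherits it from
  \<open>a\<close>, tested on the preimage of B under \<phi>, and the remainder, being the same for
  all g, is reproduced because \<mu> has total mass 1.\<close>

lemma shrunk_stationary:
  fixes G (structure)
  assumes G: "group G" and \<mu>: "prob_on_group G \<mu>" and a: "a \<in> stationary_actions G \<mu> \<nu>"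
  shows "(\<lambda>g\<in>carrier G. sh (a g)) \<in> stationary_actions G \<mu> \<nu>"
  unfolding stationary_actions_def
proof (intro CollectI conjI ballI)
  note na = stationary_nonsingular[OF a]
  note aut = nonsingular_actions_aut[OF na]
  note [measurable] = aut[THEN nonsingular_aut_measurable]
  show "(\<lambda>g\<in>carrier G. sh (a g)) \<in> nonsingular_actions G \<nu>"
    by (rule shrunk_action[OF G na])
  fix B assume B[measurable]: "B \<in> sets \<nu>"
  have m[measurable]: "\<phi> -` B \<in> sets \<nu>" using measurable_sets[OF meas(1) B] by simp
  have eq: "measure (distr \<nu> \<nu> (sh (a g))) B = c * measure (distr \<nu> \<nu> (a g)) (\<phi> -` B) + measure \<nu> (B - Y)"
    if "g \<in> carrier G" for g
  proof -
    interpret D: prob_space "distr \<nu> \<nu> (a g)" using that by (intro prob_space_distr) simp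
    have "emeasure (distr \<nu> \<nu> (sh (a g))) B = ennreal (c * measure (distr \<nu> \<nu> (a g)) (\<phi> -` B) + measure \<nu> (B - Y))"
      using that c_pos by (subst emeasure_shrunk)
        (auto simp: D.emeasure_eq_measure emeasure_eq_measure ennreal_mult ennreal_plus)
    then show ?thesis unfolding measure_def[of "distr \<nu> \<nu> (sh (a g))"]
      by (simp only:, intro enn2real_ennreal) (use c_pos in simp)
  qed
  have "emeasure \<nu> B = ennreal (c * measure \<nu> (\<phi> -` B) + measure \<nu> (B - Y))"
    using c_pos by (subst emeasure_split) (auto simp: emeasure_eq_measure ennreal_mult ennreal_plus)
  then have tot: "measure \<nu> B = measure \<nu> (\<phi> -` B) * c + 1 * measure \<nu> (B - Y)"
    unfolding emeasure_eq_measure using c_pos by (subst (asm) ennreal_inj) (auto simp: mult.commute)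
  have "((\<lambda>g. \<mu> g * measure (distr \<nu> \<nu> (a g)) (\<phi> -` B)) has_sum measure \<nu> (\<phi> -` B)) (carrier G)"
    using a m by (auto simp: stationary_actions_def)
  moreover have "(\<mu> has_sum 1) (carrier G)" using \<mu> by (simp add: prob_on_group_def)
  ultimately have "((\<lambda>g. \<mu> g * measure (distr \<nu> \<nu> (a g)) (\<phi> -` B) * c + \<mu> g * measure \<nu> (B - Y)) has_sum measure \<nu> B) (carrier G)"
    unfolding tot by (intro has_sum_add has_sum_cmult_left)
  then show "((\<lambda>g. \<mu> g * measure (distr \<nu> \<nu> ((\<lambda>g\<in>carrier G. sh (a g)) g)) B) has_sum measure \<nu> B) (carrier G)"
    by (rule has_sum_cong[THEN iffD1, rotated]) (simp add: eq algebra_simps)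
qed

text \<open>On Y both \<nu> and the image measure are c times an image under \<phi>, so the factor c
  cancels in the density. The formula is checked by integrating over sets.\<close>

lemma U1_ind_shrunk:
  assumes T: "nonsingular_aut \<nu> T" and T': "nonsingular_aut \<nu> (sh T)" and A[measurable]: "A \<in> sets \<nu>"
  shows "AE x in \<nu>. U1_ind \<nu> (sh T) A x = (if x \<in> Y then U1_ind \<nu> T (\<phi> -` A) (\<psi> x) else indicator A x)"
proof (rule U1_ind_unique[OF T' A])
  have m[measurable]: "\<phi> -` A \<in> sets \<nu>" using measurable_sets[OF meas(1) A] by simp
  note [measurable] = nonsingular_aut_measurable[OF T] U1_ind_measurable[OF T m]
  have [measurable]: "- Y \<in> sets \<nu>" using sets.compl_sets[OF meas(3)] by (simp add: Compl_eq_Diff_UNIV)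
  show "(\<lambda>x. if x \<in> Y then U1_ind \<nu> T (\<phi> -` A) (\<psi> x) else indicator A x) \<in> borel_measurable \<nu>"
    by measurable
  show "0 \<le> (if x \<in> Y then U1_ind \<nu> T (\<phi> -` A) (\<psi> x) else indicator A x)" for x by simp
  fix B assume [measurable]: "B \<in> sets \<nu>"
  have "(\<integral>\<^sup>+x. ennreal (if x \<in> Y then U1_ind \<nu> T (\<phi> -` A) (\<psi> x) else indicator A x) * indicator B x \<partial>\<nu>) =
     (\<integral>\<^sup>+x. (ennreal (U1_ind \<nu> T (\<phi> -` A) (\<psi> x)) * indicator B x) * indicator Y x + indicator A x * indicator B x * indicator (-Y) x \<partial>\<nu>)"
    by (intro nn_integral_cong) (auto simp: indicator_def)
  also have "\<dots> = (\<integral>\<^sup>+x. (ennreal (U1_ind \<nu> T (\<phi> -` A) (\<psi> x)) * indicator B x) * indicator Y x \<partial>\<nu>) + (\<integral>\<^sup>+x. indicator A x * indicator B x * indicator (-Y) x \<partial>\<nu>)"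
    by (rule nn_integral_add) auto
  also have "(\<integral>\<^sup>+x. (ennreal (U1_ind \<nu> T (\<phi> -` A) (\<psi> x)) * indicator B x) * indicator Y x \<partial>\<nu>) =
      ennreal c * (\<integral>\<^sup>+x. ennreal (U1_ind \<nu> T (\<phi> -` A) (\<psi> (\<phi> x))) * indicator B (\<phi> x) \<partial>\<nu>)"
    by (rule nn_integral_Y) auto
  also have "(\<integral>\<^sup>+x. ennreal (U1_ind \<nu> T (\<phi> -` A) (\<psi> (\<phi> x))) * indicator B (\<phi> x) \<partial>\<nu>) =
      (\<integral>\<^sup>+x. ennreal (U1_ind \<nu> T (\<phi> -` A) x) * indicator B (\<phi> x) \<partial>\<nu>)"
    by (intro nn_integral_cong_AE) (use \<psi>\<phi> in auto)
  also have "\<dots> = (\<integral>\<^sup>+x. indicator (\<phi> -` A) x * indicator B (\<phi> (T x)) \<partial>\<nu>)"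
    by (rule nn_integral_U1_ind[OF T]) auto
  also have "\<dots> = (\<integral>\<^sup>+x. indicator A (\<phi> x) * indicator B (\<phi> (T x)) \<partial>\<nu>)"
    by (intro nn_integral_cong) (auto simp: indicator_def)
  finally show "(\<integral>\<^sup>+x. ennreal (if x \<in> Y then U1_ind \<nu> T (\<phi> -` A) (\<psi> x) else indicator A x) * indicator B x \<partial>\<nu>) =
     (\<integral>\<^sup>+x. indicator A x * indicator B (sh T x) \<partial>\<nu>)"
    by (subst nn_integral_shrunk) auto
qed

text \<open>The shrunk map fixes every point of A. Weak closeness to a shrunk action, tested on such
  an A, is therefore L1-closeness to the indicator of A.\<close>

lemma U1_ind_shrunk_trivial:
  assumes T: "nonsingular_aut \<nu> (sh T)" and A[measurable]: "A \<in> sets \<nu>" and AY: "A \<inter> Y = {}"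
  shows "AE x in \<nu>. U1_ind \<nu> (sh T) A x = indicator A x"
proof (rule U1_ind_unique[OF T A])
  fix B
  show "(\<integral>\<^sup>+x. ennreal (indicator A x) * indicator B x \<partial>\<nu>) = (\<integral>\<^sup>+x. indicator A x * indicator B (sh T x) \<partial>\<nu>)"
    using AY by (intro nn_integral_cong) (auto simp: shrunk_def indicator_def)
qed auto

section \<open>Weak distance between a transformation and its shrunk version\<close>

abbreviation displacement :: "('x \<Rightarrow> real) \<Rightarrow> real" where
  "displacement f \<equiv> \<integral>x. \<bar>indicator Y x * f (\<psi> x) - f x\<bar> \<partial>\<nu>"

lemma nn_integral_Y_\<psi>:
  assumes [measurable]: "F \<in> borel_measurable \<nu>"
  shows "(\<integral>\<^sup>+x. F (\<psi> x) * indicator Y x \<partial>\<nu>) = ennreal c * (\<integral>\<^sup>+x. F x \<partial>\<nu>)"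
proof -
  have "(\<integral>\<^sup>+x. F (\<psi> x) * indicator Y x \<partial>\<nu>) = ennreal c * (\<integral>\<^sup>+x. F (\<psi> (\<phi> x)) \<partial>\<nu>)"
    by (rule nn_integral_Y) simp
  also have "(\<integral>\<^sup>+x. F (\<psi> (\<phi> x)) \<partial>\<nu>) = (\<integral>\<^sup>+x. F x \<partial>\<nu>)"
    by (intro nn_integral_cong_AE) (use \<psi>\<phi> in auto)
  finally show ?thesis .
qed

lemma nn_displacement:
  assumes f: "integrable \<nu> f"
  shows "(\<integral>\<^sup>+x. ennreal \<bar>indicator Y x * f (\<psi> x) - f x\<bar> \<partial>\<nu>) = ennreal (displacement f)"
proof (rule nn_integral_eq_integral)
  have [measurable]: "f \<in> borel_measurable \<nu>" using f by simp
  have "(\<integral>\<^sup>+x. ennreal (norm (f x)) \<partial>\<nu>) < \<infinity>" using f by (simp add: integrable_iff_bounded)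
  then have "(\<integral>\<^sup>+x. ennreal (norm (f (\<psi> x))) * indicator Y x \<partial>\<nu>) < \<infinity>"
    by (subst nn_integral_Y_\<psi>) (auto simp: ennreal_mult_less_top)
  moreover have "(\<integral>\<^sup>+x. ennreal (norm (indicator Y x * f (\<psi> x))) \<partial>\<nu>) = (\<integral>\<^sup>+x. ennreal (norm (f (\<psi> x))) * indicator Y x \<partial>\<nu>)"
    by (intro nn_integral_cong) (auto simp: indicator_def)
  ultimately have "integrable \<nu> (\<lambda>x. indicator Y x * f (\<psi> x))"
    by (subst integrable_iff_bounded) simp
  then show "integrable \<nu> (\<lambda>x. \<bar>indicator Y x * f (\<psi> x) - f x\<bar>)" using f by auto
qed auto

text \<open>Inside Y the error splits in two: replacing the preimage of A under \<phi> by A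
  (\<open>e1\<close>), and replacing F composed with \<psi> by F (\<open>e2\<close>). Outside Y the
  crude bound F + 1 suffices, because there F is part of \<open>e2\<close> and 1 is
  \<open>e3\<close>. As T acts isometrically on L1, the integral of \<open>e1\<close> no longer
  depends on T and is bounded by the displacement of the indicator of A.\<close>

lemma weak_dist_shrunk:
  assumes T: "nonsingular_aut \<nu> T" and T': "nonsingular_aut \<nu> (sh T)" and A[measurable]: "A \<in> sets \<nu>"
  shows "weak_dist \<nu> A (sh T) T \<le>
    ennreal (displacement (indicator A) + displacement (U1_ind \<nu> T A) + displacement (\<lambda>_. 1))"
proof -
  have m[measurable]: "\<phi> -` A \<in> sets \<nu>" using measurable_sets[OF meas(1) A] by simp
  note [measurable] = nonsingular_aut_measurable[OF T] aut_inv_measurable[OF T] U1_ind_measurable[OF T m] U1_ind_measurable[OF T A]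
  define F where "F = U1_ind \<nu> T A"
  define F' where "F' = U1_ind \<nu> T (\<phi> -` A)"
  have [measurable]: "F \<in> borel_measurable \<nu>" "F' \<in> borel_measurable \<nu>" by (simp_all add: F_def F'_def)
  have F0: "0 \<le> F x" for x by (simp add: F_def)
  define e1 where "e1 x = ennreal \<bar>F' (\<psi> x) - F (\<psi> x)\<bar> * indicator Y x" for x
  define e2 where "e2 x = ennreal \<bar>indicator Y x * F (\<psi> x) - F x\<bar>" for x
  define e3 where "e3 x = ennreal \<bar>indicator Y x * 1 - (1::real)\<bar>" for x
  have [measurable]: "e1 \<in> borel_measurable \<nu>" "e2 \<in> borel_measurable \<nu>" "e3 \<in> borel_measurable \<nu>"
    unfolding e1_def e2_def e3_def by measurable
  have "weak_dist \<nu> A (sh T) T \<le> (\<integral>\<^sup>+x. e1 x + (e2 x + e3 x) \<partial>\<nu>)"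
    unfolding weak_dist_def
  proof (intro nn_integral_mono_AE, use U1_ind_shrunk[OF T T' A] in eventually_elim)
    case (elim x)
    have "\<bar>indicator A x - F x\<bar> \<le> F x + (1::real)" using F0[of x] by (auto simp: indicator_def)
    moreover have "\<bar>F' (\<psi> x) - F x\<bar> \<le> \<bar>F' (\<psi> x) - F (\<psi> x)\<bar> + \<bar>F (\<psi> x) - F x\<bar>" by linarith
    ultimately have "ennreal \<bar>indicator A x - F x\<bar> \<le> ennreal (F x) + ennreal 1"
      "ennreal \<bar>F' (\<psi> x) - F x\<bar> \<le> ennreal \<bar>F' (\<psi> x) - F (\<psi> x)\<bar> + ennreal \<bar>F (\<psi> x) - F x\<bar>"
      using F0[of x] by (auto simp flip: ennreal_plus simp del: ennreal_1 intro!: ennreal_leI)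
    then show ?case
      unfolding elim e1_def e2_def e3_def F_def[symmetric] F'_def[symmetric]
      using F0[of x] by (cases "x \<in> Y") simp_all
  qed
  also have "\<dots> = (\<integral>\<^sup>+x. e1 x \<partial>\<nu>) + ((\<integral>\<^sup>+x. e2 x \<partial>\<nu>) + (\<integral>\<^sup>+x. e3 x \<partial>\<nu>))"
    by (simp add: nn_integral_add)
  also have "(\<integral>\<^sup>+x. e2 x \<partial>\<nu>) = ennreal (displacement F)"
    unfolding e2_def F_def by (rule nn_displacement[OF integrable_U1_ind[OF T A]])
  also have "(\<integral>\<^sup>+x. e3 x \<partial>\<nu>) = ennreal (displacement (\<lambda>_. 1))"
    unfolding e3_def by (rule nn_displacement) simp
  also have "(\<integral>\<^sup>+x. e1 x \<partial>\<nu>) \<le> ennreal (displacement (indicator A))"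
  proof -
    have "(\<integral>\<^sup>+x. e1 x \<partial>\<nu>) = ennreal c * (\<integral>\<^sup>+x. ennreal \<bar>F' x - F x\<bar> \<partial>\<nu>)"
      unfolding e1_def by (rule nn_integral_Y_\<psi>) simp
    also have "(\<integral>\<^sup>+x. ennreal \<bar>F' x - F x\<bar> \<partial>\<nu>) =
      (\<integral>\<^sup>+x. ennreal (RN_jacobian \<nu> T x) * (ennreal \<bar>indicator (\<phi> -` A) (aut_inv \<nu> T x) - indicator A (aut_inv \<nu> T x)\<bar> * 1) \<partial>\<nu>)"
      unfolding F'_def F_def U1_ind_eq
      by (intro nn_integral_cong) (auto simp: indicator_def)
    also have "\<dots> = (\<integral>\<^sup>+x. ennreal \<bar>indicator (\<phi> -` A) x - indicator A x\<bar> * 1 \<partial>\<nu>)"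
      by (rule nn_integral_jacobian_aut_inv[OF T]) auto
    also have "\<dots> = (\<integral>\<^sup>+x. ennreal \<bar>indicator A (\<phi> x) - indicator A (\<psi> (\<phi> x))\<bar> \<partial>\<nu>)"
      by (intro nn_integral_cong_AE) (use \<psi>\<phi> in eventually_elim, auto simp: indicator_def)
    also have "ennreal c * \<dots> = (\<integral>\<^sup>+x. ennreal \<bar>indicator A x - indicator A (\<psi> x)\<bar> * indicator Y x \<partial>\<nu>)"
      by (rule nn_integral_Y[symmetric]) auto
    also have "\<dots> \<le> (\<integral>\<^sup>+x. ennreal \<bar>indicator Y x * indicator A (\<psi> x) - indicator A x\<bar> \<partial>\<nu>)"
      by (intro nn_integral_mono) (auto simp: indicator_def)
    also have "\<dots> = ennreal (displacement (indicator A))"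
      by (rule nn_displacement) (auto intro!: integrable_real_indicator simp: top.not_eq_extremum[symmetric])
    finally show ?thesis .
  qed
  finally show ?thesis
    by (simp add: F_def ennreal_plus add.assoc)
qed

end

section \<open>Square integrable functions\<close>

text \<open>Functions rather than classes: identities in the Hilbert space become almost everywhere
  statements, which matches actions given by representatives.\<close>

definition L2 :: "'y measure \<Rightarrow> ('y \<Rightarrow> complex) set" where
  "L2 M = {f \<in> borel_measurable M. integrable M (\<lambda>x. (cmod (f x))\<^sup>2)}"

definition sqn :: "'y measure \<Rightarrow> ('y \<Rightarrow> complex) \<Rightarrow> real" where
  "sqn M f = (\<integral>x. (cmod (f x))\<^sup>2 \<partial>M)"

definition ip :: "'y measure \<Rightarrow> ('y \<Rightarrow> complex) \<Rightarrow> ('y \<Rightarrow> complex) \<Rightarrow> complex" where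
  "ip M f g = (\<integral>x. f x * cnj (g x) \<partial>M)"

lemma L2_measurable[measurable_dest]: "f \<in> L2 M \<Longrightarrow> f \<in> borel_measurable M"
  by (simp add: L2_def)

lemma L2_integrable: "f \<in> L2 M \<Longrightarrow> integrable M (\<lambda>x. (cmod (f x))\<^sup>2)"
  by (simp add: L2_def)

lemma sqn_nonneg[simp]: "0 \<le> sqn M f"
  by (simp add: sqn_def)

lemma cmod_add_sq: "(cmod (a + b))\<^sup>2 \<le> 2 * (cmod a)\<^sup>2 + 2 * (cmod b)\<^sup>2"
proof -
  have "(cmod (a + b))\<^sup>2 \<le> (cmod a + cmod b)\<^sup>2" by (intro power_mono norm_triangle_ineq) simp
  also have "\<dots> \<le> 2 * (cmod a)\<^sup>2 + 2 * (cmod b)\<^sup>2"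
    using sum_squares_bound[of "cmod a" "cmod b"] by (simp add: power2_sum)
  finally show ?thesis .
qed

lemma cmod_diff_sq: "(cmod (a - b))\<^sup>2 \<le> 2 * (cmod a)\<^sup>2 + 2 * (cmod b)\<^sup>2"
  using cmod_add_sq[of a "- b"] by simp

lemma borel_measurable_cnj[measurable]: "cnj \<in> borel_measurable borel"
  by (intro borel_measurable_continuous_onI continuous_intros)

lemma L2_add: assumes "f \<in> L2 M" "g \<in> L2 M" shows "(\<lambda>x. f x + g x) \<in> L2 M"
proof -
  have "integrable M (\<lambda>x. (cmod (f x + g x))\<^sup>2)"
    by (rule Bochner_Integration.integrable_bound[where f="\<lambda>x. 2 * (cmod (f x))\<^sup>2 + 2 * (cmod (g x))\<^sup>2"])
       (use assms in \<open>auto simp: L2_def cmod_add_sq\<close>)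
  then show ?thesis using assms by (auto simp: L2_def)
qed

lemma L2_smult: assumes "f \<in> L2 M" shows "(\<lambda>x. c * f x) \<in> L2 M"
  using assms by (auto simp: L2_def norm_mult power_mult_distrib)

lemma L2_diff: assumes "f \<in> L2 M" "g \<in> L2 M" shows "(\<lambda>x. f x - g x) \<in> L2 M"
  using L2_add[OF assms(1) L2_smult[OF assms(2), of "-1"]] by simp

lemma L2_zero: "(\<lambda>x. 0) \<in> L2 M"
  by (simp add: L2_def)

lemma L2_sum: "(\<And>i. i \<in> I \<Longrightarrow> f i \<in> L2 M) \<Longrightarrow> (\<lambda>x. \<Sum>i\<in>I. f i x) \<in> L2 M"
  by (induction I rule: infinite_finite_induct) (auto simp: L2_zero L2_add)

lemma L2_ip_integrable: assumes "f \<in> L2 M" "g \<in> L2 M" shows "integrable M (\<lambda>x. f x * cnj (g x))"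
proof (rule Bochner_Integration.integrable_bound[where f="\<lambda>x. (cmod (f x))\<^sup>2 + (cmod (g x))\<^sup>2"])
  show "AE x in M. norm (f x * cnj (g x)) \<le> norm ((cmod (f x))\<^sup>2 + (cmod (g x))\<^sup>2)"
  proof (rule AE_I2)
    fix x
    have "cmod (f x) * cmod (g x) \<le> (cmod (f x))\<^sup>2 + (cmod (g x))\<^sup>2"
      using sum_squares_bound[of "cmod (f x)" "cmod (g x)"] zero_le_power2[of "cmod (f x)"] zero_le_power2[of "cmod (g x)"]
        mult_nonneg_nonneg[OF norm_ge_zero[of "f x"] norm_ge_zero[of "g x"]] by linarith
    then show "norm (f x * cnj (g x)) \<le> norm ((cmod (f x))\<^sup>2 + (cmod (g x))\<^sup>2)"
      by (simp add: norm_mult)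
  qed
qed (use assms in \<open>auto simp: L2_def\<close>)

lemma ip_add_left: "f \<in> L2 M \<Longrightarrow> g \<in> L2 M \<Longrightarrow> h \<in> L2 M \<Longrightarrow> ip M (\<lambda>x. f x + g x) h = ip M f h + ip M g h"
  unfolding ip_def using L2_ip_integrable[of f M h] L2_ip_integrable[of g M h] by (simp add: algebra_simps)

lemma ip_diff_left: "f \<in> L2 M \<Longrightarrow> g \<in> L2 M \<Longrightarrow> h \<in> L2 M \<Longrightarrow> ip M (\<lambda>x. f x - g x) h = ip M f h - ip M g h"
  unfolding ip_def using L2_ip_integrable[of f M h] L2_ip_integrable[of g M h] by (simp add: algebra_simps)

lemma ip_smult_left: "ip M (\<lambda>x. c * f x) h = c * ip M f h"
  unfolding ip_def by (simp add: mult.assoc)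

lemma ip_commute: "ip M g f = cnj (ip M f g)"
proof -
  have "cnj (ip M f g) = (\<integral>x. cnj (f x * cnj (g x)) \<partial>M)"
    unfolding ip_def by (rule Bochner_Integration.integral_cnj[symmetric])
  also have "\<dots> = ip M g f" unfolding ip_def by (intro Bochner_Integration.integral_cong) auto
  finally show ?thesis by simp
qed

lemma ip_smult_right: "ip M f (\<lambda>x. c * h x) = cnj c * ip M f h"
  by (subst (1 2) ip_commute) (simp add: ip_smult_left)

lemma ip_self: "ip M f f = of_real (sqn M f)"
  unfolding ip_def sqn_def by (simp flip: complex_norm_square integral_complex_of_real)

lemma ip_sum_left:
  "(\<And>i. i \<in> I \<Longrightarrow> f i \<in> L2 M) \<Longrightarrow> h \<in> L2 M \<Longrightarrow> ip M (\<lambda>x. \<Sum>i\<in>I. f i x) h = (\<Sum>i\<in>I. ip M (f i) h)"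
proof (induction I rule: infinite_finite_induct)
  case (insert i I)
  then show ?case using ip_add_left[of "f i" M "\<lambda>x. \<Sum>i\<in>I. f i x" h] by (simp add: L2_sum)
qed (auto simp: ip_def)

lemma sqn_smult: "sqn M (\<lambda>x. c * f x) = (cmod c)\<^sup>2 * sqn M f"
  unfolding sqn_def by (simp add: norm_mult power_mult_distrib)

lemma sqn_minus_commute: "sqn M (\<lambda>x. f x - g x) = sqn M (\<lambda>x. g x - f x)"
  unfolding sqn_def by (simp add: norm_minus_commute)

lemma sqn_diff:
  assumes "f \<in> L2 M" "g \<in> L2 M"
  shows "sqn M (\<lambda>x. f x - g x) = sqn M f + sqn M g - 2 * Re (ip M f g)"
proof -
  have "complex_of_real (sqn M (\<lambda>x. f x - g x)) = ip M (\<lambda>x. f x - g x) (\<lambda>x. f x - g x)"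
    by (simp add: ip_self)
  also have "\<dots> = ip M f (\<lambda>x. f x - g x) - ip M g (\<lambda>x. f x - g x)"
    using assms by (intro ip_diff_left L2_diff)
  also have "\<dots> = cnj (ip M (\<lambda>x. f x - g x) f) - cnj (ip M (\<lambda>x. f x - g x) g)"
    using ip_commute by metis
  also have "\<dots> = cnj (ip M f f - ip M g f) - cnj (ip M f g - ip M g g)"
    using assms by (simp add: ip_diff_left)
  finally show ?thesis
    using ip_commute[of M g f] by (simp add: ip_self complex_eq_iff)
qed

lemma sqn_eq_0_iff: assumes "f \<in> L2 M" shows "sqn M f = 0 \<longleftrightarrow> (AE x in M. f x = 0)"
  unfolding sqn_def using assms by (subst integral_nonneg_eq_0_iff_AE) (auto simp: L2_def)

lemma ip_cong_AE:
  "f \<in> L2 M \<Longrightarrow> f' \<in> L2 M \<Longrightarrow> g \<in> L2 M \<Longrightarrow> AE x in M. f x = f' x \<Longrightarrow> ip M f g = ip M f' g"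
  unfolding ip_def by (intro integral_cong_AE) auto

lemma sqn_cong_AE:
  "f \<in> L2 M \<Longrightarrow> g \<in> L2 M \<Longrightarrow> AE x in M. f x = g x \<Longrightarrow> sqn M f = sqn M g"
  unfolding sqn_def by (intro integral_cong_AE) auto

lemma ip_Cauchy_Schwarz:
  assumes fg: "f \<in> L2 M" "g \<in> L2 M"
  shows "(cmod (ip M f g))\<^sup>2 \<le> sqn M f * sqn M g"
proof (cases "sqn M g = 0")
  case True
  then have "AE x in M. g x = 0" using sqn_eq_0_iff fg by blast
  then have "ip M g f = ip M (\<lambda>x. 0) f" by (intro ip_cong_AE fg L2_zero)
  then have "ip M g f = 0" by (simp add: ip_def)
  then have "ip M f g = 0" using ip_commute[of M f g] by simp
  then show ?thesis by simp
next
  case False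
  then have s: "sqn M g > 0" using sqn_nonneg[of M g] by linarith
  \<comment> \<open>The coefficient of the orthogonal projection of f onto g.\<close>
  define l where "l = ip M f g / sqn M g"
  have "0 \<le> sqn M (\<lambda>x. f x - l * g x)" by simp
  also have "\<dots> = sqn M f + (cmod l)\<^sup>2 * sqn M g - 2 * Re (cnj l * ip M f g)"
    using fg by (subst sqn_diff) (auto simp: L2_smult sqn_smult ip_smult_right)
  also have "cnj l * ip M f g = of_real ((cmod (ip M f g))\<^sup>2 / sqn M g)"
    using s complex_norm_square[of "ip M f g"] by (simp add: l_def mult_ac)
  also have "(cmod l)\<^sup>2 * sqn M g = (cmod (ip M f g))\<^sup>2 / sqn M g"
    using s by (simp add: l_def norm_divide power_divide power2_eq_square)
  finally show ?thesis using s by (simp add: field_simps)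
qed

lemma ip_tendsto:
  assumes "\<And>n. f n \<in> L2 M" "g \<in> L2 M" "h \<in> L2 M" "(\<lambda>n. sqn M (\<lambda>x. f n x - g x)) \<longlonglongrightarrow> 0"
  shows "(\<lambda>n. ip M (f n) h) \<longlonglongrightarrow> ip M g h"
proof -
  have "(\<lambda>n. sqrt (sqn M (\<lambda>x. f n x - g x) * sqn M h)) \<longlonglongrightarrow> sqrt (0 * sqn M h)"
    by (intro tendsto_intros assms)
  then have lim: "(\<lambda>n. sqrt (sqn M (\<lambda>x. f n x - g x) * sqn M h)) \<longlonglongrightarrow> 0" by simp
  have "norm (ip M (f n) h - ip M g h) \<le> sqrt (sqn M (\<lambda>x. f n x - g x) * sqn M h)" for n
    using ip_Cauchy_Schwarz[of "\<lambda>x. f n x - g x" M h] assms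
    by (subst ip_diff_left[symmetric]) (auto intro!: real_le_rsqrt L2_diff)
  then have "(\<lambda>n. ip M (f n) h - ip M g h) \<longlonglongrightarrow> 0"
    by (intro Lim_null_comparison[OF _ lim]) auto
  then show ?thesis by (rule LIM_zero_cancel)
qed

lemma nn_integral_sqn: "f \<in> L2 M \<Longrightarrow> (\<integral>\<^sup>+x. ennreal ((cmod (f x))\<^sup>2) \<partial>M) = ennreal (sqn M f)"
  unfolding sqn_def by (rule nn_integral_eq_integral) (auto simp: L2_def)

lemma L2I_nn:
  assumes [measurable]: "f \<in> borel_measurable M" and "(\<integral>\<^sup>+x. ennreal ((cmod (f x))\<^sup>2) \<partial>M) \<le> ennreal c" "0 \<le> c"
  shows "f \<in> L2 M" "sqn M f \<le> c"
proof -
  show *: "f \<in> L2 M" unfolding L2_def using assms(2)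
    by (auto simp: integrable_iff_bounded order_le_less_trans)
  show "sqn M f \<le> c" using assms(2,3) unfolding nn_integral_sqn[OF *] by simp
qed

text \<open>The weights 4^n keep the integrated squares summable (4^n / 16^n = 1 / 4^n) and force |d
  n x| \<le> sqrt C / 2^n for almost every x, with C depending on x. The increments are then
  absolutely summable, and no triangle inequality for the L2-norm is involved.\<close>

lemma L2_fast_Cauchy_AE_convergent:
  assumes f: "\<And>n. f n \<in> L2 M" and fast: "\<And>n. sqn M (\<lambda>x. f (Suc n) x - f n x) \<le> (1/16)^n"
  shows "AE x in M. convergent (\<lambda>n. f n x)"
proof -
  define d where "d n x = f (Suc n) x - f n x" for n x
  have dL: "d n \<in> L2 M" for n unfolding d_def by (intro L2_diff f)
  note [measurable] = L2_measurable[OF dL]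
  have "(\<integral>\<^sup>+x. (\<Sum>n. ennreal (4^n * (cmod (d n x))\<^sup>2)) \<partial>M) = (\<Sum>n. \<integral>\<^sup>+x. ennreal (4^n * (cmod (d n x))\<^sup>2) \<partial>M)"
    by (rule nn_integral_suminf) measurable
  also have "\<dots> \<le> (\<Sum>n. ennreal ((1/4)^n))"
  proof (intro suminf_le allI)
    fix n
    have "(\<integral>\<^sup>+x. ennreal (4^n * (cmod (d n x))\<^sup>2) \<partial>M) = ennreal (4^n) * ennreal (sqn M (d n))"
      by (simp add: ennreal_mult nn_integral_cmult nn_integral_sqn[OF dL])
    also have "\<dots> \<le> ennreal (4^n * (1/16)^n)"
      using fast[of n, folded d_def] by (subst ennreal_mult[symmetric]) (auto intro!: ennreal_leI mult_left_mono)
    also have "(4::real)^n * (1/16)^n = (1/4)^n" by (simp flip: power_mult_distrib)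
    finally show "(\<integral>\<^sup>+x. ennreal (4^n * (cmod (d n x))\<^sup>2) \<partial>M) \<le> ennreal ((1/4)^n)" .
  qed auto
  also have "\<dots> < \<infinity>"
    using summable_geometric[of "1/4::real"] by (subst suminf_ennreal2) auto
  finally have "AE x in M. (\<Sum>n. ennreal (4^n * (cmod (d n x))\<^sup>2)) \<noteq> \<infinity>"
    by (intro nn_integral_PInf_AE) auto
  then show ?thesis
  proof eventually_elim
    case (elim x)
    define C where "C = enn2real (\<Sum>n. ennreal (4^n * (cmod (d n x))\<^sup>2))"
    have C0: "0 \<le> C" by (simp add: C_def)
    have "cmod (d n x) \<le> sqrt C * (1/2)^n" for n
    proof -
      have "ennreal (4^n * (cmod (d n x))\<^sup>2) \<le> (\<Sum>n. ennreal (4^n * (cmod (d n x))\<^sup>2))"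
        by (rule order_trans[OF _ sum_le_suminf[of _ "{n}"]]) auto
      also have "\<dots> = ennreal C" unfolding C_def using elim by (simp add: top.not_eq_extremum)
      finally have "4^n * (cmod (d n x))\<^sup>2 \<le> C" using C0 by simp
      moreover have "((2::real)^n)\<^sup>2 = 4^n" by (simp add: power2_eq_square flip: power_mult_distrib)
      ultimately have "(2^n * cmod (d n x))\<^sup>2 \<le> C" by (simp only: power_mult_distrib)
      then have "2^n * cmod (d n x) \<le> sqrt C" by (rule real_le_rsqrt)
      then show ?thesis by (simp add: field_simps power_divide)
    qed
    moreover have "summable (\<lambda>n. sqrt C * (1/2)^n)" by (intro summable_mult summable_geometric) simp
    ultimately have "summable (\<lambda>n. d n x)" by (intro summable_comparison_test'[of _ 0 "\<lambda>n. d n x"])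
    then have "convergent (\<lambda>n. \<Sum>i<n. d i x)" by (simp add: summable_iff_convergent)
    moreover have "(\<Sum>i<n. d i x) = f n x - f 0 x" for n
      unfolding d_def by (rule sum_lessThan_telescope)
    ultimately have "convergent (\<lambda>n. (f n x - f 0 x) + f 0 x)"
      by (intro convergent_add convergent_const) simp
    then show ?case by simp
  qed
qed

text \<open>Riesz-Fischer: a rapidly converging subsequence has a pointwise limit, and Fatou's lemma
  turns the Cauchy bounds into bounds on the distance to it.\<close>

lemma L2_complete:
  assumes f: "\<And>n. f n \<in> L2 M"
    and Cauchy: "\<And>e. 0 < e \<Longrightarrow> \<exists>N. \<forall>m\<ge>N. \<forall>n\<ge>N. sqn M (\<lambda>x. f m x - f n x) < e"
  shows "\<exists>g\<in>L2 M. (\<lambda>n. sqn M (\<lambda>x. f n x - g x)) \<longlonglongrightarrow> 0"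
proof -
  have "\<forall>k. \<exists>N. \<forall>m\<ge>N. \<forall>n\<ge>N. sqn M (\<lambda>x. f m x - f n x) < (1/16)^k"
    using Cauchy by simp
  then obtain N where N: "\<And>k m n. m \<ge> N k \<Longrightarrow> n \<ge> N k \<Longrightarrow> sqn M (\<lambda>x. f m x - f n x) < (1/16)^k"
    by metis
  \<comment> \<open>Summing the thresholds makes the indices monotone; the extra k makes them
    unbounded.\<close>
  define r where "r k = (\<Sum>i\<le>k. N i) + k" for k
  have rN: "N k \<le> r k" "k \<le> r k" "r k \<le> r (Suc k)" for k
    unfolding r_def by (auto simp: sum.atMost_Suc intro: member_le_sum trans_le_add1)
  have conv: "AE x in M. convergent (\<lambda>k. f (r k) x)"
  proof (rule L2_fast_Cauchy_AE_convergent[OF f])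
    fix k
    have "N k \<le> r (Suc k)" using rN(1,3)[of k] by linarith
    then show "sqn M (\<lambda>x. f (r (Suc k)) x - f (r k) x) \<le> (1/16)^k"
      using N[of k "r (Suc k)" "r k"] rN(1)[of k] by simp
  qed
  note [measurable] = L2_measurable[OF f]
  define g where "g x = lim (\<lambda>k. f (r k) x)" for x
  have [measurable]: "g \<in> borel_measurable M" unfolding g_def by (rule borel_measurable_lim_metric) measurable
  have lim: "AE x in M. (\<lambda>k. f (r k) x) \<longlonglongrightarrow> g x"
    using conv by eventually_elim (simp add: g_def convergent_LIMSEQ_iff)
  have fatou: "(\<integral>\<^sup>+x. ennreal ((cmod (g x - f n x))\<^sup>2) \<partial>M) \<le> ennreal e"
    if e: "\<And>m. m \<ge> K \<Longrightarrow> sqn M (\<lambda>x. f m x - f n x) \<le> e" for n e K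
  proof -
    have "(\<integral>\<^sup>+x. ennreal ((cmod (g x - f n x))\<^sup>2) \<partial>M) = (\<integral>\<^sup>+x. liminf (\<lambda>k. ennreal ((cmod (f (r k) x - f n x))\<^sup>2)) \<partial>M)"
    proof (intro nn_integral_cong_AE, use lim in eventually_elim)
      case (elim x)
      have "(\<lambda>k. ennreal ((cmod (f (r k) x - f n x))\<^sup>2)) \<longlonglongrightarrow> ennreal ((cmod (g x - f n x))\<^sup>2)"
        by (intro tendsto_intros elim)
      then show ?case by (rule lim_imp_Liminf[symmetric, rotated]) simp
    qed
    also have "\<dots> \<le> liminf (\<lambda>k. \<integral>\<^sup>+x. ennreal ((cmod (f (r k) x - f n x))\<^sup>2) \<partial>M)"
      by (rule nn_integral_liminf) measurable
    also have "\<dots> \<le> limsup (\<lambda>k. \<integral>\<^sup>+x. ennreal ((cmod (f (r k) x - f n x))\<^sup>2) \<partial>M)"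
      by (rule Liminf_le_Limsup) simp
    also have "\<dots> \<le> ennreal e"
    proof (rule Limsup_bounded)
      show "\<forall>\<^sub>F k in sequentially. (\<integral>\<^sup>+x. ennreal ((cmod (f (r k) x - f n x))\<^sup>2) \<partial>M) \<le> ennreal e"
        using eventually_ge_at_top[of K]
      proof eventually_elim
        case (elim k)
        then have "K \<le> r k" using rN(2)[of k] by linarith
        then show ?case by (subst nn_integral_sqn) (auto intro!: L2_diff f ennreal_leI e)
      qed
    qed
    finally show ?thesis .
  qed
  obtain K where K: "\<And>m n. m \<ge> K \<Longrightarrow> n \<ge> K \<Longrightarrow> sqn M (\<lambda>x. f m x - f n x) < 1"
    using Cauchy[of 1] by auto
  have "(\<lambda>x. g x - f K x) \<in> L2 M"
    using fatou[of K K 1] K by (intro L2I_nn(1)[where c=1]) (auto intro: less_imp_le)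
  then have gL: "g \<in> L2 M" using L2_add[OF _ f[of K]] by fastforce
  have "(\<lambda>n. sqn M (\<lambda>x. f n x - g x)) \<longlonglongrightarrow> 0"
  proof (rule LIMSEQ_I)
    fix e :: real assume "0 < e"
    then obtain K where K: "\<And>m n. m \<ge> K \<Longrightarrow> n \<ge> K \<Longrightarrow> sqn M (\<lambda>x. f m x - f n x) < e/2"
      using Cauchy[of "e/2"] by auto
    have "sqn M (\<lambda>x. f n x - g x) \<le> e/2" if "n \<ge> K" for n
      using fatou[of K n "e/2"] K that \<open>0 < e\<close>
      by (subst sqn_minus_commute, intro L2I_nn(2)) (auto intro: less_imp_le)
    then show "\<exists>no. \<forall>n\<ge>no. norm (sqn M (\<lambda>x. f n x - g x) - 0) < e"
      using \<open>0 < e\<close> by (intro exI[of _ K]) (force intro: le_less_trans[of _ "e/2"])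
  qed
  then show ?thesis using gL by blast
qed

section \<open>Orthonormal expansions\<close>

definition orthonormal_or_zero :: "'y measure \<Rightarrow> (nat \<Rightarrow> 'y \<Rightarrow> complex) \<Rightarrow> bool" where
  "orthonormal_or_zero M e \<longleftrightarrow> (\<forall>k. e k \<in> L2 M) \<and> (\<forall>j k. j \<noteq> k \<longrightarrow> ip M (e j) (e k) = 0) \<and>
     (\<forall>k. sqn M (e k) = 1 \<or> e k = (\<lambda>x. 0))"

lemma ip_zero_right[simp]: "ip M f (\<lambda>x. 0) = 0" and ip_zero_left[simp]: "ip M (\<lambda>x. 0) f = 0"
  by (simp_all add: ip_def)

lemma sqn_zero[simp]: "sqn M (\<lambda>x. 0) = 0"
  by (simp add: sqn_def)

text \<open>Dividing by a vanishing norm produces the zero function, so no case distinction is needed for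
  linearly dependent families.\<close>

fun gram_schmidt :: "'y measure \<Rightarrow> (nat \<Rightarrow> 'y \<Rightarrow> complex) \<Rightarrow> nat \<Rightarrow> 'y \<Rightarrow> complex" where
  "gram_schmidt M c k =
     (let r = (\<lambda>x. c k x - (\<Sum>j<k. ip M (c k) (gram_schmidt M c j) * gram_schmidt M c j x))
      in (\<lambda>x. complex_of_real (inverse (sqrt (sqn M r))) * r x))"

declare gram_schmidt.simps[simp del]

text \<open>Up to a null function, each \<open>c k\<close> is a combination of the first k + 1
  orthonormalised vectors; a residual of norm 0 is itself only null, not zero. The second part
  serves to pass totality from \<open>c\<close> to its orthonormalisation.\<close>

lemma gram_schmidt_orthonormal:
  assumes c: "\<And>k. c k \<in> L2 M"
  shows "orthonormal_or_zero M (gram_schmidt M c)"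
    and "f \<in> L2 M \<Longrightarrow> (\<And>k. ip M f (gram_schmidt M c k) = 0) \<Longrightarrow> ip M f (c k) = 0"
proof -
  define e where "e = gram_schmidt M c"
  define r where "r k x = c k x - (\<Sum>j<k. ip M (c k) (e j) * e j x)" for k x
  have e: "e k = (\<lambda>x. complex_of_real (inverse (sqrt (sqn M (r k)))) * r k x)" for k
    unfolding e_def r_def by (subst gram_schmidt.simps) (simp add: Let_def)
  have eL: "e k \<in> L2 M" for k
  proof (induction k rule: less_induct)
    case (less k)
    then have "r k \<in> L2 M" unfolding r_def by (intro L2_diff L2_sum L2_smult c) auto
    then show ?case unfolding e by (rule L2_smult)
  qed
  have rL: "r k \<in> L2 M" for k unfolding r_def by (intro L2_diff L2_sum L2_smult c eL)
  have norm: "sqn M (e k) = 1 \<or> e k = (\<lambda>x. 0)" for k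
  proof (cases "sqn M (r k) = 0")
    case True then show ?thesis by (simp add: e)
  next
    case False
    then have "sqn M (r k) > 0" using sqn_nonneg[of M "r k"] by linarith
    then have "sqn M (e k) = 1"
      unfolding e sqn_smult norm_of_real by (simp add: power_inverse)
    then show ?thesis ..
  qed
  have orth: "\<forall>j<k. ip M (e k) (e j) = 0" for k
  proof (induction k rule: less_induct)
    case (less k)
    show ?case
    proof (intro allI impI)
      fix j assume j: "j < k"
      have "ip M (e i) (e j) = 0" if "i < k" "i \<noteq> j" for i
      proof (cases "i < j")
        case True
        then have "ip M (e j) (e i) = 0" using less j by blast
        then show ?thesis using ip_commute[of M "e i" "e j"] by simp
      next
        case False
        then show ?thesis using less that by auto
      qed
      then have "(\<Sum>i<k. ip M (c k) (e i) * ip M (e i) (e j)) = (\<Sum>i<k. if i = j then ip M (c k) (e j) * ip M (e j) (e j) else 0)"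
        by (intro sum.cong) auto
      also have "\<dots> = ip M (c k) (e j) * ip M (e j) (e j)" using j by simp
      \<comment> \<open>If \<open>e j\<close> is a zero entry, both sides vanish.\<close>
      also have "\<dots> = ip M (c k) (e j)"
        using norm[of j] by (auto simp: ip_self)
      finally have "ip M (r k) (e j) = 0"
        unfolding r_def using c eL
        by (subst ip_diff_left) (auto simp: L2_sum L2_smult ip_sum_left ip_smult_left)
      then show "ip M (e k) (e j) = 0" by (simp add: e[of k] ip_smult_left)
    qed
  qed
  have "ip M (e j) (e k) = 0" if "j \<noteq> k" for j k
    using orth[of j] orth[of k] ip_commute[of M "e j" "e k"] that by (metis complex_cnj_zero linorder_neqE_nat)
  then show "orthonormal_or_zero M (gram_schmidt M c)"
    using eL norm unfolding e_def[symmetric] orthonormal_or_zero_def by blast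
  assume f: "f \<in> L2 M" and "\<And>k. ip M f (gram_schmidt M c k) = 0"
  then have f0: "ip M f (e j) = 0" for j by (simp add: e_def)
  have fe: "ip M (e j) f = 0" for j using ip_commute[of M "e j" f] f0 by simp
  have "ip M (r k) f = 0"
  proof (cases "sqn M (r k) = 0")
    case True
    then have "AE x in M. r k x = 0" using sqn_eq_0_iff[OF rL] by simp
    then show ?thesis using ip_cong_AE[OF rL L2_zero f] by simp
  next
    case False
    then have "sqn M (r k) > 0" using sqn_nonneg[of M "r k"] by linarith
    then show ?thesis using fe[of k] by (simp add: e ip_smult_left)
  qed
  then have "ip M (c k) f = 0"
    unfolding r_def using c eL f fe
    by (subst (asm) ip_diff_left) (auto simp: L2_sum L2_smult ip_sum_left ip_smult_left)
  then show "ip M f (c k) = 0" using ip_commute[of M f "c k"] by simp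
qed

lemma sqn_orthogonal_sum:
  assumes e: "orthonormal_or_zero M e" and f: "f \<in> L2 M" and I: "finite I"
  shows "sqn M (\<lambda>x. \<Sum>k\<in>I. ip M f (e k) * e k x) = (\<Sum>k\<in>I. (cmod (ip M f (e k)))\<^sup>2)"
    and "ip M f (\<lambda>x. \<Sum>k\<in>I. ip M f (e k) * e k x) = of_real (\<Sum>k\<in>I. (cmod (ip M f (e k)))\<^sup>2)"
    and "ip M (\<lambda>x. \<Sum>k\<in>I. ip M f (e k) * e k x) (e j) = (if j \<in> I then ip M f (e j) else 0)"
proof -
  have eL: "e k \<in> L2 M" for k using e by (auto simp: orthonormal_or_zero_def)
  define s where "s x = (\<Sum>k\<in>I. ip M f (e k) * e k x)" for x
  have sL: "s \<in> L2 M" unfolding s_def by (intro L2_sum L2_smult eL)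
  have ee: "ip M f (e j) * ip M (e j) (e j) = ip M f (e j)" for j
    using e by (cases "e j = (\<lambda>x. 0)") (auto simp: ip_self orthonormal_or_zero_def)
  have se: "ip M s (e j) = (if j \<in> I then ip M f (e j) else 0)" for j
  proof -
    have "ip M s (e j) = (\<Sum>k\<in>I. ip M f (e k) * ip M (e k) (e j))"
      unfolding s_def using eL by (subst ip_sum_left) (auto simp: L2_smult ip_smult_left)
    also have "\<dots> = (\<Sum>k\<in>I. if k = j then ip M f (e j) else 0)"
      using e by (intro sum.cong) (auto simp: orthonormal_or_zero_def ee[unfolded orthonormal_or_zero_def])
    finally show ?thesis using I by simp
  qed
  show "ip M (\<lambda>x. \<Sum>k\<in>I. ip M f (e k) * e k x) (e j) = (if j \<in> I then ip M f (e j) else 0)"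
    using se unfolding s_def .
  have gs: "ip M g s = (\<Sum>k\<in>I. cnj (ip M f (e k)) * ip M g (e k))" if g: "g \<in> L2 M" for g
  proof -
    have "ip M s g = (\<Sum>k\<in>I. ip M f (e k) * ip M (e k) g)"
      unfolding s_def using eL g by (subst ip_sum_left) (auto simp: L2_smult ip_smult_left)
    then have "ip M g s = cnj (\<Sum>k\<in>I. ip M f (e k) * ip M (e k) g)" using ip_commute[of M g s] by simp
    moreover have "cnj (ip M (e k) g) = ip M g (e k)" for k using ip_commute[of M g "e k"] by simp
    ultimately show ?thesis by simp
  qed
  have mm: "cnj z * z = of_real ((cmod z)\<^sup>2)" for z by (subst complex_norm_square) (rule mult.commute)
  have fs: "ip M f s = of_real (\<Sum>k\<in>I. (cmod (ip M f (e k)))\<^sup>2)"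
    using gs[OF f] by (simp only: mm of_real_sum)
  then show "ip M f (\<lambda>x. \<Sum>k\<in>I. ip M f (e k) * e k x) = of_real (\<Sum>k\<in>I. (cmod (ip M f (e k)))\<^sup>2)"
    unfolding s_def .
  have "complex_of_real (sqn M s) = (\<Sum>k\<in>I. cnj (ip M f (e k)) * ip M f (e k))"
    using gs[OF sL] by (simp add: ip_self se cong: sum.cong)
  then have "complex_of_real (sqn M s) = of_real (\<Sum>k\<in>I. (cmod (ip M f (e k)))\<^sup>2)" by (simp only: mm of_real_sum)
  then show "sqn M (\<lambda>x. \<Sum>k\<in>I. ip M f (e k) * e k x) = (\<Sum>k\<in>I. (cmod (ip M f (e k)))\<^sup>2)"
    unfolding s_def using of_real_eq_iff by blast
qed

text \<open>Bessel's inequality makes the partial sums Cauchy. Their limit has the same coefficients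
  as f, so totality identifies it with f, and the distance of f to its partial sums tends to
  0.\<close>

lemma Parseval:
  assumes e: "orthonormal_or_zero M e" and f: "f \<in> L2 M"
    and total: "\<And>g. g \<in> L2 M \<Longrightarrow> (\<And>k. ip M g (e k) = 0) \<Longrightarrow> AE x in M. g x = 0"
  shows "(\<lambda>k. (cmod (ip M f (e k)))\<^sup>2) sums sqn M f"
proof -
  have eL: "e k \<in> L2 M" for k using e by (auto simp: orthonormal_or_zero_def)
  define a where "a k = (cmod (ip M f (e k)))\<^sup>2" for k
  define s where "s n x = (\<Sum>k<n. ip M f (e k) * e k x)" for n x
  have sL: "s n \<in> L2 M" for n unfolding s_def by (intro L2_sum L2_smult eL)
  have fs: "sqn M (\<lambda>x. f x - s n x) = sqn M f - (\<Sum>k<n. a k)" for n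
    using sqn_orthogonal_sum(1,2)[OF e f, of "{..<n}"]
    by (subst sqn_diff[OF f sL]) (simp add: s_def[abs_def] a_def)
  have bound: "(\<Sum>k<n. a k) \<le> sqn M f" for n using fs[of n] sqn_nonneg[of M "\<lambda>x. f x - s n x"] by linarith
  have a0: "0 \<le> a k" for k by (simp add: a_def)
  have summ: "summable a" by (rule summableI_nonneg_bounded[OF a0 bound])
  have ss: "sqn M (\<lambda>x. s n x - s m x) = (\<Sum>k\<in>{m..<n}. a k)" if "m \<le> n" for m n
  proof -
    have "s n x - s m x = (\<Sum>k\<in>{m..<n}. ip M f (e k) * e k x)" for x
      unfolding s_def using that by (simp add: lessThan_atLeast0 sum_diff_nat_ivl)
    then show ?thesis using sqn_orthogonal_sum(1)[OF e f, of "{m..<n}"] by (simp add: a_def)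
  qed
  have "\<exists>g\<in>L2 M. (\<lambda>n. sqn M (\<lambda>x. s n x - g x)) \<longlonglongrightarrow> 0"
  proof (rule L2_complete[OF sL])
    fix d :: real assume "0 < d"
    then obtain N where N: "\<And>m n. m \<ge> N \<Longrightarrow> norm (\<Sum>k\<in>{m..<n}. a k) < d"
      using summ[unfolded summable_Cauchy] by blast
    have le: "sqn M (\<lambda>x. s n x - s m x) < d" if "N \<le> m" "m \<le> n" for m n
      using ss[OF that(2)] N[OF that(1), of n] by auto
    have "sqn M (\<lambda>x. s m x - s n x) < d" if "N \<le> m" "N \<le> n" for m n
      using le[of m n] le[of n m] that sqn_minus_commute[of M "s n" "s m"] by (cases "m \<le> n") auto
    then show "\<exists>N. \<forall>m\<ge>N. \<forall>n\<ge>N. sqn M (\<lambda>x. s m x - s n x) < d" by blast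
  qed
  then obtain g where g: "g \<in> L2 M" and lim: "(\<lambda>n. sqn M (\<lambda>x. s n x - g x)) \<longlonglongrightarrow> 0" by blast
  have "ip M (\<lambda>x. f x - g x) (e k) = 0" for k
  proof -
    have "(\<lambda>n. ip M (s n) (e k)) \<longlonglongrightarrow> ip M g (e k)" by (rule ip_tendsto[OF sL g eL lim])
    moreover have "eventually (\<lambda>n. ip M (s n) (e k) = ip M f (e k)) sequentially"
      using eventually_gt_at_top[of k]
      by eventually_elim (use sqn_orthogonal_sum(3)[OF e f] in \<open>simp add: s_def[abs_def]\<close>)
    ultimately have "ip M g (e k) = ip M f (e k)"
      by (rule LIMSEQ_unique[OF _ tendsto_eventually])
    then show ?thesis by (simp add: ip_diff_left[OF f g eL])
  qed
  then have "AE x in M. f x - g x = 0" by (intro total L2_diff f g)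
  then have "sqn M (\<lambda>x. s n x - g x) = sqn M (\<lambda>x. f x - s n x)" for n
    by (subst sqn_minus_commute, intro sqn_cong_AE L2_diff sL f g) auto
  then have "(\<lambda>n. sqn M f - (\<Sum>k<n. a k)) \<longlonglongrightarrow> 0" using lim by (simp add: fs)
  then have "(\<lambda>n. sqn M f - (sqn M f - (\<Sum>k<n. a k))) \<longlonglongrightarrow> sqn M f - 0" by (intro tendsto_intros)
  then show ?thesis by (simp add: sums_def a_def)
qed

lemma l2_diff:
  assumes "u \<in> l2" "v \<in> l2"
  shows "(\<lambda>n. u n - v n) \<in> l2" "(l2_norm (\<lambda>n. u n - v n))\<^sup>2 \<le> 2 * (l2_norm u)\<^sup>2 + 2 * (l2_norm v)\<^sup>2"
proof -
  have s: "summable (\<lambda>n. 2 * (cmod (u n))\<^sup>2)" "summable (\<lambda>n. 2 * (cmod (v n))\<^sup>2)"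
    using assms by (auto simp: l2_def)
  have sm: "summable (\<lambda>n. 2 * (cmod (u n))\<^sup>2 + 2 * (cmod (v n))\<^sup>2)" by (rule summable_add[OF s])
  have sd: "summable (\<lambda>n. (cmod (u n - v n))\<^sup>2)"
    by (rule summable_comparison_test'[OF sm, of 0]) (simp add: cmod_diff_sq)
  then show "(\<lambda>n. u n - v n) \<in> l2" by (simp add: l2_def)
  have "(\<Sum>n. (cmod (u n - v n))\<^sup>2) \<le> (\<Sum>n. 2 * (cmod (u n))\<^sup>2 + 2 * (cmod (v n))\<^sup>2)"
    by (intro suminf_le sd sm cmod_diff_sq)
  also have "\<dots> = 2 * (\<Sum>n. (cmod (u n))\<^sup>2) + 2 * (\<Sum>n. (cmod (v n))\<^sup>2)"
    using s assms by (subst suminf_add[symmetric]) (auto simp: l2_def suminf_mult)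
  finally show "(l2_norm (\<lambda>n. u n - v n))\<^sup>2 \<le> 2 * (l2_norm u)\<^sup>2 + 2 * (l2_norm v)\<^sup>2"
    unfolding l2_norm_def using assms sd by (simp add: l2_def suminf_nonneg)
qed

lemma cmod_le_l2_norm:
  assumes "u \<in> l2" shows "(cmod (u n))\<^sup>2 \<le> (l2_norm u)\<^sup>2"
proof -
  have "(cmod (u n))\<^sup>2 \<le> (\<Sum>n. (cmod (u n))\<^sup>2)"
    using sum_le_suminf[of "\<lambda>n. (cmod (u n))\<^sup>2" "{n}"] assms by (simp add: l2_def)
  then show ?thesis unfolding l2_norm_def using assms by (simp add: l2_def suminf_nonneg)
qed

section \<open>Property (T) for representations on square integrable functions\<close>

text \<open>The total sequence \<open>c\<close> stands for separability of L2(M), on which the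
  passage to sequences of complex numbers rests. The operators satisfy the laws of a representation
  only up to null sets, and only on the closed subspace V, so that the complement of the invariant
  vectors can be taken for V.\<close>

locale L2_representation =
  fixes G :: "('g, 'b) monoid_scheme" (structure) and M :: "'y measure"
    and V :: "('y \<Rightarrow> complex) set" and U :: "'g \<Rightarrow> ('y \<Rightarrow> complex) \<Rightarrow> ('y \<Rightarrow> complex)"
    and c :: "nat \<Rightarrow> 'y \<Rightarrow> complex"
  assumes G: "group G"
    and c: "\<And>k. c k \<in> L2 M"
    and total: "\<And>f. f \<in> L2 M \<Longrightarrow> (\<And>k. ip M f (c k) = 0) \<Longrightarrow> AE x in M. f x = 0"
    and V_L2: "V \<subseteq> L2 M" and V_zero: "(\<lambda>x. 0) \<in> V"
    and V_add: "\<And>f g. f \<in> V \<Longrightarrow> g \<in> V \<Longrightarrow> (\<lambda>x. f x + g x) \<in> V"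
    and V_smult: "\<And>z f. f \<in> V \<Longrightarrow> (\<lambda>x. z * f x) \<in> V"
    and V_closed: "\<And>s f. (\<And>k. s k \<in> V) \<Longrightarrow> f \<in> L2 M \<Longrightarrow> (\<lambda>k. sqn M (\<lambda>x. s k x - f x)) \<longlonglongrightarrow> 0 \<Longrightarrow> f \<in> V"
    and U_V: "\<And>g f. g \<in> carrier G \<Longrightarrow> f \<in> V \<Longrightarrow> U g f \<in> V"
    and U_add: "\<And>g f f'. g \<in> carrier G \<Longrightarrow> f \<in> V \<Longrightarrow> f' \<in> V \<Longrightarrow> AE x in M. U g (\<lambda>x. f x + f' x) x = U g f x + U g f' x"
    and U_smult: "\<And>g f z. g \<in> carrier G \<Longrightarrow> f \<in> V \<Longrightarrow> AE x in M. U g (\<lambda>x. z * f x) x = z * U g f x"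
    and U_sqn: "\<And>g f. g \<in> carrier G \<Longrightarrow> f \<in> V \<Longrightarrow> sqn M (U g f) = sqn M f"
    and U_mult: "\<And>g h f. g \<in> carrier G \<Longrightarrow> h \<in> carrier G \<Longrightarrow> f \<in> V \<Longrightarrow> AE x in M. U (g \<otimes> h) f x = U g (U h f) x"
    and U_one: "\<And>f. f \<in> V \<Longrightarrow> AE x in M. U \<one> f x = f x"
begin

abbreviation "e \<equiv> gram_schmidt M c"

text \<open>An isometry that identifies functions equal almost everywhere. It need not be onto,
  since zero entries of \<open>e\<close> give zero coordinates, so the representation is moved to a
  subspace of \<open>l2\<close>.\<close>

definition W :: "('y \<Rightarrow> complex) \<Rightarrow> nat \<Rightarrow> complex" where "W f k = ip M f (e k)"

lemma e: "orthonormal_or_zero M e" by (rule gram_schmidt_orthonormal(1)[OF c])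

lemma e_L2: "e k \<in> L2 M" using e by (auto simp: orthonormal_or_zero_def)

lemma W_sums: assumes "f \<in> L2 M" shows "(\<lambda>k. (cmod (W f k))\<^sup>2) sums sqn M f"
  unfolding W_def
proof (rule Parseval[OF e assms])
  fix g assume g: "g \<in> L2 M" "\<And>k. ip M g (e k) = 0"
  show "AE x in M. g x = 0"
    by (rule total[OF g(1)]) (rule gram_schmidt_orthonormal(2)[OF c g])
qed

lemma W_l2: "f \<in> L2 M \<Longrightarrow> W f \<in> l2"
  using W_sums sums_summable unfolding l2_def by blast

lemma W_norm: "f \<in> L2 M \<Longrightarrow> l2_norm (W f) = sqrt (sqn M f)"
  unfolding l2_norm_def using W_sums[of f] sums_unique by metis

lemma W_add: "f \<in> L2 M \<Longrightarrow> g \<in> L2 M \<Longrightarrow> W (\<lambda>x. f x + g x) = (\<lambda>n. W f n + W g n)"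
  unfolding W_def by (simp add: ip_add_left e_L2)

lemma W_diff: "f \<in> L2 M \<Longrightarrow> g \<in> L2 M \<Longrightarrow> W (\<lambda>x. f x - g x) = (\<lambda>n. W f n - W g n)"
  unfolding W_def by (simp add: ip_diff_left e_L2)

lemma W_smult: "W (\<lambda>x. z * f x) = (\<lambda>n. z * W f n)"
  unfolding W_def by (simp add: ip_smult_left)

lemma W_cong: "f \<in> L2 M \<Longrightarrow> g \<in> L2 M \<Longrightarrow> AE x in M. f x = g x \<Longrightarrow> W f = W g"
  unfolding W_def using ip_cong_AE e_L2 by blast

lemma W_inj:
  assumes "f \<in> L2 M" "g \<in> L2 M" "W f = W g" shows "AE x in M. f x = g x"
proof -
  have "(\<lambda>k. (cmod (W (\<lambda>x. f x - g x) k))\<^sup>2) sums sqn M (\<lambda>x. f x - g x)"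
    by (intro W_sums L2_diff assms)
  then have "(\<lambda>k. 0) sums sqn M (\<lambda>x. f x - g x)" using assms by (simp add: W_diff)
  then have "sqn M (\<lambda>x. f x - g x) = 0" using sums_unique2 sums_zero by blast
  then show ?thesis using sqn_eq_0_iff[OF L2_diff[OF assms(1,2)]] by simp
qed

lemma V_diff: "f \<in> V \<Longrightarrow> g \<in> V \<Longrightarrow> (\<lambda>x. f x - g x) \<in> V"
  using V_add[of f "\<lambda>x. -1 * g x"] V_smult[of g "-1"] by simp

text \<open>Additivity and norm preservation force this: f - f' has norm 0, hence so has its
  image.\<close>

lemma U_cong:
  assumes g: "g \<in> carrier G" and f: "f \<in> V" "f' \<in> V" "AE x in M. f x = f' x"
  shows "AE x in M. U g f x = U g f' x"
proof -
  have d: "(\<lambda>x. f x - f' x) \<in> V" by (intro V_diff f)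
  have "sqn M (U g (\<lambda>x. f x - f' x)) = sqn M (\<lambda>x. f x - f' x)" by (rule U_sqn[OF g d])
  also have "\<dots> = 0" using f(3) V_L2 d by (subst sqn_eq_0_iff) auto
  finally have "AE x in M. U g (\<lambda>x. f x - f' x) x = 0"
    using sqn_eq_0_iff[of "U g (\<lambda>x. f x - f' x)" M] U_V[OF g d] V_L2 by blast
  then show ?thesis using U_add[OF g d f(2)] by eventually_elim simp
qed

definition H :: "(nat \<Rightarrow> complex) set" where "H = W ` V"

text \<open>An arbitrary preimage: two preimages agree almost everywhere because \<open>W\<close>
  preserves norms, and \<open>U_cong\<close> then makes the choice invisible in
  \<open>\<pi>\<close>.\<close>

definition R :: "(nat \<Rightarrow> complex) \<Rightarrow> 'y \<Rightarrow> complex" where "R u = (SOME f. f \<in> V \<and> W f = u)"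

definition \<pi> :: "'g \<Rightarrow> (nat \<Rightarrow> complex) \<Rightarrow> nat \<Rightarrow> complex" where "\<pi> g u = W (U g (R u))"

lemma \<pi>_W:
  assumes g: "g \<in> carrier G" and f: "f \<in> V" shows "\<pi> g (W f) = W (U g f)"
proof -
  have R: "R (W f) \<in> V \<and> W (R (W f)) = W f" unfolding R_def by (rule someI[of _ f]) (use f in simp)
  then have "AE x in M. R (W f) x = f x" using f V_L2 by (intro W_inj) auto
  then have "AE x in M. U g (R (W f)) x = U g f x" using R by (intro U_cong g f) auto
  then show ?thesis unfolding \<pi>_def using U_V[OF g] R f V_L2 by (intro W_cong) auto
qed

text \<open>A convergent sequence in \<open>H\<close> is Cauchy, its preimages are Cauchy because
  \<open>W\<close> is isometric, and completeness gives them a limit in V. This limit is mapped to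
  v, because coefficients converge one by one on both sides.\<close>

lemma H_closed: "closed_l2_subspace H"
  unfolding closed_l2_subspace_def
proof (intro conjI ballI allI impI)
  show "H \<subseteq> l2" using V_L2 W_l2 by (auto simp: H_def)
  have "(\<lambda>n. 0) = W (\<lambda>x. 0)" by (simp add: W_def[abs_def])
  then show "(\<lambda>n. 0) \<in> H" using V_zero unfolding H_def by (rule image_eqI)
  show "(\<lambda>n. u n + v n) \<in> H" if uv: "u \<in> H" "v \<in> H" for u v
  proof -
    obtain f f' where "f \<in> V" "f' \<in> V" "u = W f" "v = W f'" using uv by (auto simp: H_def)
    then have "(\<lambda>n. u n + v n) = W (\<lambda>x. f x + f' x)" "(\<lambda>x. f x + f' x) \<in> V"
      using V_L2 by (auto simp: W_add subset_iff V_add)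
    then show ?thesis unfolding H_def by (rule image_eqI)
  qed
  show "(\<lambda>n. z * u n) \<in> H" if u: "u \<in> H" for u z
  proof -
    obtain f where "f \<in> V" "u = W f" using u by (auto simp: H_def)
    then have "(\<lambda>n. z * u n) = W (\<lambda>x. z * f x)" "(\<lambda>x. z * f x) \<in> V"
      by (auto simp: W_smult V_smult)
    then show ?thesis unfolding H_def by (rule image_eqI)
  qed
  fix s :: "nat \<Rightarrow> nat \<Rightarrow> complex" and v
  assume "(\<forall>k. s k \<in> H) \<and> v \<in> l2 \<and> (\<lambda>k. l2_norm (\<lambda>n. s k n - v n)) \<longlonglongrightarrow> 0"
  then have sH: "\<And>k. s k \<in> H" and v: "v \<in> l2" and lim: "(\<lambda>k. l2_norm (\<lambda>n. s k n - v n)) \<longlonglongrightarrow> 0" by auto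
  have "\<forall>k. \<exists>f. f \<in> V \<and> s k = W f" using sH by (auto simp: H_def)
  then obtain f where fV: "\<And>k. f k \<in> V" and sW: "\<And>k. s k = W (f k)" by metis
  have fL: "f k \<in> L2 M" for k using fV V_L2 by auto
  have sl: "s k \<in> l2" for k using sW W_l2[OF fL] by simp
  define d where "d k = (l2_norm (\<lambda>n. s k n - v n))\<^sup>2" for k
  have dlim: "d \<longlonglongrightarrow> 0" unfolding d_def using tendsto_power[OF lim, of 2] by simp
  have fd: "sqn M (\<lambda>x. f m x - f n x) \<le> 2 * d m + 2 * d n" for m n
  proof -
    have "sqn M (\<lambda>x. f m x - f n x) = (l2_norm (W (\<lambda>x. f m x - f n x)))\<^sup>2"
      by (subst W_norm) (auto intro!: L2_diff fL)
    also have "W (\<lambda>x. f m x - f n x) = (\<lambda>i. (s m i - v i) - (s n i - v i))"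
      using W_diff[OF fL fL, of m n] by (simp add: sW)
    also have "(l2_norm \<dots>)\<^sup>2 \<le> 2 * d m + 2 * d n"
      unfolding d_def by (intro l2_diff sl v)
    finally show ?thesis .
  qed
  have "\<exists>g\<in>L2 M. (\<lambda>n. sqn M (\<lambda>x. f n x - g x)) \<longlonglongrightarrow> 0"
  proof (rule L2_complete[OF fL])
    fix r :: real assume "0 < r"
    then obtain N where N: "\<And>n. n \<ge> N \<Longrightarrow> norm (d n - 0) < r/4" using LIMSEQ_D[OF dlim, of "r/4"] by auto
    have "sqn M (\<lambda>x. f m x - f n x) < r" if "m \<ge> N" "n \<ge> N" for m n
      using fd[of m n] N[OF that(1)] N[OF that(2)] by (simp add: abs_less_iff)
    then show "\<exists>N. \<forall>m\<ge>N. \<forall>n\<ge>N. sqn M (\<lambda>x. f m x - f n x) < r" by blast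
  qed
  then obtain g where g: "g \<in> L2 M" and glim: "(\<lambda>n. sqn M (\<lambda>x. f n x - g x)) \<longlonglongrightarrow> 0" by blast
  have "W g n = v n" for n
  proof -
    have "(\<lambda>k. W (f k) n) \<longlonglongrightarrow> W g n" unfolding W_def by (rule ip_tendsto[OF fL g e_L2 glim])
    moreover have "(\<lambda>k. s k n) \<longlonglongrightarrow> v n"
    proof -
      have "norm (s k n - v n) \<le> sqrt (d k)" for k
        unfolding d_def using cmod_le_l2_norm[OF l2_diff(1)[OF sl[of k] v], of n] by (intro real_le_rsqrt) simp
      moreover have "(\<lambda>k. sqrt (d k)) \<longlonglongrightarrow> 0" using tendsto_real_sqrt[OF dlim] by simp
      ultimately have "(\<lambda>k. s k n - v n) \<longlonglongrightarrow> 0"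
        by (intro Lim_null_comparison[of "\<lambda>k. s k n - v n" "\<lambda>k. sqrt (d k)"] always_eventually) auto
      then show ?thesis by (rule LIM_zero_cancel)
    qed
    ultimately show ?thesis using LIMSEQ_unique by (simp add: sW) blast
  qed
  then have "W g = v" by auto
  moreover have "g \<in> V" by (rule V_closed[OF fV g glim])
  ultimately show "v \<in> H" by (auto simp: H_def)
qed

lemma \<pi>_unitary: "unitary_rep G H \<pi>"
  unfolding unitary_rep_def
proof (intro conjI ballI allI)
  interpret group G by (rule G)
  have VL: "f \<in> L2 M" if "f \<in> V" for f using that V_L2 by auto
  have mult: "\<pi> (g \<otimes> h) u = \<pi> g (\<pi> h u)" if g: "g \<in> carrier G" "h \<in> carrier G" and u: "u \<in> H" for g h u
  proof -
    obtain f where f: "f \<in> V" "u = W f" using u by (auto simp: H_def)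
    have "W (U (g \<otimes> h) f) = W (U g (U h f))"
      using U_mult[OF g f(1)] g f by (intro W_cong VL U_V) auto
    then show ?thesis using f g by (simp add: \<pi>_W U_V)
  qed
  have one: "\<pi> \<one> u = u" if u: "u \<in> H" for u
  proof -
    obtain f where f: "f \<in> V" "u = W f" using u by (auto simp: H_def)
    have "W (U \<one> f) = W f" using U_one[OF f(1)] f by (intro W_cong VL U_V) auto
    then show ?thesis using f by (simp add: \<pi>_W)
  qed
  have HH: "\<pi> g u \<in> H" if "g \<in> carrier G" "u \<in> H" for g u
    using that by (auto simp: H_def \<pi>_W U_V)
  show "\<pi> (g \<otimes> h) u = \<pi> g (\<pi> h u)" if "g \<in> carrier G" "h \<in> carrier G" "u \<in> H" for g h u
    using mult[OF that] .
  show "\<pi> \<one> u = u" if "u \<in> H" for u using one[OF that] .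
  fix g assume g: "g \<in> carrier G"
  show "bij_betw (\<pi> g) H H"
  proof (rule bij_betw_byWitness[where f'="\<pi> (inv g)"])
    show "\<forall>u\<in>H. \<pi> (inv g) (\<pi> g u) = u" using mult[of "inv g" g] one g by auto
    show "\<forall>u\<in>H. \<pi> g (\<pi> (inv g) u) = u" using mult[of g "inv g"] one g by auto
    show "\<pi> g ` H \<subseteq> H" "\<pi> (inv g) ` H \<subseteq> H" using HH g by auto
  qed
  show "\<pi> g (\<lambda>n. u n + v n) = (\<lambda>n. \<pi> g u n + \<pi> g v n)" if uv: "u \<in> H" "v \<in> H" for u v
  proof -
    obtain f f' where f: "f \<in> V" "f' \<in> V" "u = W f" "v = W f'" using uv by (auto simp: H_def)
    have "W (U g (\<lambda>x. f x + f' x)) = W (\<lambda>x. U g f x + U g f' x)"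
      using U_add[OF g f(1,2)] g f by (intro W_cong VL U_V V_add) auto
    moreover have "\<pi> g (\<lambda>n. u n + v n) = \<pi> g (W (\<lambda>x. f x + f' x))" using f by (simp add: W_add VL)
    ultimately have "\<pi> g (\<lambda>n. u n + v n) = W (\<lambda>x. U g f x + U g f' x)"
      using f g by (simp only: \<pi>_W V_add)
    then show ?thesis using f g by (simp add: \<pi>_W W_add VL U_V)
  qed
  show "\<pi> g (\<lambda>n. z * u n) = (\<lambda>n. z * \<pi> g u n)" if u: "u \<in> H" for z u
  proof -
    obtain f where f: "f \<in> V" "u = W f" using u by (auto simp: H_def)
    have "W (U g (\<lambda>x. z * f x)) = W (\<lambda>x. z * U g f x)"
      using U_smult[OF g f(1)] g f by (intro W_cong VL U_V V_smult) auto
    moreover have "\<pi> g (\<lambda>n. z * u n) = \<pi> g (W (\<lambda>x. z * f x))" using f by (simp add: W_smult)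
    ultimately have "\<pi> g (\<lambda>n. z * u n) = W (\<lambda>x. z * U g f x)"
      using f g by (simp only: \<pi>_W V_smult)
    then show ?thesis using f g by (simp add: \<pi>_W W_smult)
  qed
  show "l2_norm (\<pi> g u) = l2_norm u" if u: "u \<in> H" for u
  proof -
    obtain f where f: "f \<in> V" "u = W f" using u by (auto simp: H_def)
    then show ?thesis using g by (simp add: \<pi>_W W_norm VL U_V U_sqn)
  qed
qed

theorem kazhdan_invariant_vector:
  assumes T: "kazhdan_T G"
    and almost: "\<And>K \<epsilon>. finite K \<Longrightarrow> K \<subseteq> carrier G \<Longrightarrow> 0 < \<epsilon> \<Longrightarrow>
      \<exists>v\<in>V. sqn M v = 1 \<and> (\<forall>g\<in>K. sqn M (\<lambda>x. U g v x - v x) < \<epsilon>)"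
  shows "\<exists>v\<in>V. sqn M v \<noteq> 0 \<and> (\<forall>g\<in>carrier G. AE x in M. U g v x = v x)"
proof -
  have VL: "f \<in> L2 M" if "f \<in> V" for f using that V_L2 by auto
  have "has_almost_invariant_vectors G H \<pi>"
    unfolding has_almost_invariant_vectors_def
  proof (intro allI impI)
    fix K and \<epsilon> :: real assume K: "finite K \<and> K \<subseteq> carrier G \<and> 0 < \<epsilon>"
    \<comment> \<open>The hypothesis bounds squared norms, hence it is applied with
      \<epsilon>^2.\<close>
    then obtain v where v: "v \<in> V" "sqn M v = 1" "\<And>g. g \<in> K \<Longrightarrow> sqn M (\<lambda>x. U g v x - v x) < \<epsilon>\<^sup>2"
      using almost[of K "\<epsilon>\<^sup>2"] by auto
    have "l2_norm (\<lambda>n. \<pi> g (W v) n - W v n) < \<epsilon>" if g: "g \<in> K" for g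
    proof -
      have gc: "g \<in> carrier G" using K g by auto
      have "l2_norm (\<lambda>n. \<pi> g (W v) n - W v n) = sqrt (sqn M (\<lambda>x. U g v x - v x))"
        using v gc by (simp add: \<pi>_W W_diff[symmetric] VL U_V W_norm L2_diff)
      also have "\<dots> < sqrt (\<epsilon>\<^sup>2)" using v(3)[OF g] by (rule real_sqrt_less_mono)
      finally show ?thesis using K by simp
    qed
    then show "\<exists>v\<in>H. l2_norm v = 1 \<and> (\<forall>g\<in>K. l2_norm (\<lambda>n. \<pi> g v n - v n) < \<epsilon>)"
      using v by (intro bexI[of _ "W v"]) (auto simp: W_norm VL H_def)
  qed
  then have "has_nonzero_invariant_vector G H \<pi>"
    using T H_closed \<pi>_unitary unfolding kazhdan_T_def by blast
  then obtain v where v: "v \<in> V" "W v \<noteq> (\<lambda>n. 0)" "\<And>g. g \<in> carrier G \<Longrightarrow> \<pi> g (W v) = W v"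
    unfolding has_nonzero_invariant_vector_def H_def by blast
  have "sqn M v \<noteq> 0"
  proof
    assume "sqn M v = 0"
    then have "AE x in M. v x = 0" using sqn_eq_0_iff VL[OF v(1)] by blast
    then have "W v = W (\<lambda>x. 0)" by (intro W_cong VL v L2_zero)
    then show False using v(2) by (simp add: W_def[abs_def])
  qed
  moreover have "AE x in M. U g v x = v x" if "g \<in> carrier G" for g
    using v that by (intro W_inj VL U_V) (auto simp: \<pi>_W)
  ultimately show ?thesis using v(1) by blast
qed

end

section \<open>Half-density representations\<close>

text \<open>Finite intersections of a countable base form a countable generating family closed under
  intersection. The sets over which f integrates to 0 are closed under complements and disjoint
  unions, so they include every Borel set, and f vanishes almost everywhere.\<close>

lemma countable_total_family:
  fixes \<nu> :: "'x::second_countable_topology measure"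
  assumes \<nu>: "finite_measure \<nu>" and sets_\<nu>: "sets \<nu> = sets borel"
  obtains A :: "nat \<Rightarrow> 'x set" where "\<And>k. A k \<in> sets \<nu>"
    and "\<And>f::'x \<Rightarrow> complex. integrable \<nu> f \<Longrightarrow> (\<And>k. (LINT x:A k|\<nu>. f x) = 0) \<Longrightarrow> AE x in \<nu>. f x = 0"
proof -
  interpret finite_measure \<nu> by fact
  obtain B :: "'x set set" where B: "countable B" "topological_basis B"
    using ex_countable_basis by blast
  define C where "C = (\<lambda>F. \<Inter>F) ` {F. F \<subseteq> B \<and> finite F}"
  have cC: "countable C" unfolding C_def
    using countable_Collect_finite_subset[OF B(1)] by (intro countable_image) (simp add: conj_commute)
  \<comment> \<open>The intersection of the empty family; complements in the Dynkin argument rely on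
    the whole space being a test set.\<close>
  have UC: "UNIV \<in> C" unfolding C_def by (rule image_eqI[of _ _ "{}"]) auto
  have oB: "open X" if "X \<in> B" for X using B(2) that by (rule topological_basis_open)
  have oC: "open X" if "X \<in> C" for X
    using that oB unfolding C_def by (auto intro!: open_Inter)
  have BC: "B \<subseteq> C" unfolding C_def by (auto intro!: image_eqI[of _ _ "{_}"])
  have int: "Int_stable C"
  proof (rule Int_stableI)
    fix X Y assume "X \<in> C" "Y \<in> C"
    then obtain F F' where "X = \<Inter>F" "Y = \<Inter>F'" "F \<subseteq> B" "F' \<subseteq> B" "finite F" "finite F'" by (auto simp: C_def)
    then show "X \<inter> Y \<in> C" unfolding C_def by (intro image_eqI[of _ _ "F \<union> F'"]) auto
  qed
  have gen: "sets \<nu> = sigma_sets UNIV C"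
  proof
    have "sets \<nu> = sets (sigma UNIV B)"
      unfolding sets_\<nu> by (rule arg_cong[where f=sets, OF borel_eq_countable_basis[OF B]])
    also have "\<dots> = sigma_sets UNIV B" by (rule sets_measure_of) simp
    also have "\<dots> \<subseteq> sigma_sets UNIV C" by (rule sigma_sets_subseteq[OF BC])
    finally show "sets \<nu> \<subseteq> sigma_sets UNIV C" .
    have "C \<subseteq> sets \<nu>" using oC sets_\<nu> by auto
    then show "sigma_sets UNIV C \<subseteq> sets \<nu>"
      using sets.sigma_sets_subset[of C \<nu>] sets_eq_imp_space_eq[OF sets_\<nu>] by simp
  qed
  define A where "A = from_nat_into C"
  have AC: "A k \<in> C" for k unfolding A_def using UC by (intro from_nat_into) auto
  show thesis
  proof (rule that[of A])
    show "A k \<in> sets \<nu>" for k using oC[OF AC] sets_\<nu> by auto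
    fix f :: "'x \<Rightarrow> complex" assume f: "integrable \<nu> f" and z: "\<And>k. (LINT x:A k|\<nu>. f x) = 0"
    have zC: "(LINT x:X|\<nu>. f x) = 0" if "X \<in> C" for X
      using z[of "to_nat_on C X"] that cC by (simp add: A_def)
    have si: "set_integrable \<nu> X f" if "X \<in> sets \<nu>" for X
      unfolding set_integrable_def using f that by (intro integrable_mult_indicator)
    have spU: "space \<nu> = UNIV" using sets_eq_imp_space_eq[OF sets_\<nu>] by simp
    have CP: "C \<subseteq> Pow UNIV" by simp
    have "(LINT x:X|\<nu>. f x) = 0" if "X \<in> sigma_sets UNIV C" for X
      using int CP that
    proof (induction rule: sigma_sets_induct_disjoint)
      case (basic X) then show ?case by (rule zC)
    next
      case empty then show ?case by (simp add: set_lebesgue_integral_def)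
    next
      case (compl X)
      then have [measurable]: "X \<in> sets \<nu>" by (simp add: gen)
      have "UNIV - X \<in> sets \<nu>" using sets.compl_sets[of X \<nu>] spU by simp
      then have "(LINT x:X \<union> (UNIV - X)|\<nu>. f x) = (LINT x:X|\<nu>. f x) + (LINT x:UNIV - X|\<nu>. f x)"
        by (intro set_integral_Un si) auto
      then show ?case using zC[OF UC] compl by simp
    next
      case (union X)
      then have m: "X i \<in> sets \<nu>" for i by (auto simp: gen)
      have "(LINT x:(\<Union>i. X i)|\<nu>. f x) = (\<Sum>i. (LINT x:X i|\<nu>. f x))"
        using union(1) m by (intro lebesgue_integral_countable_add si) (auto simp: disjoint_family_on_def)
      then show ?case using union by simp
    qed
    then show "AE x in \<nu>. f x = 0"
      using density_unique_banach[OF f, of "\<lambda>x. 0"] by (simp add: gen set_lebesgue_integral_def)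
  qed
qed

text \<open>The square root makes this isometric on L2 without invariance of \<nu>: its square is
  the density in the change of variables.\<close>

definition half_density :: "'x measure \<Rightarrow> ('x \<Rightarrow> 'x) \<Rightarrow> ('x \<Rightarrow> complex) \<Rightarrow> 'x \<Rightarrow> complex" where
  "half_density \<nu> T f x = complex_of_real (sqrt (RN_jacobian \<nu> T x)) * f (aut_inv \<nu> T x)"

lemma half_density_measurable:
  assumes "nonsingular_aut \<nu> T" "f \<in> borel_measurable \<nu>"
  shows "half_density \<nu> T f \<in> borel_measurable \<nu>"
proof -
  note [measurable] = aut_inv_measurable[OF assms(1)] assms(2)
  show ?thesis unfolding half_density_def[abs_def] by measurable
qed

context prob_space
begin

lemma half_density_isometry:
  assumes T: "nonsingular_aut M T" and [measurable]: "f \<in> borel_measurable M"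
  shows "(\<integral>\<^sup>+x. ennreal ((cmod (half_density M T f x))\<^sup>2) \<partial>M) = (\<integral>\<^sup>+x. ennreal ((cmod (f x))\<^sup>2) \<partial>M)"
proof -
  have "(\<integral>\<^sup>+x. ennreal ((cmod (half_density M T f x))\<^sup>2) \<partial>M) =
    (\<integral>\<^sup>+x. ennreal (RN_jacobian M T x) * (ennreal ((cmod (f (aut_inv M T x)))\<^sup>2) * 1) \<partial>M)"
    by (intro nn_integral_cong) (simp add: half_density_def norm_mult power_mult_distrib ennreal_mult)
  also have "\<dots> = (\<integral>\<^sup>+x. ennreal ((cmod (f x))\<^sup>2) * 1 \<partial>M)"
    by (rule nn_integral_jacobian_aut_inv[OF T]) auto
  finally show ?thesis by simp
qed

text \<open>The inverse of a product reverses the factors, and densities obey a chain rule: the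
  Jacobian of gh is that of g times that of h composed with the inverse of g. Both hold almost
  everywhere and come from \<open>aut_inv_unique\<close> and \<open>jacobian_unique\<close>.\<close>

lemma half_density_mult:
  fixes G (structure)
  assumes G: "group G" and a: "a \<in> nonsingular_actions G M" and gh: "g \<in> carrier G" "h \<in> carrier G"
  shows "AE x in M. half_density M (a (g \<otimes> h)) f x = half_density M (a g) (half_density M (a h) f) x"
proof -
  interpret group G by fact
  note aut = nonsingular_actions_aut[OF a]
  note g = aut[OF gh(1)] and h = aut[OF gh(2)] and gh' = aut[OF m_closed[OF gh]]
  note [measurable] = g[THEN nonsingular_aut_measurable] h[THEN nonsingular_aut_measurable]
    gh'[THEN nonsingular_aut_measurable] g[THEN aut_inv_measurable] h[THEN aut_inv_measurable]
  note m = nonsingular_actions_mult[OF a gh]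
  have "AE x in M. aut_inv M (a h) (aut_inv M (a g) (a (g \<otimes> h) x)) = x"
    using m AE_nonsingular[OF h aut_inv_left[OF g]] aut_inv_left[OF h] by eventually_elim simp
  then have S: "AE x in M. aut_inv M (a (g \<otimes> h)) x = aut_inv M (a h) (aut_inv M (a g) x)"
    by (rule aut_inv_unique[OF gh'])
  have J: "AE x in M. RN_jacobian M (a (g \<otimes> h)) x = RN_jacobian M (a g) x * RN_jacobian M (a h) (aut_inv M (a g) x)"
  proof (rule jacobian_unique[OF gh'])
    fix B assume [measurable]: "B \<in> sets M"
    have "(\<integral>\<^sup>+x. ennreal (RN_jacobian M (a g) x * RN_jacobian M (a h) (aut_inv M (a g) x)) * indicator B x \<partial>M) =
      (\<integral>\<^sup>+x. ennreal (RN_jacobian M (a g) x) * (ennreal (RN_jacobian M (a h) (aut_inv M (a g) x)) * indicator B x) \<partial>M)"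
      by (intro nn_integral_cong) (simp add: ennreal_mult mult.assoc)
    also have "\<dots> = (\<integral>\<^sup>+x. ennreal (RN_jacobian M (a h) x) * indicator B (a g x) \<partial>M)"
      by (rule nn_integral_jacobian_aut_inv[OF g]) auto
    also have "\<dots> = (\<integral>\<^sup>+x. indicator B (a g (a h x)) \<partial>M)"
      by (rule nn_integral_jacobian[OF h]) auto
    also have "\<dots> = (\<integral>\<^sup>+x. indicator B (a (g \<otimes> h) x) \<partial>M)"
      by (intro nn_integral_cong_AE) (use m in auto)
    finally show "(\<integral>\<^sup>+x. ennreal (RN_jacobian M (a g) x * RN_jacobian M (a h) (aut_inv M (a g) x)) * indicator B x \<partial>M) =
      (\<integral>\<^sup>+x. indicator B (a (g \<otimes> h) x) \<partial>M)" .
  qed auto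
  show ?thesis using S J by eventually_elim (simp add: half_density_def real_sqrt_mult)
qed

lemma half_density_one:
  fixes G (structure)
  assumes G: "group G" and a: "a \<in> nonsingular_actions G M"
  shows "AE x in M. half_density M (a \<one>) f x = f x"
proof -
  interpret group G by fact
  note aut = nonsingular_actions_aut[OF a one_closed]
  have S: "AE x in M. aut_inv M (a \<one>) x = x"
    by (rule aut_inv_unique[OF aut]) (rule nonsingular_actions_one[OF a])
  have J: "AE x in M. RN_jacobian M (a \<one>) x = 1"
  proof (rule jacobian_unique[OF aut])
    fix B
    show "(\<integral>\<^sup>+x. ennreal 1 * indicator B x \<partial>M) = (\<integral>\<^sup>+x. indicator B (a \<one> x) \<partial>M)"
      using nonsingular_actions_one[OF a] by (intro nn_integral_cong_AE) auto
  qed auto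
  show ?thesis using S J by eventually_elim (simp add: half_density_def)
qed

lemma half_density_indicator:
  "half_density M T (\<lambda>x. complex_of_real (indicator A x)) x = complex_of_real (sqrt (U1_ind M T A x))"
  by (simp add: half_density_def U1_ind_eq indicator_def)

text \<open>An indicator is its own square root, so (sqrt p - sqrt q)^2 \<le> |p - q| applies
  pointwise with p = \<open>U1_ind M T A x\<close> and q the indicator.\<close>

lemma half_density_indicator_displacement:
  assumes T: "nonsingular_aut M T" and [measurable]: "A \<in> sets M"
  shows "(\<integral>\<^sup>+x. ennreal ((cmod (half_density M T (\<lambda>x. complex_of_real (indicator A x)) x - complex_of_real (indicator A x)))\<^sup>2) \<partial>M)
    \<le> (\<integral>\<^sup>+x. ennreal \<bar>U1_ind M T A x - indicator A x\<bar> \<partial>M)"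
proof (rule nn_integral_mono, rule ennreal_leI)
  fix x
  have sq: "(sqrt p - sqrt q)\<^sup>2 \<le> \<bar>p - q\<bar>" if "0 \<le> p" "0 \<le> q" for p q :: real
  proof -
    have "(sqrt p - sqrt q)\<^sup>2 = \<bar>sqrt p - sqrt q\<bar> * \<bar>sqrt p - sqrt q\<bar>" by (simp add: power2_eq_square)
    also have "\<dots> \<le> \<bar>sqrt p - sqrt q\<bar> * \<bar>sqrt p + sqrt q\<bar>"
      using that by (intro mult_left_mono) (auto simp: abs_le_iff)
    also have "\<dots> = \<bar>(sqrt p - sqrt q) * (sqrt p + sqrt q)\<bar>" by (simp only: abs_mult)
    also have "(sqrt p - sqrt q) * (sqrt p + sqrt q) = p - q" using that by (simp add: algebra_simps)
    finally show ?thesis .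
  qed
  have "indicator A x = sqrt (indicator A x)" by (simp add: indicator_def)
  then have "(sqrt (U1_ind M T A x) - indicator A x)\<^sup>2 \<le> \<bar>U1_ind M T A x - indicator A x\<bar>"
    using sq[of "U1_ind M T A x" "indicator A x"] by simp
  then show "(cmod (half_density M T (\<lambda>x. complex_of_real (indicator A x)) x - complex_of_real (indicator A x)))\<^sup>2
      \<le> \<bar>U1_ind M T A x - indicator A x\<bar>"
    unfolding half_density_indicator of_real_diff[symmetric] norm_of_real by simp
qed

end

section \<open>Countable Hilbert sums, realised as square integrable functions on N x X\<close>

abbreviation nat_copies :: "'x measure \<Rightarrow> (nat \<times> 'x) measure" where
  "nat_copies \<nu> \<equiv> count_space UNIV \<Otimes>\<^sub>M \<nu>"

context prob_space
begin

lemma nat_copies_pair: "pair_sigma_finite (count_space (UNIV::nat set)) M"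
  by (simp add: pair_sigma_finite_def sigma_finite_measure_axioms sigma_finite_measure_count_space)

lemma nat_copies_measurable_slice:
  "f \<in> measurable (nat_copies M) N \<Longrightarrow> (\<lambda>x. f (n, x)) \<in> measurable M N"
  by (rule measurable_compose[of "Pair n" M "nat_copies M"]) auto

lemma nat_copies_measurableI:
  "(\<And>n. (\<lambda>x. f (n, x)) \<in> measurable M N) \<Longrightarrow> f \<in> measurable (nat_copies M) N"
  by (rule measurable_pair_measure_countable1) auto

lemma nn_integral_nat_copies:
  "f \<in> borel_measurable (nat_copies M) \<Longrightarrow>
    (\<integral>\<^sup>+z. f z \<partial>nat_copies M) = (\<Sum>n. \<integral>\<^sup>+x. f (n, x) \<partial>M)"
  by (subst nn_integral_fst[symmetric]) (auto simp: nn_integral_count_space_nat)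

lemma AE_nat_copies_slice: "AE z in nat_copies M. P z \<Longrightarrow> AE x in M. P (n, x)"
  using pair_sigma_finite.AE_pair[OF nat_copies_pair, of P] by (auto simp: AE_count_space)

lemma AE_nat_copies_eqI:
  fixes f g :: "nat \<times> 'a \<Rightarrow> complex"
  assumes [measurable]: "f \<in> borel_measurable (nat_copies M)" "g \<in> borel_measurable (nat_copies M)"
    and "\<And>n. AE x in M. f (n, x) = g (n, x)"
  shows "AE z in nat_copies M. f z = g z"
  by (rule pair_sigma_finite.AE_pair_measure[OF nat_copies_pair]) (use assms(3) in \<open>auto simp: AE_count_space\<close>)

lemma integral_nat_copies_single:
  fixes f :: "nat \<times> 'a \<Rightarrow> complex"
  assumes "integrable (nat_copies M) f" and z: "\<And>m x. m \<noteq> n \<Longrightarrow> f (m, x) = 0"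
  shows "(\<integral>z. f z \<partial>nat_copies M) = (\<integral>x. f (n, x) \<partial>M)"
proof -
  let ?I = "\<lambda>m. \<integral>x. f (m, x) \<partial>M"
  have "?I m = 0" if "m \<noteq> n" for m using z[OF that] by simp
  then have "{m \<in> UNIV. ?I m \<noteq> 0} \<subseteq> {n}" by blast
  then have fin: "finite {m \<in> UNIV. ?I m \<noteq> 0}" using finite_subset by blast
  have "(\<integral>z. f z \<partial>nat_copies M) = (\<integral>m. ?I m \<partial>count_space UNIV)"
    by (rule pair_sigma_finite.integral_fst'[OF nat_copies_pair assms(1), symmetric])
  also have "\<dots> = (\<Sum>m | m \<in> UNIV \<and> ?I m \<noteq> 0. ?I m)"
    by (rule lebesgue_integral_count_space_finite_support[OF fin])
  also have "\<dots> = (\<Sum>m\<in>{n}. ?I m)"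
    by (rule sum.mono_neutral_left) (use \<open>_ \<subseteq> {n}\<close> in auto)
  finally show ?thesis by simp
qed

lemma L2_slice:
  assumes f: "f \<in> L2 (nat_copies M)" shows "(\<lambda>x. f (n, x)) \<in> L2 M"
proof -
  have [measurable]: "f \<in> borel_measurable (nat_copies M)" using f by (rule L2_measurable)
  have "(\<integral>\<^sup>+x. ennreal ((cmod (f (n, x)))\<^sup>2) \<partial>M) \<le> (\<Sum>n. \<integral>\<^sup>+x. ennreal ((cmod (f (n, x)))\<^sup>2) \<partial>M)"
    by (rule order_trans[OF _ sum_le_suminf[of _ "{n}"]]) auto
  also have "\<dots> = (\<integral>\<^sup>+z. ennreal ((cmod (f z))\<^sup>2) \<partial>nat_copies M)"
    by (rule nn_integral_nat_copies[symmetric]) measurable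
  also have "\<dots> = ennreal (sqn (nat_copies M) f)" by (rule nn_integral_sqn[OF f])
  finally show ?thesis
    by (intro L2I_nn(1)[OF nat_copies_measurable_slice[OF L2_measurable[OF f]]]) auto
qed

lemma L2_prob_integrable: assumes f: "f \<in> L2 M" shows "integrable M f"
proof (rule Bochner_Integration.integrable_bound[where f="\<lambda>x. 1 + (cmod (f x))\<^sup>2"])
  show "AE x in M. cmod (f x) \<le> norm (1 + (cmod (f x))\<^sup>2)"
  proof (rule AE_I2)
    fix x
    show "cmod (f x) \<le> norm (1 + (cmod (f x))\<^sup>2)"
      using sum_squares_bound[of "cmod (f x)" 1] by (simp add: abs_if)
  qed
qed (use f in \<open>auto simp: L2_def\<close>)

text \<open>Products of a single index with a set \<open>A j\<close>, enumerated by
  \<open>prod_decode\<close>, test each slice separately. Slices are integrable because the measure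
  is finite, so the total family on X applies to them.\<close>

lemma L2_nat_copies_total:
  assumes A: "\<And>k. A k \<in> sets M"
    and total: "\<And>f::'a \<Rightarrow> complex. integrable M f \<Longrightarrow> (\<And>k. (LINT x:A k|M. f x) = 0) \<Longrightarrow> AE x in M. f x = 0"
  defines "c \<equiv> \<lambda>k z. complex_of_real (indicator ({fst (prod_decode k)} \<times> A (snd (prod_decode k))) z)"
  shows "c k \<in> L2 (nat_copies M)"
    and "f \<in> L2 (nat_copies M) \<Longrightarrow> (\<And>k. ip (nat_copies M) f (c k) = 0) \<Longrightarrow> AE z in nat_copies M. f z = 0"
proof -
  have [measurable]: "c k \<in> borel_measurable (nat_copies M)" for k
    unfolding c_def using A by measurable
  have "(\<integral>\<^sup>+z. ennreal ((cmod (c k z))\<^sup>2) \<partial>nat_copies M) = (\<integral>\<^sup>+z. indicator ({fst (prod_decode k)} \<times> A (snd (prod_decode k))) z \<partial>nat_copies M)" for k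
    by (intro nn_integral_cong) (auto simp: c_def indicator_def)
  also have "\<dots> k = emeasure (nat_copies M) ({fst (prod_decode k)} \<times> A (snd (prod_decode k)))" for k
    using A by (intro nn_integral_indicator) auto
  also have "\<dots> k \<le> ennreal 1" for k
    using A by (subst emeasure_pair_measure_Times) (auto simp: emeasure_le_1)
  finally show cL: "c k \<in> L2 (nat_copies M)" for k
    by (intro L2I_nn(1)[where c=1]) auto
  assume f: "f \<in> L2 (nat_copies M)" and z: "\<And>k. ip (nat_copies M) f (c k) = 0"
  have "AE x in M. f (n, x) = 0" for n
  proof (rule total)
    show "integrable M (\<lambda>x. f (n, x))" by (rule L2_prob_integrable[OF L2_slice[OF f]])
    fix j
    let ?k = "prod_encode (n, j)"
    have "0 = (\<integral>z. f z * cnj (c ?k z) \<partial>nat_copies M)" using z[of ?k] by (simp add: ip_def)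
    also have "\<dots> = (\<integral>x. f (n, x) * cnj (c ?k (n, x)) \<partial>M)"
      by (rule integral_nat_copies_single[OF L2_ip_integrable[OF f cL]]) (simp add: c_def)
    also have "\<dots> = (LINT x:A j|M. f (n, x))"
      unfolding set_lebesgue_integral_def
      by (intro Bochner_Integration.integral_cong) (auto simp: c_def indicator_def)
    finally show "(LINT x:A j|M. f (n, x)) = 0" by simp
  qed
  then show "AE z in nat_copies M. f z = 0"
    using L2_measurable[OF f] by (intro AE_nat_copies_eqI) auto
qed

end

definition half_density_sum ::
  "'x measure \<Rightarrow> (nat \<Rightarrow> 'g \<Rightarrow> 'x \<Rightarrow> 'x) \<Rightarrow> 'g \<Rightarrow> (nat \<times> 'x \<Rightarrow> complex) \<Rightarrow> nat \<times> 'x \<Rightarrow> complex" where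
  "half_density_sum \<nu> b g f z = half_density \<nu> (b (fst z) g) (\<lambda>x. f (fst z, x)) (snd z)"

text \<open>Polarisation: squared norms of differences determine the real part of the inner product,
  and replacing f by i times f gives the imaginary part.\<close>

lemma isometry_preserves_ip:
  assumes UL: "\<And>f. f \<in> L2 M \<Longrightarrow> U f \<in> L2 M"
    and diff: "\<And>f h. U (\<lambda>x. f x - h x) = (\<lambda>x. U f x - U h x)"
    and smult: "\<And>f z. U (\<lambda>x. z * f x) = (\<lambda>x. z * U f x)"
    and sqn: "\<And>f. f \<in> L2 M \<Longrightarrow> sqn M (U f) = sqn M f"
    and fh: "f \<in> L2 M" "h \<in> L2 M"
  shows "ip M (U f) (U h) = ip M f h"
proof -
  have Re: "Re (ip M (U f) (U h)) = Re (ip M f h)" if f: "f \<in> L2 M" for f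
    using sqn_diff[OF f fh(2)] sqn_diff[OF UL[OF f] UL[OF fh(2)]] sqn[OF L2_diff[OF f fh(2)]]
    by (simp add: diff sqn f fh)
  have "Re (ip M (U (\<lambda>x. \<i> * f x)) (U h)) = Re (ip M (\<lambda>x. \<i> * f x) h)"
    by (intro Re L2_smult fh)
  then have "Im (ip M (U f) (U h)) = Im (ip M f h)"
    by (simp add: smult ip_smult_left)
  with Re[OF fh(1)] show ?thesis by (simp add: complex_eq_iff)
qed

lemma half_density_sum_diff:
  "half_density_sum \<nu> b g (\<lambda>z. f z - h z) = (\<lambda>z. half_density_sum \<nu> b g f z - half_density_sum \<nu> b g h z)"
  by (simp add: half_density_sum_def half_density_def fun_eq_iff algebra_simps)

lemma half_density_sum_add:
  "half_density_sum \<nu> b g (\<lambda>z. f z + h z) = (\<lambda>z. half_density_sum \<nu> b g f z + half_density_sum \<nu> b g h z)"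
  by (simp add: half_density_sum_def half_density_def fun_eq_iff algebra_simps)

lemma half_density_sum_smult:
  "half_density_sum \<nu> b g (\<lambda>z. c * f z) = (\<lambda>z. c * half_density_sum \<nu> b g f z)"
  by (simp add: half_density_sum_def half_density_def fun_eq_iff)

lemma half_density_sum_slice:
  "half_density_sum \<nu> b g f (n, x) = half_density \<nu> (b n g) (\<lambda>x. f (n, x)) x"
  by (simp add: half_density_sum_def)

context prob_space
begin

lemma half_density_sum_measurable:
  assumes "\<And>n. nonsingular_aut M (b n g)" "f \<in> borel_measurable (nat_copies M)"
  shows "half_density_sum M b g f \<in> borel_measurable (nat_copies M)"
  by (rule nat_copies_measurableI)
     (simp add: half_density_sum_slice half_density_measurable[OF assms(1) nat_copies_measurable_slice[OF assms(2)]])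

lemma half_density_sum_L2:
  assumes b: "\<And>n. nonsingular_aut M (b n g)" and f: "f \<in> L2 (nat_copies M)"
  shows "half_density_sum M b g f \<in> L2 (nat_copies M)"
    and "sqn (nat_copies M) (half_density_sum M b g f) = sqn (nat_copies M) f"
proof -
  note [measurable] = L2_measurable[OF f] half_density_sum_measurable[where b=b and g=g, OF b L2_measurable[OF f]]
  have "(\<integral>\<^sup>+z. ennreal ((cmod (half_density_sum M b g f z))\<^sup>2) \<partial>nat_copies M) =
    (\<Sum>n. \<integral>\<^sup>+x. ennreal ((cmod (half_density M (b n g) (\<lambda>x. f (n, x)) x))\<^sup>2) \<partial>M)"
    by (subst nn_integral_nat_copies) (auto simp: half_density_sum_slice)
  also have "\<dots> = (\<Sum>n. \<integral>\<^sup>+x. ennreal ((cmod (f (n, x)))\<^sup>2) \<partial>M)"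
    by (subst half_density_isometry[OF b nat_copies_measurable_slice[OF L2_measurable[OF f]]]) simp
  also have "\<dots> = (\<integral>\<^sup>+z. ennreal ((cmod (f z))\<^sup>2) \<partial>nat_copies M)"
    by (subst nn_integral_nat_copies) auto
  also have "\<dots> = ennreal (sqn (nat_copies M) f)" by (rule nn_integral_sqn[OF f])
  finally have eq: "(\<integral>\<^sup>+z. ennreal ((cmod (half_density_sum M b g f z))\<^sup>2) \<partial>nat_copies M) = ennreal (sqn (nat_copies M) f)" .
  show L: "half_density_sum M b g f \<in> L2 (nat_copies M)"
    by (rule L2I_nn(1)[where c="sqn (nat_copies M) f"]) (auto simp: eq)
  show "sqn (nat_copies M) (half_density_sum M b g f) = sqn (nat_copies M) f"
    using eq unfolding nn_integral_sqn[OF L] by simp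
qed

text \<open>Property (T) is applied on the orthogonal complement of the invariant vectors, which contains no
  nonzero invariant vector.\<close>

lemma half_density_sum_spectral_gap:
  fixes G :: "('g, 'b) monoid_scheme" (structure) and b :: "nat \<Rightarrow> 'g \<Rightarrow> 'a \<Rightarrow> 'a"
  assumes G: "group G" and T: "kazhdan_T G" and b: "\<And>n. b n \<in> nonsingular_actions G M"
    and A: "\<And>k::nat. A k \<in> sets M"
    and total: "\<And>f::'a \<Rightarrow> complex. integrable M f \<Longrightarrow> (\<And>k. (LINT x:A k|M. f x) = 0) \<Longrightarrow> AE x in M. f x = 0"
    and vL: "\<And>n. v n \<in> L2 (nat_copies M)" and v1: "\<And>n. sqn (nat_copies M) (v n) = 1"
    and orth: "\<And>n w. w \<in> L2 (nat_copies M) \<Longrightarrow>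
      (\<And>g. g \<in> carrier G \<Longrightarrow> AE z in nat_copies M. half_density_sum M b g w z = w z) \<Longrightarrow> ip (nat_copies M) (v n) w = 0"
    and almost: "\<And>g. g \<in> carrier G \<Longrightarrow>
      (\<lambda>n. sqn (nat_copies M) (\<lambda>z. half_density_sum M b g (v n) z - v n z)) \<longlonglongrightarrow> 0"
  shows False
proof -
  interpret group G by fact
  let ?N = "nat_copies M" and ?U = "half_density_sum M b"
  have aut: "nonsingular_aut M (b n g)" if "g \<in> carrier G" for n g
    using nonsingular_actions_aut[OF b that] .
  define Inv where "Inv = {w \<in> L2 ?N. \<forall>g\<in>carrier G. AE z in ?N. ?U g w z = w z}"
  define V where "V = {f \<in> L2 ?N. \<forall>w\<in>Inv. ip ?N f w = 0}"
  have vV: "v n \<in> V" for n using orth[of _ n] vL by (auto simp: V_def Inv_def)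
  have UL: "?U g f \<in> L2 ?N" if "g \<in> carrier G" "f \<in> L2 ?N" for g f
    using half_density_sum_L2(1)[where b=b and g=g, OF aut[OF that(1)] that(2)] .
  have Usqn: "sqn ?N (?U g f) = sqn ?N f" if "g \<in> carrier G" "f \<in> L2 ?N" for g f
    using half_density_sum_L2(2)[where b=b and g=g, OF aut[OF that(1)] that(2)] .
  have AE_eq: "AE z in ?N. f z = h z" if "f \<in> L2 ?N" "h \<in> L2 ?N" "\<And>n. AE x in M. f (n, x) = h (n, x)" for f h
    by (rule AE_nat_copies_eqI[OF L2_measurable[OF that(1)] L2_measurable[OF that(2)] that(3)])
  let ?c = "\<lambda>k z. complex_of_real (indicator ({fst (prod_decode k)} \<times> A (snd (prod_decode k))) z)"
  interpret R: L2_representation G ?N V ?U ?c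
  proof
    show "?c k \<in> L2 ?N" for k by (rule L2_nat_copies_total(1)[OF A total])
    show "AE z in ?N. f z = 0" if "f \<in> L2 ?N" "\<And>k. ip ?N f (?c k) = 0" for f
      by (rule L2_nat_copies_total(2)[OF A total that])
    show "V \<subseteq> L2 ?N" "(\<lambda>z. 0) \<in> V" by (auto simp: V_def L2_zero)
    show "(\<lambda>z. f z + h z) \<in> V" if "f \<in> V" "h \<in> V" for f h
      using that by (auto simp: V_def L2_add ip_add_left Inv_def)
    show "(\<lambda>z. c * f z) \<in> V" if "f \<in> V" for c f
      using that by (auto simp: V_def L2_smult ip_smult_left)
    show "f \<in> V" if "\<And>k. s k \<in> V" "f \<in> L2 ?N" "(\<lambda>k. sqn ?N (\<lambda>z. s k z - f z)) \<longlonglongrightarrow> 0" for s f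
    proof -
      have "ip ?N f w = 0" if w: "w \<in> Inv" for w
      proof -
        have "(\<lambda>k. ip ?N (s k) w) \<longlonglongrightarrow> ip ?N f w"
          using that \<open>\<And>k. s k \<in> V\<close> \<open>f \<in> L2 ?N\<close> \<open>_ \<longlonglongrightarrow> 0\<close> by (intro ip_tendsto) (auto simp: V_def Inv_def)
        moreover have "ip ?N (s k) w = 0" for k using \<open>\<And>k. s k \<in> V\<close> w by (auto simp: V_def)
        ultimately show ?thesis by (simp add: LIMSEQ_const_iff)
      qed
      then show ?thesis using that by (simp add: V_def)
    qed
    fix g assume g: "g \<in> carrier G"
    show "?U g f \<in> V" if f: "f \<in> V" for f
    proof -
      have fL: "f \<in> L2 ?N" using f by (simp add: V_def)
      have "ip ?N (?U g f) w = 0" if w: "w \<in> Inv" for w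
      proof -
        have wL: "w \<in> L2 ?N" and wi: "AE z in ?N. ?U g w z = w z" using w g by (auto simp: Inv_def)
        \<comment> \<open>An invariant w may be replaced by its image, and the operator preserves
          inner products; so the complement of the invariant vectors is mapped into itself.\<close>
        have "ip ?N w (?U g f) = ip ?N (?U g w) (?U g f)"
          using wi by (intro ip_cong_AE wL UL g fL) auto
        also have "\<dots> = ip ?N w f"
          by (rule isometry_preserves_ip[OF UL[OF g] half_density_sum_diff half_density_sum_smult Usqn[OF g] wL fL])
        also have "\<dots> = 0" using f w ip_commute[of ?N w f] by (simp add: V_def)
        finally show ?thesis using ip_commute[of ?N "?U g f" w] by simp
      qed
      then show ?thesis using UL[OF g fL] by (simp add: V_def)
    qed
    show "AE z in ?N. ?U g (\<lambda>z. f z + h z) z = ?U g f z + ?U g h z" for f h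
      by (simp add: half_density_sum_add)
    show "AE z in ?N. ?U g (\<lambda>z. c * f z) z = c * ?U g f z" for f c
      by (simp add: half_density_sum_smult)
    show "sqn ?N (?U g f) = sqn ?N f" if "f \<in> V" for f
      using Usqn[OF g] that by (simp add: V_def)
    show "AE z in ?N. ?U (g \<otimes> h) f z = ?U g (?U h f) z" if h: "h \<in> carrier G" and f: "f \<in> V" for h f
    proof (rule AE_eq)
      show "AE x in M. ?U (g \<otimes> h) f (n, x) = ?U g (?U h f) (n, x)" for n
        unfolding half_density_sum_slice by (rule half_density_mult[OF G b g h])
    qed (use UL g h f in \<open>auto simp: V_def\<close>)
  next
    show "AE z in ?N. ?U \<one> f z = f z" if f: "f \<in> V" for f
    proof (rule AE_eq)
      show "AE x in M. ?U \<one> f (n, x) = f (n, x)" for n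
        unfolding half_density_sum_slice by (rule half_density_one[OF G b])
    qed (use UL f in \<open>auto simp: V_def\<close>)
  qed
  have "\<exists>w\<in>V. sqn ?N w \<noteq> 0 \<and> (\<forall>g\<in>carrier G. AE z in ?N. ?U g w z = w z)"
  proof (rule R.kazhdan_invariant_vector[OF T])
    fix K and \<epsilon> :: real assume K: "finite K" "K \<subseteq> carrier G" "0 < \<epsilon>"
    \<comment> \<open>Only finitely many group elements are tested, so one late index n serves them
      all.\<close>
    have "\<forall>\<^sub>F n in sequentially. \<forall>g\<in>K. sqn ?N (\<lambda>z. ?U g (v n) z - v n z) < \<epsilon>"
      using K almost by (intro eventually_ball_finite ballI order_tendstoD(2)[where y=0]) auto
    then obtain n where "\<forall>g\<in>K. sqn ?N (\<lambda>z. ?U g (v n) z - v n z) < \<epsilon>"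
      by (auto simp: eventually_sequentially)
    then show "\<exists>v\<in>V. sqn ?N v = 1 \<and> (\<forall>g\<in>K. sqn ?N (\<lambda>z. ?U g v z - v z) < \<epsilon>)"
      using vV v1 by blast
  qed
  then obtain w where w: "w \<in> V" "sqn ?N w \<noteq> 0" "\<forall>g\<in>carrier G. AE z in ?N. ?U g w z = w z" by blast
  then have "w \<in> Inv" by (simp add: V_def Inv_def)
  then have "ip ?N w w = 0" using w(1) by (simp add: V_def)
  then show False using w(2) by (simp add: ip_self)
qed

end

section \<open>Ergodic stationary actions do not approach a partially trivial action\<close>

lemma tendsto_zero_ennreal_bound:
  fixes f h :: "nat \<Rightarrow> ennreal"
  assumes "\<forall>\<^sub>F n in sequentially. f n \<le> h n" "h \<longlonglongrightarrow> 0" shows "f \<longlonglongrightarrow> 0"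
  by (rule tendsto_sandwich[OF _ assms(1) tendsto_const assms(2)]) simp

text \<open>The vector 1_A - 1_B, normalised and placed in the n-th copy, is moved less and less as
  n grows, by \<open>limA\<close> and \<open>limB\<close>. The n-th slice of an invariant vector is
  constant because \<open>b n\<close> is ergodic and stationary, so equal masses of A and B give the
  orthogonality that the spectral gap demands.\<close>

lemma no_ergodic_limit:
  fixes G :: "('g, 'b) monoid_scheme" (structure) and \<nu> :: "'x::polish_space measure"
  assumes G: "group G" and T: "kazhdan_T G" and \<nu>: "prob_space \<nu>" and s\<nu>: "sets \<nu> = sets borel"
    and gen: "generating_prob G \<mu>"
    and b: "\<And>n. b n \<in> stationary_actions G \<mu> \<nu>" and erg: "\<And>n. ergodic_action G \<nu> (b n)"
    and A[measurable]: "A \<in> sets \<nu>" and B[measurable]: "B \<in> sets \<nu>" and AB: "A \<inter> B = {}"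
    and meq: "measure \<nu> A = measure \<nu> B" and mpos: "0 < measure \<nu> A"
    and limA: "\<And>g. g \<in> carrier G \<Longrightarrow> (\<lambda>n. \<integral>\<^sup>+x. ennreal \<bar>U1_ind \<nu> (b n g) A x - indicator A x\<bar> \<partial>\<nu>) \<longlonglongrightarrow> 0"
    and limB: "\<And>g. g \<in> carrier G \<Longrightarrow> (\<lambda>n. \<integral>\<^sup>+x. ennreal \<bar>U1_ind \<nu> (b n g) B x - indicator B x\<bar> \<partial>\<nu>) \<longlonglongrightarrow> 0"
  shows False
proof -
  interpret prob_space \<nu> by fact
  let ?N = "nat_copies \<nu>" and ?U = "half_density_sum \<nu> b"
  have nb: "b n \<in> nonsingular_actions G \<nu>" for n by (rule stationary_nonsingular[OF b])
  have aut: "nonsingular_aut \<nu> (b n g)" if "g \<in> carrier G" for n g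
    using nonsingular_actions_aut[OF nb that] .
  obtain C :: "nat \<Rightarrow> 'x set" where C: "\<And>k. C k \<in> sets \<nu>"
    and total: "\<And>f::'x \<Rightarrow> complex. integrable \<nu> f \<Longrightarrow> (\<And>k. (LINT x:C k|\<nu>. f x) = 0) \<Longrightarrow> AE x in \<nu>. f x = 0"
    using countable_total_family[OF finite_measure_axioms s\<nu>] by blast
  define iA where "iA x = complex_of_real (indicator A x)" for x
  define iB where "iB x = complex_of_real (indicator B x)" for x
  have [measurable]: "iA \<in> borel_measurable \<nu>" "iB \<in> borel_measurable \<nu>" unfolding iA_def iB_def by measurable
  \<comment> \<open>The squared norm of 1_A - 1_B is 2 \<nu>(A), as A and B are disjoint and of
    equal measure.\<close>
  define s where "s = 1 / sqrt (2 * measure \<nu> A)"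
  have s2: "s\<^sup>2 = 1 / (2 * measure \<nu> A)" using mpos by (simp add: s_def power_divide)
  define v where "v n z = (if fst z = n then complex_of_real s * (iA (snd z) - iB (snd z)) else 0)" for n and z :: "nat \<times> 'x"
  have vm[measurable]: "v n \<in> borel_measurable ?N" for n
    by (rule nat_copies_measurableI) (simp only: v_def fst_conv snd_conv, measurable)
  have single: "(\<integral>\<^sup>+z. f z \<partial>?N) = (\<integral>\<^sup>+x. f (n, x) \<partial>\<nu>)"
    if "f \<in> borel_measurable ?N" "\<And>m x. m \<noteq> n \<Longrightarrow> f (m, x) = 0" for f :: "nat \<times> 'x \<Rightarrow> ennreal" and n
  proof -
    have "(\<integral>\<^sup>+z. f z \<partial>?N) = (\<Sum>m. \<integral>\<^sup>+x. f (m, x) \<partial>\<nu>)" by (rule nn_integral_nat_copies[OF that(1)])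
    also have "\<dots> = (\<Sum>m\<in>{n}. \<integral>\<^sup>+x. f (m, x) \<partial>\<nu>)" by (rule suminf_finite) (auto simp: that(2))
    finally show ?thesis by simp
  qed
  have nv: "(\<integral>\<^sup>+z. ennreal ((cmod (v n z))\<^sup>2) \<partial>?N) = ennreal 1" for n
  proof -
    have "(\<integral>\<^sup>+z. ennreal ((cmod (v n z))\<^sup>2) \<partial>?N) = (\<integral>\<^sup>+x. ennreal ((cmod (v n (n, x)))\<^sup>2) \<partial>\<nu>)"
      by (rule single) (auto simp: v_def)
    also have "\<dots> = (\<integral>\<^sup>+x. ennreal (s\<^sup>2) * indicator (A \<union> B) x \<partial>\<nu>)"
      using AB by (intro nn_integral_cong) (auto simp: v_def iA_def iB_def indicator_def norm_mult)
    also have "\<dots> = ennreal (s\<^sup>2) * emeasure \<nu> (A \<union> B)" by (rule nn_integral_cmult_indicator) auto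
    also have "emeasure \<nu> (A \<union> B) = ennreal (2 * measure \<nu> A)"
      using AB meq by (simp add: emeasure_eq_measure finite_measure_Union)
    also have "ennreal (s\<^sup>2) * ennreal (2 * measure \<nu> A) = ennreal 1"
      using mpos by (subst ennreal_mult[symmetric]) (auto simp: s2)
    finally show ?thesis .
  qed
  have vL: "v n \<in> L2 ?N" for n by (rule L2I_nn(1)[where c=1]) (auto simp: nv)
  have v1: "sqn ?N (v n) = 1" for n using nv[of n] unfolding nn_integral_sqn[OF vL] by simp
  show False
  proof (rule half_density_sum_spectral_gap[OF G T nb C total vL v1])
    fix n w assume wL: "w \<in> L2 ?N"
      and winv: "\<And>g. g \<in> carrier G \<Longrightarrow> AE z in ?N. ?U g w z = w z"
    note ws = L2_slice[OF wL, of n]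
    have "\<exists>k. AE x in \<nu>. w (n, x) = k"
    proof (rule ergodic_invariant_half_density[OF G \<nu> gen b erg L2_measurable[OF ws] L2_integrable[OF ws]])
      fix g assume "g \<in> carrier G"
      from AE_nat_copies_slice[OF winv[OF this]]
      show "AE x in \<nu>. complex_of_real (sqrt (RN_jacobian \<nu> (b n g) x)) * w (n, aut_inv \<nu> (b n g) x) = w (n, x)"
        by (simp add: half_density_sum_slice half_density_def)
    qed
    then obtain k where k: "AE x in \<nu>. w (n, x) = k" by blast
    have i: "integrable \<nu> iA" "integrable \<nu> iB"
      unfolding iA_def iB_def by (auto intro!: integrable_real_indicator simp: top.not_eq_extremum[symmetric])
    have "ip ?N (v n) w = (\<integral>x. v n (n, x) * cnj (w (n, x)) \<partial>\<nu>)"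
      unfolding ip_def by (rule integral_nat_copies_single[OF L2_ip_integrable[OF vL wL]]) (simp add: v_def)
    also have "\<dots> = (\<integral>x. complex_of_real s * cnj k * (iA x - iB x) \<partial>\<nu>)"
    proof (rule integral_cong_AE)
      note [measurable] = nat_copies_measurable_slice[OF vm] L2_measurable[OF ws]
      show "(\<lambda>x. v n (n, x) * cnj (w (n, x))) \<in> borel_measurable \<nu>" by measurable
      show "(\<lambda>x. complex_of_real s * cnj k * (iA x - iB x)) \<in> borel_measurable \<nu>" by measurable
      show "AE x in \<nu>. v n (n, x) * cnj (w (n, x)) = complex_of_real s * cnj k * (iA x - iB x)"
        using k by eventually_elim (simp add: v_def)
    qed
    also have "\<dots> = complex_of_real s * cnj k * ((\<integral>x. iA x \<partial>\<nu>) - (\<integral>x. iB x \<partial>\<nu>))"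
      using i by simp
    also have "(\<integral>x. iA x \<partial>\<nu>) - (\<integral>x. iB x \<partial>\<nu>) = 0"
      unfolding iA_def iB_def using meq by (simp add: integral_complex_of_real)
    finally show "ip ?N (v n) w = 0" by simp
  next
    fix g assume g: "g \<in> carrier G"
    define dA where "dA n = (\<integral>\<^sup>+x. ennreal \<bar>U1_ind \<nu> (b n g) A x - indicator A x\<bar> \<partial>\<nu>)" for n
    define dB where "dB n = (\<integral>\<^sup>+x. ennreal \<bar>U1_ind \<nu> (b n g) B x - indicator B x\<bar> \<partial>\<nu>)" for n
    \<comment> \<open>The factor 2 comes from |a - b|^2 \<le> 2|a|^2 + 2|b|^2, applied to the
      displacements of 1_A and 1_B.\<close>
    have bound: "ennreal (sqn ?N (\<lambda>z. ?U g (v n) z - v n z)) \<le> ennreal (2 * s\<^sup>2) * (dA n + dB n)" for n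
    proof -
      let ?hA = "half_density \<nu> (b n g) iA" and ?hB = "half_density \<nu> (b n g) iB"
      note [measurable] = half_density_measurable[OF aut[OF g], of iA n] half_density_measurable[OF aut[OF g], of iB n]
      have UvL: "?U g (v n) \<in> L2 ?N" by (rule half_density_sum_L2(1)[where b=b and g=g, OF aut[OF g] vL])
      note [measurable] = L2_measurable[OF UvL]
      have "ennreal (sqn ?N (\<lambda>z. ?U g (v n) z - v n z)) = (\<integral>\<^sup>+z. ennreal ((cmod (?U g (v n) z - v n z))\<^sup>2) \<partial>?N)"
        by (rule nn_integral_sqn[symmetric, OF L2_diff[OF UvL vL]])
      also have "\<dots> = (\<integral>\<^sup>+x. ennreal ((cmod (?U g (v n) (n, x) - v n (n, x)))\<^sup>2) \<partial>\<nu>)"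
        by (rule single) (auto simp: v_def half_density_sum_slice half_density_def)
      also have "\<dots> \<le> (\<integral>\<^sup>+x. ennreal (2 * s\<^sup>2) * (ennreal ((cmod (?hA x - iA x))\<^sup>2) + ennreal ((cmod (?hB x - iB x))\<^sup>2)) \<partial>\<nu>)"
      proof (rule nn_integral_mono)
        fix x
        have "?U g (v n) (n, x) - v n (n, x) = complex_of_real s * ((?hA x - iA x) - (?hB x - iB x))"
          by (simp add: half_density_sum_slice half_density_def v_def algebra_simps)
        then have "(cmod (?U g (v n) (n, x) - v n (n, x)))\<^sup>2 = s\<^sup>2 * (cmod ((?hA x - iA x) - (?hB x - iB x)))\<^sup>2"
          by (simp add: norm_mult power_mult_distrib)
        also have "\<dots> \<le> s\<^sup>2 * (2 * (cmod (?hA x - iA x))\<^sup>2 + 2 * (cmod (?hB x - iB x))\<^sup>2)"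
          by (intro mult_left_mono cmod_diff_sq) simp
        finally have "(cmod (?U g (v n) (n, x) - v n (n, x)))\<^sup>2 \<le> (2 * s\<^sup>2) * ((cmod (?hA x - iA x))\<^sup>2 + (cmod (?hB x - iB x))\<^sup>2)"
          by (simp add: algebra_simps)
        then show "ennreal ((cmod (?U g (v n) (n, x) - v n (n, x)))\<^sup>2) \<le> ennreal (2 * s\<^sup>2) * (ennreal ((cmod (?hA x - iA x))\<^sup>2) + ennreal ((cmod (?hB x - iB x))\<^sup>2))"
          by (subst ennreal_plus[symmetric], simp, simp, subst ennreal_mult[symmetric]) (auto intro: ennreal_leI)
      qed
      also have "\<dots> = ennreal (2 * s\<^sup>2) * ((\<integral>\<^sup>+x. ennreal ((cmod (?hA x - iA x))\<^sup>2) \<partial>\<nu>) + (\<integral>\<^sup>+x. ennreal ((cmod (?hB x - iB x))\<^sup>2) \<partial>\<nu>))"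
        by (simp add: nn_integral_cmult nn_integral_add)
      also have "\<dots> \<le> ennreal (2 * s\<^sup>2) * (dA n + dB n)"
        unfolding dA_def dB_def
        using half_density_indicator_displacement[OF aut[OF g] A, of n, folded iA_def]
          half_density_indicator_displacement[OF aut[OF g] B, of n, folded iB_def]
        by (intro mult_left_mono add_mono) (simp_all add: iA_def[abs_def] iB_def[abs_def])
      finally show ?thesis .
    qed
    have "(\<lambda>n. ennreal (2 * s\<^sup>2) * (dA n + dB n)) \<longlonglongrightarrow> ennreal (2 * s\<^sup>2) * (0 + 0)"
      using limA[OF g] limB[OF g] unfolding dA_def dB_def
      by (intro ennreal_tendsto_cmult tendsto_add) auto
    then have "(\<lambda>n. ennreal (2 * s\<^sup>2) * (dA n + dB n)) \<longlonglongrightarrow> 0" by simp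
    then have "(\<lambda>n. ennreal (sqn ?N (\<lambda>z. ?U g (v n) z - v n z))) \<longlonglongrightarrow> 0"
      by (rule tendsto_zero_ennreal_bound[OF always_eventually[OF allI[OF bound]]])
    then show "(\<lambda>n. sqn ?N (\<lambda>z. ?U g (v n) z - v n z)) \<longlonglongrightarrow> 0"
      by (simp flip: ennreal_0)
  qed
qed

section \<open>The weak topology\<close>

text \<open>Subbasic sets are centred at arbitrary actions \<open>a0\<close>, so convergence to
  \<open>a\<close> enters them through the triangle inequality. Induction over the generated
  topology then covers finite intersections and unions.\<close>

lemma eventually_in_weak_open:
  assumes \<nu>: "prob_space \<nu>" and a: "a \<in> nonsingular_actions G \<nu>" and a': "\<And>n. a' n \<in> nonsingular_actions G \<nu>"
    and lim: "\<And>g A. g \<in> carrier G \<Longrightarrow> A \<in> sets \<nu> \<Longrightarrow> (\<lambda>n. weak_dist \<nu> A (a' n g) (a g)) \<longlonglongrightarrow> 0"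
    and W: "openin (weak_action_topology G \<nu>) W" "a \<in> W"
  shows "\<forall>\<^sub>F n in sequentially. a' n \<in> W"
proof -
  interpret prob_space \<nu> by fact
  let ?S = "{{b \<in> nonsingular_actions G \<nu>. weak_dist \<nu> A (b g) (a g) < ennreal \<epsilon>} | a g A \<epsilon>.
        a \<in> nonsingular_actions G \<nu> \<and> g \<in> carrier G \<and> A \<in> sets \<nu> \<and> \<epsilon> > 0}"
  have "generate_topology_on ?S W"
    using W(1) by (simp add: weak_action_topology_def openin_topology_generated_by_iff)
  then show ?thesis using W(2)
  proof (induction rule: generate_topology_on.induct)
    case Empty then show ?case by simp
  next
    case (Int X Y) then show ?case by (auto intro: eventually_conj)
  next
    case (UN K)
    then obtain X where X: "X \<in> K" "a \<in> X" by auto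
    then have "\<forall>\<^sub>F n in sequentially. a' n \<in> X" using UN by auto
    then show ?case by eventually_elim (use X in auto)
  next
    case (Basis X)
    then obtain a0 g A \<epsilon> where X: "X = {b \<in> nonsingular_actions G \<nu>. weak_dist \<nu> A (b g) (a0 g) < ennreal \<epsilon>}"
      and a0: "a0 \<in> nonsingular_actions G \<nu>" and g: "g \<in> carrier G" and A: "A \<in> sets \<nu>" by blast
    have lt: "weak_dist \<nu> A (a g) (a0 g) < ennreal \<epsilon>" using Basis X by simp
    have "(\<lambda>n. weak_dist \<nu> A (a' n g) (a g) + weak_dist \<nu> A (a g) (a0 g)) \<longlonglongrightarrow> 0 + weak_dist \<nu> A (a g) (a0 g)"
      by (intro tendsto_add lim g A tendsto_const)
    then have "\<forall>\<^sub>F n in sequentially. weak_dist \<nu> A (a' n g) (a g) + weak_dist \<nu> A (a g) (a0 g) < ennreal \<epsilon>"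
      using lt by (intro order_tendstoD(2)) auto
    then show ?case
    proof eventually_elim
      case (elim n)
      have "weak_dist \<nu> A (a' n g) (a0 g) \<le> weak_dist \<nu> A (a' n g) (a g) + weak_dist \<nu> A (a g) (a0 g)"
        by (intro weak_dist_triangle nonsingular_actions_aut[OF _ g] a a' a0 A)
      then show ?case using elim a' by (simp add: X)
    qed
  qed
qed

text \<open>In place of a neighbourhood base, the n-th neighbourhood controls the sets A and B and
  the first n + 1 terms of an enumeration of G, up to 1/(n + 1). Choosing an ergodic action in each
  yields a sequence that contradicts \<open>no_ergodic_limit\<close>, because the shrunk action
  fixes A and B pointwise.\<close>

lemma shrunk_not_limit_of_ergodic:
  fixes G :: "('g, 'b) monoid_scheme" (structure) and \<nu> :: "'x::polish_space measure"
  assumes G: "group G" and count: "countable (carrier G)" and T: "kazhdan_T G"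
    and \<nu>: "prob_space \<nu>" and s\<nu>: "sets \<nu> = sets borel" and gen: "generating_prob G \<mu>"
    and shr: "shrinking \<nu> c \<phi> \<psi> Y" and a: "a \<in> stationary_actions G \<mu> \<nu>"
    and AB: "A \<in> sets \<nu>" "B \<in> sets \<nu>" "A \<inter> B = {}" "(A \<union> B) \<inter> Y = {}"
    and half: "measure \<nu> A = measure \<nu> B" "0 < measure \<nu> A"
  shows "(\<lambda>g\<in>carrier G. shrunk \<phi> \<psi> Y (a g)) \<notin>
    stationary_topology G \<mu> \<nu> closure_of {a \<in> stationary_actions G \<mu> \<nu>. ergodic_action G \<nu> a}"
proof
  interpret group G by fact
  interpret shrinking_space \<nu> c \<phi> \<psi> Y
    using \<nu> s\<nu> shr by (simp add: shrinking_space_def shrinking_space_axioms_def)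
  define a' where "a' = (\<lambda>g\<in>carrier G. sh (a g))"
  assume "(\<lambda>g\<in>carrier G. sh (a g)) \<in>
    stationary_topology G \<mu> \<nu> closure_of {a \<in> stationary_actions G \<mu> \<nu>. ergodic_action G \<nu> a}"
  then have cl: "\<And>W. openin (stationary_topology G \<mu> \<nu>) W \<Longrightarrow> a' \<in> W \<Longrightarrow>
      \<exists>b\<in>W. b \<in> stationary_actions G \<mu> \<nu> \<and> ergodic_action G \<nu> b"
    unfolding in_closure_of a'_def by blast
  have prob: "prob_on_group G \<mu>" using gen by (simp add: generating_prob_def)
  have a's: "a' \<in> stationary_actions G \<mu> \<nu>"
    unfolding a'_def by (rule shrunk_stationary[OF G prob a])
  note a'n = stationary_nonsingular[OF a's]
  define e where "e = from_nat_into (carrier G)"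
  have eC: "e i \<in> carrier G" for i
    unfolding e_def using one_closed by (intro from_nat_into) auto
  define Z where "Z D i n = {b \<in> nonsingular_actions G \<nu>. weak_dist \<nu> D (b (e i)) (a' (e i)) < ennreal (inverse (real (Suc n)))}" for D i n
  have oZ: "openin (weak_action_topology G \<nu>) (Z D i n)" if "D \<in> sets \<nu>" for D i n
    unfolding weak_action_topology_def
  proof (rule topology_generated_by_Basis, intro CollectI exI conjI)
    show "Z D i n = {b \<in> nonsingular_actions G \<nu>. weak_dist \<nu> D (b (e i)) (a' (e i)) < ennreal (inverse (real (Suc n)))}"
      by (simp add: Z_def)
  qed (use a'n eC that in auto)
  have aZ: "a' \<in> Z D i n" for D i n
    using a'n by (simp add: Z_def weak_dist_def)
  have "\<exists>b. b \<in> stationary_actions G \<mu> \<nu> \<and> ergodic_action G \<nu> b \<and> (\<forall>i\<le>n. b \<in> Z A i n \<and> b \<in> Z B i n)" for n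
  proof -
    let ?W = "\<Inter>i\<in>{..n}. Z A i n \<inter> Z B i n"
    have "openin (weak_action_topology G \<nu>) ?W"
      using AB by (intro openin_INT2) (auto intro!: openin_Int oZ)
    then have "openin (stationary_topology G \<mu> \<nu>) (?W \<inter> stationary_actions G \<mu> \<nu>)"
      unfolding stationary_topology_def openin_subtopology by blast
    moreover have "a' \<in> ?W \<inter> stationary_actions G \<mu> \<nu>" using aZ a's by auto
    ultimately obtain b where "b \<in> ?W \<inter> stationary_actions G \<mu> \<nu>" "ergodic_action G \<nu> b"
      using cl[of "?W \<inter> stationary_actions G \<mu> \<nu>"] by auto
    then show ?thesis by (intro exI[of _ b]) auto
  qed
  then obtain b where b: "\<And>n. b n \<in> stationary_actions G \<mu> \<nu>" "\<And>n. ergodic_action G \<nu> (b n)"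
    and bZ: "\<And>n i. i \<le> n \<Longrightarrow> b n \<in> Z A i n \<and> b n \<in> Z B i n"
    by metis
  have lim: "(\<lambda>n. \<integral>\<^sup>+x. ennreal \<bar>U1_ind \<nu> (b n g) D x - indicator D x\<bar> \<partial>\<nu>) \<longlonglongrightarrow> 0"
    if g: "g \<in> carrier G" and D: "D \<in> sets \<nu>" "D \<inter> Y = {}" and Z: "\<And>n i. i \<le> n \<Longrightarrow> b n \<in> Z D i n" for g D
  proof -
    obtain i where i: "e i = g"
      unfolding e_def using from_nat_into_surj[OF count g] by blast
    have "nonsingular_aut \<nu> (sh (a g))"
      using nonsingular_actions_aut[OF a'n g] g by (simp add: a'_def)
    then have triv: "AE x in \<nu>. U1_ind \<nu> (a' g) D x = indicator D x"
      using U1_ind_shrunk_trivial[of "a g" D] D g by (simp add: a'_def)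
    have eq: "(\<integral>\<^sup>+x. ennreal \<bar>U1_ind \<nu> (b n g) D x - indicator D x\<bar> \<partial>\<nu>) = weak_dist \<nu> D (b n g) (a' g)" for n
      unfolding weak_dist_def by (intro nn_integral_cong_AE) (use triv in eventually_elim, simp)
    have "\<forall>\<^sub>F n in sequentially. weak_dist \<nu> D (b n g) (a' g) \<le> ennreal (inverse (real (Suc n)))"
      using eventually_ge_at_top[of i]
      by eventually_elim (use Z i in \<open>auto simp: Z_def intro: less_imp_le\<close>)
    moreover have "(\<lambda>n. ennreal (inverse (real (Suc n)))) \<longlonglongrightarrow> 0"
      using tendsto_ennrealI[OF LIMSEQ_inverse_real_of_nat] by simp
    ultimately show ?thesis unfolding eq by (rule tendsto_zero_ennreal_bound)
  qed
  show False
  proof (rule no_ergodic_limit[OF G T \<nu> s\<nu> gen b AB(1-3) half])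
    fix g assume g: "g \<in> carrier G"
    show "(\<lambda>n. \<integral>\<^sup>+x. ennreal \<bar>U1_ind \<nu> (b n g) A x - indicator A x\<bar> \<partial>\<nu>) \<longlonglongrightarrow> 0"
      using AB bZ by (intro lim g) auto
    show "(\<lambda>n. \<integral>\<^sup>+x. ennreal \<bar>U1_ind \<nu> (b n g) B x - indicator B x\<bar> \<partial>\<nu>) \<longlonglongrightarrow> 0"
      using AB bZ by (intro lim g) auto
  qed
qed

theorem theorem1p4:
  fixes G :: "('g, 'b) monoid_scheme"
    and \<mu> :: "'g \<Rightarrow> real"
    and \<nu> :: "'x::polish_space measure"
  assumes "group G"
    and "countable (carrier G)"
    and "kazhdan_T G"
    and "std_nonatomic_prob \<nu>"
    and "generating_prob G \<mu>"
  shows "nowhere_dense_in (stationary_topology G \<mu> \<nu>)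
           {a \<in> stationary_actions G \<mu> \<nu>. ergodic_action G \<nu> a}"
  unfolding nowhere_dense_in_def
proof (rule ccontr)
  let ?E = "{a \<in> stationary_actions G \<mu> \<nu>. ergodic_action G \<nu> a}"
  have \<nu>: "prob_space \<nu>" and s\<nu>: "sets \<nu> = sets borel" using assms(4) by (auto simp: std_nonatomic_prob_def)
  interpret prob_space \<nu> by fact
  assume "stationary_topology G \<mu> \<nu> interior_of (stationary_topology G \<mu> \<nu> closure_of ?E) \<noteq> {}"
  then obtain a O' where O': "openin (stationary_topology G \<mu> \<nu>) O'" "a \<in> O'"
    and sub: "O' \<subseteq> stationary_topology G \<mu> \<nu> closure_of ?E"
    by (auto simp: interior_of_def)
  then obtain W where W: "openin (weak_action_topology G \<nu>) W" and OW: "O' = W \<inter> stationary_actions G \<mu> \<nu>"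
    by (auto simp: stationary_topology_def openin_subtopology)
  have a: "a \<in> stationary_actions G \<mu> \<nu>" "a \<in> W" using O' OW by auto
  note na = stationary_nonsingular[OF a(1)]
  obtain c \<phi> \<psi> Y where shr: "\<And>n::nat. shrinking \<nu> (c n) (\<phi> n) (\<psi> n) (Y n)"
    and lim: "\<And>f::'x \<Rightarrow> real. integrable \<nu> f \<Longrightarrow>
          (\<lambda>n. \<integral>x. \<bar>indicator (Y n) x * f (\<psi> n x) - f x\<bar> \<partial>\<nu>) \<longlonglongrightarrow> 0"
    and halves: "\<And>n. \<exists>A\<in>sets \<nu>. \<exists>B\<in>sets \<nu>. A \<inter> B = {} \<and> (A \<union> B) \<inter> Y n = {} \<and>
          measure \<nu> A = measure \<nu> B \<and> 0 < measure \<nu> A"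
    using shrinking_sequence_exists[OF assms(4)] by blast
  have sp: "shrinking_space \<nu> (c n) (\<phi> n) (\<psi> n) (Y n)" for n
    using \<nu> s\<nu> shr by (simp add: shrinking_space_def shrinking_space_axioms_def)
  define a' where "a' n = (\<lambda>g\<in>carrier G. shrunk (\<phi> n) (\<psi> n) (Y n) (a g))" for n
  have prob: "prob_on_group G \<mu>" using assms(5) by (simp add: generating_prob_def)
  have a's: "a' n \<in> stationary_actions G \<mu> \<nu>" for n
    unfolding a'_def by (rule shrinking_space.shrunk_stationary[OF sp assms(1) prob a(1)])
  have "\<forall>\<^sub>F n in sequentially. a' n \<in> W"
  proof (rule eventually_in_weak_open[OF \<nu> na stationary_nonsingular[OF a's] _ W a(2)])
    fix g A assume g: "g \<in> carrier G" and A: "A \<in> sets \<nu>"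
    let ?D = "\<lambda>n f. \<integral>x. \<bar>indicator (Y n) x * f (\<psi> n x) - f x\<bar> \<partial>\<nu>"
    note T = nonsingular_actions_aut[OF na g]
    have T': "nonsingular_aut \<nu> (shrunk (\<phi> n) (\<psi> n) (Y n) (a g))" for n
      using nonsingular_actions_aut[OF stationary_nonsingular[OF a's[of n]] g] g by (simp add: a'_def)
    have le: "weak_dist \<nu> A (a' n g) (a g) \<le> ennreal (?D n (indicator A) + ?D n (U1_ind \<nu> (a g) A) + ?D n (\<lambda>_. 1))" for n
      using shrinking_space.weak_dist_shrunk[OF sp T T' A] g by (simp add: a'_def)
    have "(\<lambda>n. ?D n (indicator A) + ?D n (U1_ind \<nu> (a g) A) + ?D n (\<lambda>_. 1)) \<longlonglongrightarrow> 0 + 0 + 0"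
      using A by (intro tendsto_add lim integrable_U1_ind[OF T A])
        (auto intro!: integrable_real_indicator simp: top.not_eq_extremum[symmetric])
    then have "(\<lambda>n. ennreal (?D n (indicator A) + ?D n (U1_ind \<nu> (a g) A) + ?D n (\<lambda>_. 1))) \<longlonglongrightarrow> 0"
      using tendsto_ennrealI by fastforce
    then show "(\<lambda>n. weak_dist \<nu> A (a' n g) (a g)) \<longlonglongrightarrow> 0"
      by (rule tendsto_zero_ennreal_bound[OF always_eventually[OF allI[OF le]]])
  qed
  \<comment> \<open>Being stationary, \<open>a' n\<close> lies in the relatively open set
    \<open>O'\<close> and so in the closure of the ergodic actions, although it is trivial off
    \<open>Y n\<close>.\<close>
  then obtain n where "a' n \<in> W" by (auto simp: eventually_sequentially)
  then have "a' n \<in> stationary_topology G \<mu> \<nu> closure_of ?E" using a's sub OW by auto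
  moreover obtain A B where "A \<in> sets \<nu>" "B \<in> sets \<nu>" "A \<inter> B = {}" "(A \<union> B) \<inter> Y n = {}"
      "measure \<nu> A = measure \<nu> B" "0 < measure \<nu> A"
    using halves[of n] by blast
  ultimately show False
    using shrunk_not_limit_of_ergodic[OF assms(1-3) \<nu> s\<nu> assms(5) shr a(1)] unfolding a'_def by blast
qed

end
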